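(* For all sufficiently small $\varepsilon>0$, the two-step elliptic model with $$\nu=1+\varepsilon,\qquad \alpha=\frac12,\qquad q=\frac{\varepsilon}{16}$$ has a transverse heteroclinic connection from the long-axis periodic orbit (corresponding to the fixed point $X=(0,0)$ of the reduced return map) to the short-axis periodic orbit (corresponding to the fixed point $Y=(\pi/2,0)$). Its reduced return orbit has exponential tails (it converges exponentially in the return index to $X$ as $n\to-\infty$ and to $Y$ as $n\to+\infty$) and stays in the branch with two inner transmissions and one outer reflection per return, uniformly away from the singular boundaries (tangency and critical transmission) for this fixed $\varepsilon$.
   Context: Two-step elliptic model (normalized). Let $\nu>1$ and $\Psi_\nu(x,y)=x^2+\nu y^2$. The inner ellipse is $\{\Psi_\nu=\alpha^2\}$ and the outer ellipse is $\{\Psi_\nu=1\}$, $0<\alpha<1$. A particle moves on straight lines with speed $1$ inside the inner ellipse and with speed $q\in(0,1)$ in the annulus between the ellipses. At the outer ellipse it is reflected specularly. When it crosses the inner ellipse (in either direction), the tangential velocity is preserved and the normal velocity keeps its sign and changes magnitude so that the speed takes the value of the new region; outward transmission requires the squared incident normal speed to be strictly larger than $1-q^2$ (equality is critical transmission). Reduced section. With $\nu=1+\varepsilon$, points of the inner ellipse are $r_\varepsilon(\theta)=\alpha(\cos\theta,\sin\theta/\sqrt{1+\varepsilon})$, with outward unit normal $\mathbf n_\varepsilon(\theta)$ and counterclockwise unit tangent $\mathbf t_\varepsilon(\theta)$. The section consists of states immediately before transmission from the annulus into the inner ellipse, with coordinates $(\theta,p)$, $|p|<1$, and velocity $q(-\sqrt{1-p^2}\,\mathbf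 n_\varepsilon(\theta)+p\,\mathbf t_\varepsilon(\theta))$. The antipodal symmetry $(R,V)\mapsto(-R,-V)$ is divided out, so $\theta$ is taken modulo $\pi$. Reduced return map. One return consists of: inner entry transmission; one chord of the inner ellipse; inner exit transmission; annular flight; one outer reflection; return annular flight to the inner ellipse; the final state is taken just before the next entry transmission. This is the regular branch with two inner transmissions and one outer reflection per return. The tangential fraction of the annular velocity just after exit transmission is denoted $w$; critical transmission corresponds to $|w|=1$, tangency on the section to $|p|=1$. "Uniformly away from the singular boundaries" means that the closure of the return orbit is a compact subset of the regular domain of this branch, with positive margins from tangency and critical transmission. The long-axis (resp. short-axis) periodic orbit is the periodic motion along the $x$-axis (resp. $y$-axis); in the reduced section they are the fixed points $X=(0,0)$, $Y=(\pi/2,0)$. A transverse heteroclinic connection means: $X$ and $Y$ are hyperbolic saddle fixed points of the return map and there is an orbit in $W^u(X)\cap W^s(Y)$ along which these two invariant curves have distinct tangent lines. *)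

theory Defs
  imports "HOL-Analysis.Analysis"
begin

section \<open>The two-step elliptic model\<close>

type_synonym plane = "real \<times> real"

definition Psi :: "real \<Rightarrow> plane \<Rightarrow> real" where
  "Psi \<nu> R = (fst R)\<^sup>2 + \<nu> * (snd R)\<^sup>2"

definition inner_region :: "real \<Rightarrow> real \<Rightarrow> plane set" where
  "inner_region \<nu> \<alpha> = {R. Psi \<nu> R < \<alpha>\<^sup>2}"

definition annulus :: "real \<Rightarrow> real \<Rightarrow> plane set" where
  "annulus \<nu> \<alpha> = {R. \<alpha>\<^sup>2 < Psi \<nu> R \<and> Psi \<nu> R < 1}"

definition inner_ellipse :: "real \<Rightarrow> real \<Rightarrow> plane set" where
  "inner_ellipse \<nu> \<alpha> = {R. Psi \<nu> R = \<alpha>\<^sup>2}"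

definition outer_ellipse :: "real \<Rightarrow> plane set" where
  "outer_ellipse \<nu> = {R. Psi \<nu> R = 1}"

text \<open>Outward unit normal of the level curve of Psi through R: the normalised gradient
  (the common factor 2 is dropped). The tangent is the normal turned by a quarter turn
  counterclockwise.\<close>

definition unit_normal :: "real \<Rightarrow> plane \<Rightarrow> plane" where
  "unit_normal \<nu> R = sgn (fst R, \<nu> * snd R)"

definition unit_tangent :: "real \<Rightarrow> plane \<Rightarrow> plane" where
  "unit_tangent \<nu> R = (- snd (unit_normal \<nu> R), fst (unit_normal \<nu> R))"

definition flight :: "plane set \<Rightarrow> plane \<Rightarrow> plane \<Rightarrow> plane \<Rightarrow> bool" where
  "flight U R V R' \<longleftrightarrow>
     (\<exists>t>0. R' = R + t *\<^sub>R V \<and> (\<forall>s\<in>{0<..<t}. R + s *\<^sub>R V \<in> U))"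

text \<open>Velocity after transmission at R into a region where the speed is c. The formula has
  this meaning only if the radicand is positive; for outward transmission this is the
  condition imposed in \<open>regular_branch\<close> below, for inward transmission it is automatic.\<close>

definition transmit :: "real \<Rightarrow> real \<Rightarrow> plane \<Rightarrow> plane \<Rightarrow> plane" where
  "transmit \<nu> c R V =
     (let n = unit_normal \<nu> R; t = unit_tangent \<nu> R; vt = V \<bullet> t
      in vt *\<^sub>R t + (sgn (V \<bullet> n) * sqrt (c\<^sup>2 - vt\<^sup>2)) *\<^sub>R n)"

definition reflect :: "real \<Rightarrow> plane \<Rightarrow> plane \<Rightarrow> plane" where
  "reflect \<nu> R V = V - (2 * (V \<bullet> unit_normal \<nu> R)) *\<^sub>R unit_normal \<nu> R"


section \<open>The reduced section and the reduced return map\<close>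

text \<open>Points of the section are written as pairs (theta, p) of real numbers; theta is only
  meaningful modulo pi, so a point of the reduced section has many representatives.\<close>

definition section_point :: "real \<Rightarrow> real \<Rightarrow> real \<Rightarrow> plane" where
  "section_point \<nu> \<alpha> \<theta> = (\<alpha> * cos \<theta>, \<alpha> * sin \<theta> / sqrt \<nu>)"

definition section_velocity :: "real \<Rightarrow> real \<Rightarrow> real \<Rightarrow> real \<times> real \<Rightarrow> plane" where
  "section_velocity \<nu> \<alpha> q z =
     (let R = section_point \<nu> \<alpha> (fst z); p = snd z
      in q *\<^sub>R (- sqrt (1 - p\<^sup>2) *\<^sub>R unit_normal \<nu> R + p *\<^sub>R unit_tangent \<nu> R))"

text \<open>One return from z to z' in the branch with two inner transmissions and one outer
  reflection: R0, V0 before inner entry; R1 inner exit; R2 outer reflection; (R3, V3) before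
  the next inner entry. The number w is the tangential fraction of the annular velocity V2
  just after exit. By the two alternatives at the end (the antipodal symmetry), all
  representatives of the same return state modulo pi occur as z'.\<close>

definition regular_branch ::
  "real \<Rightarrow> real \<Rightarrow> real \<Rightarrow> real \<times> real \<Rightarrow> real \<Rightarrow> real \<times> real \<Rightarrow> bool" where
  "regular_branch \<nu> \<alpha> q z w z' \<longleftrightarrow>
     \<bar>snd z\<bar> < 1 \<and> \<bar>snd z'\<bar> < 1 \<and>
     (\<exists>R0 V0 V1 R1 V2 R2 V3 R3.
        R0 = section_point \<nu> \<alpha> (fst z) \<and> V0 = section_velocity \<nu> \<alpha> q z \<and>
        V1 = transmit \<nu> 1 R0 V0 \<and>
        flight (inner_region \<nu> \<alpha>) R0 V1 R1 \<and> R1 \<in> inner_ellipse \<nu> \<alpha> \<and>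
        V1 \<bullet> unit_normal \<nu> R1 > 0 \<and> (V1 \<bullet> unit_normal \<nu> R1)\<^sup>2 > 1 - q\<^sup>2 \<and>
        V2 = transmit \<nu> q R1 V1 \<and> w = (V2 \<bullet> unit_tangent \<nu> R1) / q \<and>
        flight (annulus \<nu> \<alpha>) R1 V2 R2 \<and> R2 \<in> outer_ellipse \<nu> \<and>
        V3 = reflect \<nu> R2 V2 \<and>
        flight (annulus \<nu> \<alpha>) R2 V3 R3 \<and> R3 \<in> inner_ellipse \<nu> \<alpha> \<and>
        (R3 = section_point \<nu> \<alpha> (fst z') \<and> V3 = section_velocity \<nu> \<alpha> q z' \<or>
         - R3 = section_point \<nu> \<alpha> (fst z') \<and> - V3 = section_velocity \<nu> \<alpha> q z'))"

text \<open>The graph of the reduced return map, seen on representatives.\<close>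

definition return_rel :: "real \<Rightarrow> real \<Rightarrow> real \<Rightarrow> real \<times> real \<Rightarrow> real \<times> real \<Rightarrow> bool" where
  "return_rel \<nu> \<alpha> q z z' \<longleftrightarrow> (\<exists>w. regular_branch \<nu> \<alpha> q z w z')"

definition regular_domain :: "real \<Rightarrow> real \<Rightarrow> real \<Rightarrow> (real \<times> real) set" where
  "regular_domain \<nu> \<alpha> q = {z. \<exists>z'. return_rel \<nu> \<alpha> q z z'}"

text \<open>The return map as a function on representatives, meaningful on the regular domain: of
  the representatives of the return state, take the one whose angle differs from the initial
  angle by an element of (-pi/2, pi/2]. Near a fixed point this is the local lift fixing that
  point. The cut at pi/2 is irrelevant below, since this function is used only at fixed points.\<close>

definition return_map :: "real \<Rightarrow> real \<Rightarrow> real \<Rightarrow> real \<times> real \<Rightarrow> real \<times> real" where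
  "return_map \<nu> \<alpha> q z =
     (THE z'. return_rel \<nu> \<alpha> q z z' \<and> fst z' - fst z \<in> {- pi / 2 <.. pi / 2})"


section \<open>Hyperbolic saddles and their invariant curves\<close>

definition hyperbolic_saddle :: "('a::real_normed_vector \<Rightarrow> 'a) \<Rightarrow> 'a \<Rightarrow> bool" where
  "hyperbolic_saddle f P \<longleftrightarrow>
     f P = P \<and>
     (\<exists>D a b u v. (f has_derivative D) (at P) \<and>
        u \<noteq> 0 \<and> D u = a *\<^sub>R u \<and> \<bar>a\<bar> < 1 \<and>
        v \<noteq> 0 \<and> D v = b *\<^sub>R v \<and> \<bar>b\<bar> > 1)"

text \<open>Stable sets of the (multivalued, partial) dynamics given by a relation S; unstable sets
  are the stable sets of the converse relation. For \<open>return_rel\<close>, the members of a sequence are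
  representatives which may be chosen freely modulo pi, so that convergence to P in the plane is
  convergence modulo pi.\<close>

definition stable_set :: "('a \<Rightarrow> 'a \<Rightarrow> bool) \<Rightarrow> 'a::topological_space \<Rightarrow> 'a set" where
  "stable_set S P = {z. \<exists>u. u 0 = z \<and> (\<forall>n. S (u n) (u (Suc n))) \<and> u \<longlonglongrightarrow> P}"

definition unstable_set :: "('a \<Rightarrow> 'a \<Rightarrow> bool) \<Rightarrow> 'a::topological_space \<Rightarrow> 'a set" where
  "unstable_set S P = stable_set S\<inverse>\<inverse> P"

text \<open>L is the tangent line at z of the stable curve of P: it is spanned by the velocity at z of
  a regular C1 arc through z in the stable set. Uniform convergence of the orbits
  along the arc forces some iterate of the arc to lie in the local stable curve of P, hence the arc
  to be a piece of the immersed stable curve.\<close>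

definition stable_tangent_line ::
  "('a \<Rightarrow> 'a \<Rightarrow> bool) \<Rightarrow> 'a::real_normed_vector \<Rightarrow> 'a \<Rightarrow> 'a set \<Rightarrow> bool" where
  "stable_tangent_line S P z L \<longleftrightarrow>
     (\<exists>\<gamma> u. \<gamma> C1_differentiable_on {-1<..<1} \<and> \<gamma> 0 = z \<and>
        (\<forall>s\<in>{-1<..<1}. vector_derivative \<gamma> (at s) \<noteq> 0) \<and>
        (\<forall>s\<in>{-1<..<1}. u 0 s = \<gamma> s \<and> (\<forall>n. S (u n s) (u (Suc n) s))) \<and>
        uniform_limit {-1<..<1} u (\<lambda>_. P) sequentially \<and>
        L = span {vector_derivative \<gamma> (at 0)})"

definition unstable_tangent_line ::
  "('a \<Rightarrow> 'a \<Rightarrow> bool) \<Rightarrow> 'a::real_normed_vector \<Rightarrow> 'a \<Rightarrow> 'a set \<Rightarrow> bool" where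
  "unstable_tangent_line S P z L \<longleftrightarrow> stable_tangent_line S\<inverse>\<inverse> P z L"

definition saddle_of_return_map :: "real \<Rightarrow> real \<Rightarrow> real \<Rightarrow> real \<times> real \<Rightarrow> bool" where
  "saddle_of_return_map \<nu> \<alpha> q P \<longleftrightarrow>
     P \<in> interior (regular_domain \<nu> \<alpha> q) \<and> hyperbolic_saddle (return_map \<nu> \<alpha> q) P"

definition transverse_heteroclinic_orbit ::
  "real \<Rightarrow> real \<Rightarrow> real \<Rightarrow> real \<times> real \<Rightarrow> real \<times> real \<Rightarrow> (int \<Rightarrow> real \<times> real) \<Rightarrow> bool" where
  "transverse_heteroclinic_orbit \<nu> \<alpha> q P Q z \<longleftrightarrow>
     saddle_of_return_map \<nu> \<alpha> q P \<and> saddle_of_return_map \<nu> \<alpha> q Q \<and>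
     (\<forall>n. return_rel \<nu> \<alpha> q (z n) (z (n + 1))) \<and>
     (\<forall>n. z n \<in> unstable_set (return_rel \<nu> \<alpha> q) P \<inter> stable_set (return_rel \<nu> \<alpha> q) Q) \<and>
     (\<forall>n. \<exists>Lu Ls. unstable_tangent_line (return_rel \<nu> \<alpha> q) P (z n) Lu \<and>
        stable_tangent_line (return_rel \<nu> \<alpha> q) Q (z n) Ls \<and> Lu \<noteq> Ls)"

definition exponential_tails :: "(int \<Rightarrow> 'a::metric_space) \<Rightarrow> 'a \<Rightarrow> 'a \<Rightarrow> bool" where
  "exponential_tails z P Q \<longleftrightarrow>
     (\<exists>C \<rho>. 0 < \<rho> \<and> \<rho> < 1 \<and>
        (\<forall>n::nat. dist (z (- int n)) P \<le> C * \<rho> ^ n \<and> dist (z (int n)) Q \<le> C * \<rho> ^ n))"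

definition uniformly_regular_orbit ::
  "real \<Rightarrow> real \<Rightarrow> real \<Rightarrow> (int \<Rightarrow> real \<times> real) \<Rightarrow> bool" where
  "uniformly_regular_orbit \<nu> \<alpha> q z \<longleftrightarrow>
     compact (closure (range z)) \<and> closure (range z) \<subseteq> regular_domain \<nu> \<alpha> q \<and>
     (\<exists>\<delta>>0. \<forall>n. \<exists>w. regular_branch \<nu> \<alpha> q (z n) w (z (n + 1)) \<and>
        \<bar>snd (z n)\<bar> \<le> 1 - \<delta> \<and> \<bar>w\<bar> \<le> 1 - \<delta>)"

end

theory Submission
  imports Defs
begin

text \<open>
  Write \<open>e = \<nu> - 1\<close>. The scaling \<open>(x, y) \<mapsto> (x, sqrt \<nu> * y)\<close> turns the two ellipses into the
  concentric circles of radii \<open>1/2\<close> and \<open>1\<close> and keeps straight lines straight; what it distorts is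
  the metric that measures velocities. In polar coordinates a flight preserves the length and the
  angular momentum of the scaled velocity, and the boundary laws are explicit in the polar
  components. So one return is a closed formula in \<open>e\<close>, \<open>\<theta>\<close> and \<open>p\<close>
  (\<open>regular_branch_formula\<close>), and by determinism of the flights it is the only possible return up to
  the antipodal symmetry (\<open>return_unique\<close>).

  The chord is almost normal to the inner ellipse. Its tangential velocity changes by a quantity of
  size \<open>e\<close>, which is comparable with the annular speed \<open>q = e/16\<close>. The quotient is carried out
  algebraically in \<open>exit_fraction\<close>, and with it the formula is jointly continuously differentiable in
  \<open>(e, \<theta>, p)\<close> near \<open>e = 0\<close>. The limit is the twist map
  \<open>w = p - 16 * sin (2 * \<theta>)\<close>, \<open>\<theta>' = \<theta> + twist w\<close>, \<open>p' = w\<close>, where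
  \<open>twist w = 2 * (arcsin w - arcsin (w/2))\<close>. The
  derivative of the limit at the two fixed points has determinant \<open>1\<close> and trace \<open>-30\<close> or \<open>34\<close>, so
  both points remain saddles for small \<open>e > 0\<close> (\<open>eventually_saddle\<close>).

  A regular orbit of the limit map has \<open>\<bar>w\<bar> < 1\<close>, hence \<open>\<bar>sin (2 * \<theta>)\<bar> < 1/8\<close>: its angles stay
  close to multiples of \<open>pi/2\<close>. An advance by \<open>pi/2\<close> is possible because \<open>twist\<close> takes all values
  of modulus below \<open>2 * pi/3\<close>. One looks for an orbit with angles near \<open>0\<close> up to time \<open>0\<close> and near \<open>pi/2\<close>
  afterwards. The triples \<open>(\<theta>\<^sub>n, w\<^sub>n, p\<^sub>n\<^sub>+\<^sub>1)\<close>, suitably weighted, satisfy a system in which each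
  triple is a function of itself and its two neighbours: the angle is determined by the exit law
  (a Newton step), \<open>w\<^sub>n\<close> by the angular advance (the inverse of \<open>twist\<close>), and \<open>p\<^sub>n\<^sub>+\<^sub>1\<close> by the annular
  flight. At \<open>e = 0\<close> this system contracts by \<open>81/100\<close> in the supremum norm, hence by
  \<open>9/10\<close> for all small \<open>e\<close> (\<open>eventually_good_step\<close>), and its solution over all integers is the
  heteroclinic orbit.

  The same system gives the invariant curves. If only the equations with index at least \<open>m\<close> are kept
  and the preceding triple is prescribed, the solution depends on the prescribed value in a
  continuously differentiable way (\<open>solution_arc\<close>), and its states at time \<open>m\<close> form an arc of the
  stable curve; keeping the equations with index below \<open>m\<close> gives the unstable curve. Any two
  solutions approach each other by the factor \<open>9/10\<close> per index away from the indices where their data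
  differ, which yields the exponential tails.
  The linearised system contracts by the same factor, so that the stable direction is close to the
  \<open>p\<close>-axis and the unstable direction close to the \<open>\<theta>\<close>-axis; in the weighted coordinates the two
  slopes have product at most \<open>(9/10)\<^sup>2 < 1\<close>, and the directions differ (\<open>distinct_lines\<close>).
\<close>

section \<open>Continuously differentiable maps\<close>

text \<open>The condition is imposed on a whole neighbourhood: it is then an open condition, and it can be checked
  by rules whose side conditions concern the single point \<open>x\<close>. Below these points have first
  component \<open>e = 0\<close>, where all formulas simplify.\<close>

definition C1_at :: "('a::real_normed_vector \<Rightarrow> 'b::real_normed_vector) \<Rightarrow> 'a \<Rightarrow> bool" where
  "C1_at f x \<longleftrightarrow> (\<exists>S f'. open S \<and> x \<in> S \<and>
     (\<forall>y\<in>S. (f has_derivative blinfun_apply (f' y)) (at y)) \<and> continuous_on S f')"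

named_theorems C1_intros

lemma C1_atI:
  assumes "open S" "x \<in> S" "\<And>y. y \<in> S \<Longrightarrow> (f has_derivative blinfun_apply (f' y)) (at y)"
    "continuous_on S f'"
  shows "C1_at f x"
  unfolding C1_at_def using assms by blast

lemma C1_at_imp_isCont: "C1_at f x \<Longrightarrow> isCont f x"
  unfolding C1_at_def using has_derivative_continuous by blast

lemma open_C1_at: "open {x. C1_at f x}"
proof (subst open_subopen, safe)
  fix x assume "C1_at f x"
  then obtain S f' where "open S" "x \<in> S" "\<forall>y\<in>S. (f has_derivative blinfun_apply (f' y)) (at y)"
    "continuous_on S f'" unfolding C1_at_def by blast
  thus "\<exists>T. open T \<and> x \<in> T \<and> T \<subseteq> {x. C1_at f x}"
    by (intro exI[of _ S]) (auto intro: C1_atI)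
qed

lemma C1_at_compose:
  assumes f: "C1_at f x" and g: "C1_at g (f x)"
  shows "C1_at (\<lambda>x. g (f x)) x"
proof -
  obtain S f' where S: "open S" "x \<in> S" "\<And>y. y \<in> S \<Longrightarrow> (f has_derivative blinfun_apply (f' y)) (at y)"
    "continuous_on S f'" using f unfolding C1_at_def by blast
  obtain T g' where T: "open T" "f x \<in> T" "\<And>y. y \<in> T \<Longrightarrow> (g has_derivative blinfun_apply (g' y)) (at y)"
    "continuous_on T g'" using g unfolding C1_at_def by blast
  have cf: "continuous_on S f"
    using S(3) by (meson continuous_at_imp_continuous_on has_derivative_continuous)
  let ?U = "S \<inter> f -` T"
  show ?thesis
  proof (rule C1_atI)
    show "open ?U" by (rule continuous_open_preimage[OF cf S(1) T(1)])
    show "x \<in> ?U" using S T by simp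
    show "((\<lambda>x. g (f x)) has_derivative blinfun_apply (g' (f y) o\<^sub>L f' y)) (at y)" if "y \<in> ?U" for y
      using has_derivative_compose[OF S(3)[of y] T(3)[of "f y"]] that
      by (simp add: blinfun_compose.rep_eq o_def)
    have "continuous_on ?U (\<lambda>y. g' (f y))"
      by (rule continuous_on_compose2[OF T(4) continuous_on_subset[OF cf]]) auto
    thus "continuous_on ?U (\<lambda>y. g' (f y) o\<^sub>L f' y)"
      by (intro bounded_bilinear.continuous_on[OF bounded_bilinear_blinfun_compose])
        (auto intro: continuous_on_subset[OF S(4)])
  qed
qed

lemma C1_at_bounded_linear:
  assumes "bounded_linear f"
  shows "C1_at f x"
  using assms
  by (intro C1_atI[of UNIV _ _ "\<lambda>_. Blinfun f"])
    (auto simp: bounded_linear_Blinfun_apply bounded_linear_imp_has_derivative)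

lemma C1_at_const [C1_intros]: "C1_at (\<lambda>x. c) x"
  by (intro C1_atI[of UNIV _ _ "\<lambda>_. 0"]) (auto simp: zero_blinfun.rep_eq)

lemma C1_at_ident [C1_intros]: "C1_at (\<lambda>x. x) x"
  by (rule C1_at_bounded_linear) (rule bounded_linear_ident)

lemma C1_at_fst [C1_intros]: "C1_at f x \<Longrightarrow> C1_at (\<lambda>x. fst (f x)) x"
  by (erule C1_at_compose) (rule C1_at_bounded_linear[OF bounded_linear_fst])

lemma C1_at_snd [C1_intros]: "C1_at f x \<Longrightarrow> C1_at (\<lambda>x. snd (f x)) x"
  by (erule C1_at_compose) (rule C1_at_bounded_linear[OF bounded_linear_snd])

lemma C1_at_add [C1_intros]:
  assumes "C1_at f x" "C1_at g x"
  shows "C1_at (\<lambda>x. f x + g x) x"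
proof -
  obtain S f' where S: "open S" "x \<in> S" "\<And>y. y \<in> S \<Longrightarrow> (f has_derivative blinfun_apply (f' y)) (at y)"
    "continuous_on S f'" using assms(1) unfolding C1_at_def by blast
  obtain T g' where T: "open T" "x \<in> T" "\<And>y. y \<in> T \<Longrightarrow> (g has_derivative blinfun_apply (g' y)) (at y)"
    "continuous_on T g'" using assms(2) unfolding C1_at_def by blast
  show ?thesis
    using S T
    by (intro C1_atI[of "S \<inter> T" _ _ "\<lambda>y. f' y + g' y"])
      (auto simp: blinfun.bilinear_simps intro!: derivative_eq_intros continuous_intros
        intro: continuous_on_subset)
qed

lemma C1_at_Pair [C1_intros]:
  assumes "C1_at f x" "C1_at g x"
  shows "C1_at (\<lambda>x. (f x, g x)) x"
proof -
  have "C1_at (\<lambda>x. (f x, 0) + (0, g x)) x"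
    by (intro C1_at_add C1_at_compose[OF assms(1), of "\<lambda>y. (y, 0)"]
        C1_at_compose[OF assms(2), of "\<lambda>y. (0, y)"] C1_at_bounded_linear
        bounded_linear_Pair bounded_linear_ident bounded_linear_zero)
  thus ?thesis by simp
qed

lemma C1_at_real_function:
  fixes g :: "real \<Rightarrow> real"
  assumes "open S" "x \<in> S" "\<And>y. y \<in> S \<Longrightarrow> (g has_real_derivative g' y) (at y)" "continuous_on S g'"
  shows "C1_at g x"
  using assms
  by (intro C1_atI[of S _ _ "\<lambda>y. blinfun_mult_right (g' y)"])
    (auto simp: has_field_derivative_def blinfun_mult_right.rep_eq
      intro!: bounded_linear.continuous_on[OF bounded_linear_blinfun_mult_right])

lemma C1_at_mult [C1_intros]:
  fixes f g :: "_ \<Rightarrow> real"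
  assumes "C1_at f x" "C1_at g x"
  shows "C1_at (\<lambda>x. f x * g x) x"
proof -
  obtain S f' where S: "open S" "x \<in> S" "\<And>y. y \<in> S \<Longrightarrow> (f has_derivative blinfun_apply (f' y)) (at y)"
    "continuous_on S f'" using assms(1) unfolding C1_at_def by blast
  obtain T g' where T: "open T" "x \<in> T" "\<And>y. y \<in> T \<Longrightarrow> (g has_derivative blinfun_apply (g' y)) (at y)"
    "continuous_on T g'" using assms(2) unfolding C1_at_def by blast
  have cf: "continuous_on S f"
    using S(3) by (meson continuous_at_imp_continuous_on has_derivative_continuous)
  have cg: "continuous_on T g"
    using T(3) by (meson continuous_at_imp_continuous_on has_derivative_continuous)
  show ?thesis
    using S T cf cg
    by (intro C1_atI[of "S \<inter> T" _ _ "\<lambda>y. f y *\<^sub>R g' y + g y *\<^sub>R f' y"])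
      (auto simp: blinfun.bilinear_simps intro!: derivative_eq_intros continuous_intros
        intro: continuous_on_subset)
qed

lemma C1_at_minus [C1_intros]:
  fixes f :: "_ \<Rightarrow> real"
  shows "C1_at f x \<Longrightarrow> C1_at (\<lambda>x. - f x) x"
  by (erule C1_at_compose) (rule C1_at_bounded_linear[OF bounded_linear_minus[OF bounded_linear_ident]])

lemma C1_at_diff [C1_intros]:
  fixes f g :: "_ \<Rightarrow> real"
  shows "C1_at f x \<Longrightarrow> C1_at g x \<Longrightarrow> C1_at (\<lambda>x. f x - g x) x"
  using C1_at_add[OF _ C1_at_minus, of f x g] by simp

lemma C1_at_power2 [C1_intros]:
  fixes f :: "_ \<Rightarrow> real"
  shows "C1_at f x \<Longrightarrow> C1_at (\<lambda>x. (f x)\<^sup>2) x"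
  unfolding power2_eq_square by (intro C1_intros)

lemma C1_at_sin [C1_intros]:
  fixes f :: "_ \<Rightarrow> real"
  shows "C1_at f x \<Longrightarrow> C1_at (\<lambda>x. sin (f x)) x"
  by (erule C1_at_compose, rule C1_at_real_function[of UNIV _ _ cos])
    (auto intro!: derivative_eq_intros continuous_intros)

lemma C1_at_cos [C1_intros]:
  fixes f :: "_ \<Rightarrow> real"
  shows "C1_at f x \<Longrightarrow> C1_at (\<lambda>x. cos (f x)) x"
  by (erule C1_at_compose, rule C1_at_real_function[of UNIV _ _ "\<lambda>x. - sin x"])
    (auto intro!: derivative_eq_intros continuous_intros)

lemma C1_at_arctan [C1_intros]:
  "C1_at f x \<Longrightarrow> C1_at (\<lambda>x. arctan (f x)) x"
  by (erule C1_at_compose, rule C1_at_real_function[of UNIV _ _ "\<lambda>x. inverse (1 + x\<^sup>2)"])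
    (auto intro!: derivative_eq_intros continuous_intros simp: add_nonneg_eq_0_iff)

lemma C1_at_sqrt [C1_intros]:
  "C1_at f x \<Longrightarrow> 0 < f x \<Longrightarrow> C1_at (\<lambda>x. sqrt (f x)) x"
  by (erule C1_at_compose, rule C1_at_real_function[of "{0<..}" _ _ "\<lambda>x. inverse (sqrt x) / 2"])
    (auto intro!: derivative_eq_intros continuous_intros)

lemma C1_at_inverse:
  fixes f :: "_ \<Rightarrow> real"
  shows "C1_at f x \<Longrightarrow> f x \<noteq> 0 \<Longrightarrow> C1_at (\<lambda>x. inverse (f x)) x"
  by (erule C1_at_compose, rule C1_at_real_function[of "- {0}" _ _ "\<lambda>x. - (inverse x * inverse x)"])
    (auto intro!: derivative_eq_intros continuous_intros)

lemma C1_at_divide [C1_intros]: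
  fixes f g :: "_ \<Rightarrow> real"
  shows "C1_at f x \<Longrightarrow> C1_at g x \<Longrightarrow> g x \<noteq> 0 \<Longrightarrow> C1_at (\<lambda>x. f x / g x) x"
  unfolding divide_inverse by (intro C1_at_mult C1_at_inverse)

definition derivative_at :: "('a::real_normed_vector \<Rightarrow> 'b::real_normed_vector) \<Rightarrow> 'a \<Rightarrow> 'a \<Rightarrow>\<^sub>L 'b" where
  "derivative_at f x = (SOME L. (f has_derivative blinfun_apply L) (at x))"

lemma has_derivative_derivative_at:
  "C1_at f x \<Longrightarrow> (f has_derivative blinfun_apply (derivative_at f x)) (at x)"
  unfolding C1_at_def derivative_at_def by (metis (mono_tags) someI_ex)

lemma derivative_at_eq:
  "(f has_derivative blinfun_apply L) (at x) \<Longrightarrow> derivative_at f x = L"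
  unfolding derivative_at_def
  by (metis (mono_tags, lifting) blinfun_apply_inject has_derivative_unique someI_ex)

lemma continuous_on_derivative_at: "continuous_on {x. C1_at f x} (derivative_at f)"
  unfolding continuous_on_eq_continuous_at[OF open_C1_at]
proof safe
  fix x assume "C1_at f x"
  then obtain S f' where S: "open S" "x \<in> S" "\<And>y. y \<in> S \<Longrightarrow> (f has_derivative blinfun_apply (f' y)) (at y)"
    "continuous_on S f'" unfolding C1_at_def by blast
  have "continuous_on S (derivative_at f)"
    using S(4) by (rule continuous_on_eq) (use S(3) derivative_at_eq in metis)
  thus "isCont (derivative_at f) x"
    using S(1,2) continuous_on_eq_continuous_at by blast
qed

text \<open>A compact slice \<open>{0} \<times> K\<close> of the domain has a neighbourhood of uniform width on which \<open>g\<close>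
  varies little, by a Lebesgue number of a suitable cover.\<close>

lemma uniformly_close_to_slice:
  fixes g :: "real \<times> 'a::euclidean_space \<Rightarrow> 'b::metric_space"
  assumes K: "compact K" and W: "open W" "{0} \<times> K \<subseteq> W" and g: "continuous_on W g" and \<eta>: "0 < \<eta>"
  shows "\<forall>\<^sub>F e in at_right 0. \<forall>x\<in>K. (e, x) \<in> W \<and> dist (g (e, x)) (g (0, x)) < \<eta>"
proof -
  have "\<exists>d>0. ball X d \<subseteq> W \<and> (\<forall>Y\<in>ball X d. dist (g Y) (g X) < \<eta> / 2)" if "X \<in> {0} \<times> K" for X :: "real \<times> 'a"
  proof -
    have X: "X \<in> W" using that W by blast
    obtain d1 where d1: "d1 > 0" "ball X d1 \<subseteq> W" using W(1) X open_contains_ball by blast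
    obtain d2 where d2: "d2 > 0" "\<And>Y. Y \<in> W \<Longrightarrow> dist Y X < d2 \<Longrightarrow> dist (g Y) (g X) < \<eta> / 2"
      using g X \<eta> unfolding continuous_on_iff by (meson half_gt_zero)
    show ?thesis
      using d1 d2 by (intro exI[of _ "min d1 d2"]) (auto simp: dist_commute subset_eq)
  qed
  then obtain d where d: "\<And>X. X \<in> {0} \<times> K \<Longrightarrow> d X > 0 \<and> ball X (d X) \<subseteq> W \<and>
       (\<forall>Y\<in>ball X (d X). dist (g Y) (g X) < \<eta> / 2)" by metis
  define \<G> where "\<G> = (\<lambda>X. ball X (d X)) ` ({0} \<times> K)"
  have cpt: "compact ({0::real} \<times> K)" using K by (intro compact_Times) auto
  have cov: "{0} \<times> K \<subseteq> \<Union> \<G>"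
  proof
    fix X :: "real \<times> 'a" assume X: "X \<in> {0} \<times> K"
    hence "X \<in> ball X (d X)" using d[OF X] by simp
    thus "X \<in> \<Union> \<G>" using X unfolding \<G>_def by blast
  qed
  have op: "\<And>G. G \<in> \<G> \<Longrightarrow> open G"
    by (auto simp: \<G>_def)
  obtain e0 where e0: "0 < e0" "\<And>X. X \<in> {0} \<times> K \<Longrightarrow> \<exists>G\<in>\<G>. ball X e0 \<subseteq> G"
  proof (rule Heine_Borel_lemma[OF cpt cov op])
    fix e :: real assume "0 < e" "\<And>X. X \<in> {0} \<times> K \<Longrightarrow> \<exists>G\<in>\<G>. ball X e \<subseteq> G"
    thus thesis by (rule that)
  qed
  have "\<forall>x\<in>K. (e, x) \<in> W \<and> dist (g (e, x)) (g (0, x)) < \<eta>" if e: "0 < e" "e < e0" for e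
  proof
    fix x assume x: "x \<in> K"
    then obtain X where X: "X \<in> {0} \<times> K" "ball (0, x) e0 \<subseteq> ball X (d X)"
      using e0(2)[of "(0, x)"] by (auto simp: \<G>_def)
    have "(e, x) \<in> ball (0, x) e0" "(0, x) \<in> ball (0, x) e0"
      using e e0(1) by (auto simp: dist_Pair_Pair)
    hence m: "(e, x) \<in> ball X (d X)" "(0, x) \<in> ball X (d X)" using X(2) by blast+
    have "dist (g (e, x)) (g X) < \<eta> / 2" "dist (g (0, x)) (g X) < \<eta> / 2"
      using d[OF X(1)] m by blast+
    hence "dist (g (e, x)) (g (0, x)) < \<eta>"
      by (rule dist_triangle_half_l)
    moreover have "(e, x) \<in> W" using d[OF X(1)] m by blast
    ultimately show "(e, x) \<in> W \<and> dist (g (e, x)) (g (0, x)) < \<eta>" by blast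
  qed
  thus ?thesis
    unfolding eventually_at_right_field using e0(1) by blast
qed

text \<open>The derivative in the second variable only; it is the total derivative composed with the
  inclusion, and so depends continuously on both variables.\<close>

definition slice_derivative :: "(real \<times> 'a::real_normed_vector \<Rightarrow> 'b::real_normed_vector) \<Rightarrow> real \<Rightarrow> 'a \<Rightarrow> 'a \<Rightarrow>\<^sub>L 'b" where
  "slice_derivative F e x = derivative_at F (e, x) o\<^sub>L Blinfun (\<lambda>v. (0, v))"

lemma blinfun_apply_embed: "blinfun_apply (Blinfun (\<lambda>v. (0, v))) = (\<lambda>v. (0, v))"
  by (intro bounded_linear_Blinfun_apply bounded_linear_Pair bounded_linear_zero bounded_linear_ident)

lemma has_derivative_slice:
  assumes "C1_at F (e, x)"
  shows "((\<lambda>y. F (e, y)) has_derivative blinfun_apply (slice_derivative F e x)) (at x)"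
proof -
  have "((\<lambda>y. (e, y)) has_derivative (\<lambda>v. (0, v))) (at x)"
    by (auto intro!: derivative_eq_intros)
  from has_derivative_compose[OF this has_derivative_derivative_at[OF assms]]
  show ?thesis by (simp add: slice_derivative_def blinfun_compose.rep_eq blinfun_apply_embed o_def)
qed

definition slices_close ::
  "(real \<times> 'a::real_normed_vector \<Rightarrow> 'b::real_normed_vector) \<Rightarrow> 'a set \<Rightarrow> real \<Rightarrow> real \<Rightarrow> bool" where
  "slices_close F K \<eta> e \<longleftrightarrow> (\<forall>x\<in>K. C1_at F (e, x) \<and> norm (F (e, x) - F (0, x)) < \<eta> \<and>
     norm (slice_derivative F e x - slice_derivative F 0 x) < \<eta>)"

text \<open>The only perturbation argument used below: joint regularity at the points of \<open>{0} \<times> K\<close> makes the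
  slices at small positive parameters close to the limit slice, uniformly on \<open>K\<close>, together with their
  derivatives. Every strict inequality that the limit satisfies on \<open>K\<close> therefore persists.\<close>

lemma slices_uniformly_C1_close:
  fixes F :: "real \<times> 'a::euclidean_space \<Rightarrow> 'b::real_normed_vector"
  assumes K: "compact K" and F: "\<And>x. x \<in> K \<Longrightarrow> C1_at F (0, x)" and \<eta>: "0 < \<eta>"
  shows "\<forall>\<^sub>F e in at_right 0. slices_close F K \<eta> e"
proof -
  let ?W = "{X. C1_at F X}"
  have W: "{0} \<times> K \<subseteq> ?W" using F by auto
  have "continuous_on ?W F"
    by (simp add: C1_at_imp_isCont continuous_at_imp_continuous_on)
  moreover have "continuous_on ?W (\<lambda>X. derivative_at F X o\<^sub>L Blinfun (\<lambda>v. (0, v)))"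
    by (intro bounded_bilinear.continuous_on[OF bounded_bilinear_blinfun_compose]
        continuous_on_derivative_at continuous_intros)
  ultimately show ?thesis
    using uniformly_close_to_slice[OF K open_C1_at W _ \<eta>, of F]
      uniformly_close_to_slice[OF K open_C1_at W _ \<eta>, of "\<lambda>X. derivative_at F X o\<^sub>L Blinfun (\<lambda>v. (0, v))"]
    by (auto simp: dist_norm slice_derivative_def slices_close_def elim: eventually_elim2)
qed

lemma continuous_on_slice_derivative:
  assumes "\<And>x. x \<in> K \<Longrightarrow> C1_at F (e, x)"
  shows "continuous_on K (slice_derivative F e)"
  unfolding slice_derivative_def
  by (intro bounded_bilinear.continuous_on[OF bounded_bilinear_blinfun_compose]
      continuous_on_compose2[OF continuous_on_derivative_at[of F]] continuous_intros) (use assms in auto)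

lemma uniformly_C1_on_compact:
  fixes f :: "'a::euclidean_space \<Rightarrow> 'b::real_normed_vector"
  assumes K: "compact K" "convex K" and f: "\<And>x. x \<in> K \<Longrightarrow> (f has_derivative blinfun_apply (D x)) (at x)"
    and D: "continuous_on K D" and \<eta>: "0 < \<eta>"
  shows "\<exists>\<delta>>0. \<forall>x\<in>K. \<forall>y\<in>K. norm (y - x) < \<delta> \<longrightarrow>
     norm (f y - f x - D x (y - x)) \<le> \<eta> * norm (y - x) \<and> norm (D y - D x) \<le> \<eta>"
proof -
  have "uniformly_continuous_on K D" using compact_uniformly_continuous[OF D K(1)] .
  then obtain \<delta> where \<delta>: "\<delta> > 0" "\<And>x y. x \<in> K \<Longrightarrow> y \<in> K \<Longrightarrow> norm (y - x) < \<delta> \<Longrightarrow> norm (D y - D x) < \<eta>"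
    unfolding uniformly_continuous_on_def dist_norm using \<eta> by metis
  have "norm (f y - f x - D x (y - x)) \<le> \<eta> * norm (y - x)"
    if x: "x \<in> K" and y: "y \<in> K" and d: "norm (y - x) < \<delta>" for x y
  proof -
    have seg: "x + t *\<^sub>R (y - x) \<in> closed_segment x y" if "t \<in> {0..1}" for t
      using that unfolding in_segment by (intro exI[of _ t]) (auto simp: algebra_simps)
    have sub: "closed_segment x y \<subseteq> K" using x y K(2) by (simp add: closed_segment_subset)
    have "norm (f y - f x - D x (y - x)) \<le> norm (y - x) * \<eta>"
    proof (rule differentiable_bound_linearization[where f' = "\<lambda>x. blinfun_apply (D x)"])
      show "x + t *\<^sub>R (y - x) \<in> closed_segment x y" if "t \<in> {0..1}" for t by (rule seg[OF that])
      show "(f has_derivative blinfun_apply (D z)) (at z within closed_segment x y)"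
        if "z \<in> closed_segment x y" for z
        using f that sub has_derivative_at_withinI by blast
      show "onorm (blinfun_apply (D z) - blinfun_apply (D x)) \<le> \<eta>" if z: "z \<in> closed_segment x y" for z
      proof -
        have "norm (z - x) \<le> norm (y - x)"
          using segment_bound1[OF z] by (simp add: norm_minus_commute)
        hence "norm (D z - D x) < \<eta>" using \<delta>(2)[of x z] x z sub d by auto
        thus ?thesis
          by (simp add: norm_blinfun.rep_eq minus_blinfun.rep_eq fun_diff_def)
      qed
    qed auto
    thus ?thesis by (simp add: mult.commute)
  qed
  thus ?thesis using \<delta> less_imp_le by blast
qed

section \<open>Chains of contractions indexed by the integers\<close>

text \<open>The maximum norm on triples of neighbours, matching the supremum norm on sequences.\<close>

definition norm3 :: "'e::real_normed_vector \<times> 'e \<times> 'e \<Rightarrow> real" where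
  "norm3 X = max (norm (fst X)) (max (norm (fst (snd X))) (norm (snd (snd X))))"

definition window :: "(int \<Rightarrow> 'e) \<Rightarrow> int \<Rightarrow> 'e \<times> 'e \<times> 'e" where
  "window U n = (U (n - 1), U n, U (n + 1))"

definition windows :: "(int \<Rightarrow> 'e set) \<Rightarrow> int \<Rightarrow> ('e \<times> 'e \<times> 'e) set" where
  "windows B n = B (n - 1) \<times> B n \<times> B (n + 1)"

lemma norm3_nonneg: "0 \<le> norm3 X"
  by (simp add: norm3_def le_max_iff_disj)

lemma norm3_window_le:
  assumes "\<And>k. norm (U k) \<le> r"
  shows "norm3 (window U n) \<le> r"
  using assms by (simp add: norm3_def window_def)

lemma window_mem: "(\<And>n. U n \<in> B n) \<Longrightarrow> window U n \<in> windows B n"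
  by (simp add: window_def windows_def)

lemma window_diff: "window U n - window U' n = window (\<lambda>k. U k - U' k) n"
  by (simp add: window_def)

text \<open>The supremum \<open>R\<close> of the family satisfies \<open>R \<le> e + l * R\<close>. Boundedness enters because this
  inequality says nothing if \<open>R\<close> is infinite.\<close>

lemma absorb_sup_bound:
  fixes d :: "int \<Rightarrow> real"
  assumes bdd: "\<And>n. d n \<le> C"
    and step: "\<And>R n. (\<And>k. d k \<le> R) \<Longrightarrow> d n \<le> e + l * R"
    and l: "l < 1"
  shows "d n \<le> e / (1 - l)"
proof -
  define S where "S = (SUP n. d n)"
  have le: "d k \<le> S" for k
    unfolding S_def by (rule cSUP_upper) (auto intro: bdd simp: bdd_above_def)
  have "S \<le> e + l * S"
    unfolding S_def using step[OF le] by (intro cSUP_least) (auto simp: S_def)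
  hence "S \<le> e / (1 - l)"
    using l by (simp add: field_simps)
  with le[of n] show ?thesis by simp
qed

text \<open>Each use of the inequality gains a factor \<open>l\<close> and looks one index further to either side; it can be
  used \<open>j\<close> times as long as the window of radius \<open>j\<close> around \<open>n\<close> stays in \<open>A\<close>.\<close>

lemma geometric_decay:
  fixes d :: "int \<Rightarrow> real"
  assumes bdd: "\<And>n. d n \<le> C"
    and step: "\<And>k. k \<in> A \<Longrightarrow> d k \<le> l * max (d (k - 1)) (max (d k) (d (k + 1)))"
    and l: "0 \<le> l"
    and "\<And>k. \<bar>k - n\<bar> < int j \<Longrightarrow> k \<in> A"
  shows "d n \<le> l ^ j * C"
  using assms(4)
proof (induction j arbitrary: n)
  case 0
  then show ?case using bdd by simp
next
  case (Suc j)
  have *: "d k \<le> l ^ j * C" if "\<bar>k - n\<bar> \<le> 1" for k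
    using Suc.IH[of k] Suc.prems that by fastforce
  have "n \<in> A" using Suc.prems[of n] by simp
  have "d n \<le> l * max (d (n - 1)) (max (d n) (d (n + 1)))"
    by (rule step[OF \<open>n \<in> A\<close>])
  also have "\<dots> \<le> l * (l ^ j * C)"
    using *[of "n - 1"] *[of n] *[of "n + 1"] l by (intro mult_left_mono) auto
  finally show ?case by (simp add: mult.assoc)
qed

text \<open>Picard iteration from the base sequence \<open>b\<close>. On the indices outside \<open>A\<close> the iteration is
  frozen at \<open>b\<close>; with \<open>A\<close> a half line this prescribes the data of a stable or unstable curve, with
  \<open>A = UNIV\<close> nothing is prescribed.\<close>

lemma chain_solution_exists:
  fixes F :: "int \<Rightarrow> 'e::banach \<times> 'e \<times> 'e \<Rightarrow> 'e"
  assumes cl: "\<And>n. closed (B n)"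
    and bdd: "\<And>n x. x \<in> B n \<Longrightarrow> norm x \<le> M"
    and maps: "\<And>n X. X \<in> windows B n \<Longrightarrow> F n X \<in> B n"
    and lip: "\<And>n X Y. X \<in> windows B n \<Longrightarrow> Y \<in> windows B n \<Longrightarrow>
                norm (F n X - F n Y) \<le> l * norm3 (X - Y)"
    and l: "0 \<le> l" "l < 1"
    and b: "\<And>n. b n \<in> B n"
  shows "\<exists>U. \<forall>n. U n \<in> B n \<and> U n = (if n \<in> A then F n (window U n) else b n)"
proof -
  define T where "T U n = (if n \<in> A then F n (window U n) else b n)" for U n
  define it where "it k = (T ^^ k) b" for k
  have it_Suc: "it (Suc k) = T (it k)" for k by (simp add: it_def)
  have it_B: "it k n \<in> B n" for k n
  proof (induction k arbitrary: n)
    case 0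
    show ?case using b by (simp add: it_def)
  next
    case (Suc k)
    thus ?case using b by (auto simp: it_Suc T_def intro!: maps window_mem)
  qed
  have T_lip: "norm (T U n - T U' n) \<le> l * r"
    if "\<And>k. U k \<in> B k" "\<And>k. U' k \<in> B k" "\<And>k. norm (U k - U' k) \<le> r" for U U' n r
  proof -
    have "0 \<le> r" using that(3)[of 0] norm_ge_zero order_trans by blast
    moreover have "norm (F n (window U n) - F n (window U' n)) \<le> l * r"
    proof -
      have "norm (F n (window U n) - F n (window U' n)) \<le> l * norm3 (window U n - window U' n)"
        using that by (intro lip window_mem)
      also have "\<dots> \<le> l * r"
        unfolding window_diff by (intro mult_left_mono norm3_window_le that l)
      finally show ?thesis .
    qed
    ultimately show ?thesis using l by (simp add: T_def)
  qed
  have cauchy: "norm (it (N + i) n - it (N + j) n) \<le> l ^ N * (2 * M)" for N i j n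
  proof (induction N arbitrary: n)
    case 0
    show ?case
      using norm_triangle_ineq4[of "it i n" "it j n"] bdd[OF it_B, of i n] bdd[OF it_B, of j n] by simp
  next
    case (Suc N)
    show ?case
      using T_lip[OF it_B it_B Suc.IH] by (simp add: it_Suc mult.assoc)
  qed
  have lim0: "(\<lambda>N. l ^ N * (2 * M)) \<longlonglongrightarrow> 0"
    using l by (auto intro!: tendsto_eq_intros LIMSEQ_power_zero)
  have "\<forall>e>0. \<exists>N. \<forall>m n x. N \<le> m \<and> N \<le> n \<and> True \<longrightarrow> dist (it m x) (it n x) < e"
  proof (intro allI impI)
    fix e :: real assume "0 < e"
    then obtain N where N: "l ^ N * (2 * M) < e"
      using order_tendstoD(2)[OF lim0] eventually_happens'[OF sequentially_bot] by blast
    show "\<exists>N. \<forall>m n x. N \<le> m \<and> N \<le> n \<and> True \<longrightarrow> dist (it m x) (it n x) < e"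
    proof (intro exI[of _ N] allI impI)
      fix m n x assume "N \<le> m \<and> N \<le> n \<and> True"
      then obtain i j where "m = N + i" "n = N + j" using le_Suc_ex by metis
      thus "dist (it m x) (it n x) < e" using cauchy[of N i x j] N by (simp add: dist_norm)
    qed
  qed
  then obtain U where U: "\<forall>e>0. \<exists>N. \<forall>n x. N \<le> n \<and> True \<longrightarrow> dist (it n x) (U x) < e"
    unfolding uniformly_convergent_eq_cauchy[symmetric] by blast
  have UB: "U n \<in> B n" for n
  proof (rule Lim_in_closed_set[OF cl _ sequentially_bot])
    show "\<forall>\<^sub>F k in sequentially. it k n \<in> B n" using it_B by simp
    show "(\<lambda>k. it k n) \<longlonglongrightarrow> U n" unfolding lim_sequentially using U by blast
  qed
  have "U n = T U n" for n
  proof -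
    have "norm (T U n - U n) \<le> e" if "e > 0" for e
    proof -
      obtain N where N: "\<And>k x. N \<le> k \<Longrightarrow> dist (it k x) (U x) < e / 2"
        using U[rule_format, of "e / 2"] \<open>e > 0\<close> by auto
      have "norm (U k - it N k) \<le> e / 2" for k
        using N[of N k] by (simp add: dist_norm norm_minus_commute)
      from T_lip[OF UB it_B this, of n] have "norm (T U n - it (Suc N) n) \<le> l * (e / 2)"
        by (simp add: it_Suc)
      also have "\<dots> \<le> 1 * (e / 2)" using l that by (intro mult_right_mono) auto
      finally show ?thesis
        using N[of "Suc N" n] norm_triangle_ineq[of "T U n - it (Suc N) n" "it (Suc N) n - U n"]
        by (simp add: dist_norm)
    qed
    from field_le_epsilon[of "norm (T U n - U n)" 0] this show ?thesis by simp
  qed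
  with UB show ?thesis unfolding T_def by blast
qed

text \<open>Sequences \<open>U\<close> with \<open>U n \<in> B n\<close> and equations \<open>U n = F n (U (n - 1), U n, U (n + 1))\<close> whose right hand
  sides contract with a common factor and are differentiable with a common modulus. Uniformity
  in \<open>n\<close> is what allows arguments in the supremum norm.\<close>

locale contracting_chain =
  fixes B :: "int \<Rightarrow> 'e::banach set" and F :: "int \<Rightarrow> 'e \<times> 'e \<times> 'e \<Rightarrow> 'e"
    and F' :: "int \<Rightarrow> 'e \<times> 'e \<times> 'e \<Rightarrow> 'e \<times> 'e \<times> 'e \<Rightarrow> 'e" and l M :: real
  assumes closed_B: "closed (B n)"
    and bounded_B: "x \<in> B n \<Longrightarrow> norm x \<le> M"
    and maps: "X \<in> windows B n \<Longrightarrow> F n X \<in> B n"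
    and l: "0 \<le> l" "l < 1"
    and lip: "X \<in> windows B n \<Longrightarrow> Y \<in> windows B n \<Longrightarrow> norm (F n X - F n Y) \<le> l * norm3 (X - Y)"
    and linear_F': "X \<in> windows B n \<Longrightarrow> linear (F' n X)"
    and F'_le: "X \<in> windows B n \<Longrightarrow> norm (F' n X v) \<le> l * norm3 v"
    and uniformly_C1: "0 < \<eta> \<Longrightarrow> \<exists>\<delta>>0. \<forall>n. \<forall>X\<in>windows B n. \<forall>Y\<in>windows B n. norm3 (Y - X) < \<delta> \<longrightarrow>
          norm (F n Y - F n X - F' n X (Y - X)) \<le> \<eta> * norm3 (Y - X) \<and>
          (\<forall>v. norm (F' n Y v - F' n X v) \<le> \<eta> * norm3 v)"
begin

text \<open>The equations are imposed on \<open>A\<close> only; the values outside \<open>A\<close> act as boundary data.\<close>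

definition solves :: "int set \<Rightarrow> (int \<Rightarrow> 'e) \<Rightarrow> bool" where
  "solves A U \<longleftrightarrow> (\<forall>n. U n \<in> B n) \<and> (\<forall>n\<in>A. U n = F n (window U n))"

lemma solves_step:
  assumes "solves A U" "solves A U'" "n \<in> A"
  shows "norm (U n - U' n) \<le> l * norm3 (window (\<lambda>k. U k - U' k) n)"
proof -
  have "norm (U n - U' n) = norm (F n (window U n) - F n (window U' n))"
    using assms by (simp add: solves_def)
  also have "\<dots> \<le> l * norm3 (window U n - window U' n)"
    using assms by (intro lip window_mem) (auto simp: solves_def)
  finally show ?thesis by (simp add: window_diff)
qed

lemma solves_diff_bounded:
  assumes "solves A U" "solves A' U'"
  shows "norm (U n - U' n) \<le> 2 * M"
  using bounded_B[of "U n" n] bounded_B[of "U' n" n] norm_triangle_ineq4[of "U n" "U' n"] assms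
  by (simp add: solves_def)

text \<open>A maximum principle: inside \<open>A\<close> the difference of two solutions is at most \<open>l\<close> times its
  supremum, so the supremum is governed by the boundary data.\<close>

lemma solves_stable:
  assumes U: "solves A U" "solves A U'"
    and off: "\<And>n. n \<notin> A \<Longrightarrow> norm (U n - U' n) \<le> r" and r: "0 \<le> r"
  shows "norm (U n - U' n) \<le> r"
proof -
  have "norm (U n - U' n) \<le> ((1 - l) * r) / (1 - l)" if "\<not> norm (U n - U' n) \<le> r" for n
  proof -
    have "max (norm (U n - U' n)) r \<le> ((1 - l) * r) / (1 - l)" for n
    proof (rule absorb_sup_bound[of "\<lambda>n. max (norm (U n - U' n)) r" "max (2 * M) r" _ l])
      fix n show "max (norm (U n - U' n)) r \<le> max (2 * M) r"
        by (intro max.mono solves_diff_bounded[OF U] order_refl)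
    next
      fix R n assume R: "\<And>k. max (norm (U k - U' k)) r \<le> R"
      have "r \<le> (1 - l) * r + l * R"
        using R[of 0] mult_left_mono[of r R l] l by (simp add: algebra_simps)
      moreover have "norm (U n - U' n) \<le> (1 - l) * r + l * R"
      proof (cases "n \<in> A")
        case True
        have "norm (U n - U' n) \<le> l * R"
          using solves_step[OF U True] mult_left_mono[OF norm3_window_le[of "\<lambda>k. U k - U' k" R n] l(1)] R
          by (meson max.boundedE order_trans)
        thus ?thesis using r l by (simp add: add_increasing)
      next
        case False
        thus ?thesis using off[OF False] calculation by linarith
      qed
      ultimately show "max (norm (U n - U' n)) r \<le> (1 - l) * r + l * R" by simp
    qed (use l in auto)
    thus ?thesis by (meson max.boundedE)
  qed
  thus ?thesis using l by fastforce
qed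

lemma solves_unique:
  assumes "solves A U" "solves A U'" "\<And>n. n \<notin> A \<Longrightarrow> U n = U' n"
  shows "U = U'"
  using solves_stable[OF assms(1,2), of 0] assms(3) by fastforce

lemma solves_exists:
  assumes "\<And>n. b n \<in> B n"
  shows "\<exists>U. solves A U \<and> (\<forall>n. n \<notin> A \<longrightarrow> U n = b n)"
  using chain_solution_exists[of B M F l b A] closed_B bounded_B maps lip l assms
  unfolding solves_def by metis

text \<open>The linearised equations along a solution are again a contracting chain, on balls.\<close>

lemma linearized_solution_exists:
  assumes U: "solves A U" and \<beta>: "\<And>n. norm (\<beta> n) \<le> K"
  shows "\<exists>V. (\<forall>n. norm (V n) \<le> K) \<and> (\<forall>n. V n = (if n \<in> A then F' n (window U n) (window V n) else \<beta> n))"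
proof -
  have w: "window U n \<in> windows B n" for n
    using U by (intro window_mem) (auto simp: solves_def)
  have "\<exists>V. \<forall>n. V n \<in> cball 0 K \<and> V n = (if n \<in> A then F' n (window U n) (window V n) else \<beta> n)"
  proof (rule chain_solution_exists[of "\<lambda>_. cball 0 K" K "\<lambda>n. F' n (window U n)" l \<beta> A])
    show "F' n (window U n) X \<in> cball 0 K" if "X \<in> windows (\<lambda>_. cball 0 K) n" for n X
    proof -
      have "norm3 X \<le> K" using that by (auto simp: windows_def norm3_def)
      hence "l * norm3 X \<le> 1 * K" using l norm3_nonneg[of X] by (intro mult_mono) auto
      thus ?thesis using F'_le[OF w, of n X] by simp
    qed
    show "norm (F' n (window U n) X - F' n (window U n) Y) \<le> l * norm3 (X - Y)" for n X Y
      using F'_le[OF w, of n "X - Y"] by (simp add: linear_diff[OF linear_F'[OF w]])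
  qed (use l \<beta> in auto)
  thus ?thesis unfolding mem_cball_0 by meson
qed

text \<open>Differentiable dependence on boundary data that move along lines. The candidate \<open>V s\<close> for
  the velocity solves the linearised equations; the remainder
  \<open>U t - U s - (t - s) V s\<close> satisfies them up to an error that is small relative to \<open>t - s\<close>, because
  the differentiability is uniform and \<open>U\<close> is Lipschitz in the parameter. Absorbing the linear term
  into the supremum gives the derivative, and the same comparison of \<open>V t\<close> with \<open>V s\<close> its continuity.\<close>

lemma solution_arc:
  assumes b: "\<And>s n. s \<in> {-1<..<1} \<Longrightarrow> b n + s *\<^sub>R \<beta> n \<in> B n"
    and \<beta>: "\<And>n. norm (\<beta> n) \<le> K"
  obtains U V where
    "\<And>s. s \<in> {-1<..<1} \<Longrightarrow> solves A (U s)"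
    "\<And>s n. s \<in> {-1<..<1} \<Longrightarrow> n \<notin> A \<Longrightarrow> U s n = b n + s *\<^sub>R \<beta> n"
    "\<And>s n. s \<in> {-1<..<1} \<Longrightarrow> ((\<lambda>s. U s n) has_vector_derivative V s n) (at s)"
    "\<And>n. continuous_on {-1<..<1} (\<lambda>s. V s n)"
    "\<And>s n. s \<in> {-1<..<1} \<Longrightarrow> n \<notin> A \<Longrightarrow> V s n = \<beta> n"
    "\<And>s n. s \<in> {-1<..<1} \<Longrightarrow> n \<in> A \<Longrightarrow> norm (V s n) \<le> l * K"
proof -
  let ?I = "{-1<..<1::real}"
  have K: "0 \<le> K" using \<beta>[of 0] norm_ge_zero order_trans by blast
  have "\<exists>u. solves A u \<and> (\<forall>n. n \<notin> A \<longrightarrow> u n = b n + s *\<^sub>R \<beta> n)" if "s \<in> ?I" for s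
    by (rule solves_exists[of "\<lambda>n. b n + s *\<^sub>R \<beta> n" A, OF b[OF that]])
  then obtain U where U: "\<And>s. s \<in> ?I \<Longrightarrow> solves A (U s)"
    and Ub: "\<And>s n. s \<in> ?I \<Longrightarrow> n \<notin> A \<Longrightarrow> U s n = b n + s *\<^sub>R \<beta> n" by metis
  have "\<exists>v. (\<forall>n. norm (v n) \<le> K) \<and>
      (\<forall>n. v n = (if n \<in> A then F' n (window (U s) n) (window v n) else \<beta> n))" if "s \<in> ?I" for s
    by (rule linearized_solution_exists[OF U[OF that] \<beta>])
  then obtain V where VK: "\<And>s n. s \<in> ?I \<Longrightarrow> norm (V s n) \<le> K"
    and V: "\<And>s n. s \<in> ?I \<Longrightarrow> V s n = (if n \<in> A then F' n (window (U s) n) (window (V s) n) else \<beta> n)"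
    by metis
  have w: "window (U s) n \<in> windows B n" if "s \<in> ?I" for s n
    using U[OF that] by (intro window_mem) (auto simp: solves_def)
  have UL: "norm (U t n - U s n) \<le> \<bar>t - s\<bar> * K" if "s \<in> ?I" "t \<in> ?I" for s t n
  proof (rule solves_stable[OF U[OF that(2)] U[OF that(1)]])
    fix n assume "n \<notin> A"
    hence "U t n - U s n = (t - s) *\<^sub>R \<beta> n" using that by (simp add: Ub algebra_simps)
    thus "norm (U t n - U s n) \<le> \<bar>t - s\<bar> * K" using \<beta>[of n] by (simp add: mult_left_mono)
  qed (use K in auto)
  have UL3: "norm3 (window (U t) n - window (U s) n) \<le> \<bar>t - s\<bar> * K" if "s \<in> ?I" "t \<in> ?I" for s t n
    unfolding window_diff by (rule norm3_window_le) (rule UL[OF that])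
  have close: "\<exists>d>0. \<forall>t. t \<in> ?I \<and> \<bar>t - s\<bar> < d \<longrightarrow>
       (\<forall>n. norm (U t n - U s n - (t - s) *\<^sub>R V s n) \<le> e * \<bar>t - s\<bar> \<and> norm (V t n - V s n) \<le> e)"
    if s: "s \<in> ?I" and e: "0 < e" for s e
  proof -
    define \<eta> where "\<eta> = e * (1 - l) / (K + 1)"
    have \<eta>: "0 < \<eta>"
      using e l K by (simp add: \<eta>_def)
    have "\<eta> * K / (1 - l) = e * (K / (K + 1))"
      using l by (simp add: \<eta>_def)
    also have "\<dots> \<le> e * 1"
      using e K by (intro mult_left_mono) auto
    finally have \<eta>K: "\<eta> * K / (1 - l) \<le> e" by simp
    obtain \<delta> where \<delta>: "\<delta> > 0" and C1: "\<And>n X Y. X \<in> windows B n \<Longrightarrow> Y \<in> windows B n \<Longrightarrow>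
         norm3 (Y - X) < \<delta> \<Longrightarrow>
          norm (F n Y - F n X - F' n X (Y - X)) \<le> \<eta> * norm3 (Y - X) \<and>
          (\<forall>v. norm (F' n Y v - F' n X v) \<le> \<eta> * norm3 v)"
      using uniformly_C1[OF \<eta>] by metis
    define d where "d = \<delta> / (K + 1)"
    have "d > 0" using \<delta> K by (simp add: d_def)
    moreover have "norm (U t n - U s n - (t - s) *\<^sub>R V s n) \<le> e * \<bar>t - s\<bar> \<and> norm (V t n - V s n) \<le> e"
      if t: "t \<in> ?I" "\<bar>t - s\<bar> < d" for t n
    proof -
      have small: "norm3 (window (U t) n - window (U s) n) < \<delta>" for n
      proof -
        have "\<bar>t - s\<bar> * K \<le> \<bar>t - s\<bar> * (K + 1)" by (simp add: mult_left_mono)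
        also have "\<dots> < \<delta>" using t(2) K by (simp add: d_def field_simps)
        finally show ?thesis using UL3[OF s t(1), of n] by linarith
      qed
      note C1' = C1[OF w[OF s] w[OF t(1)] small]
      \<comment> \<open>Differentiability: the remainder solves the linearised equations up to a small error.\<close>
      have "norm (U t n - U s n - (t - s) *\<^sub>R V s n) \<le> (\<eta> * (\<bar>t - s\<bar> * K)) / (1 - l)"
      proof (rule absorb_sup_bound[where C = "\<bar>t - s\<bar> * K + \<bar>t - s\<bar> * K"])
        fix n
        have "norm (U t n - U s n - (t - s) *\<^sub>R V s n) \<le> norm (U t n - U s n) + \<bar>t - s\<bar> * norm (V s n)"
          using norm_triangle_ineq4[of "U t n - U s n" "(t - s) *\<^sub>R V s n"] by simp
        also have "\<dots> \<le> \<bar>t - s\<bar> * K + \<bar>t - s\<bar> * K"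
          by (intro add_mono UL s t mult_left_mono VK) auto
        finally show "norm (U t n - U s n - (t - s) *\<^sub>R V s n) \<le> \<bar>t - s\<bar> * K + \<bar>t - s\<bar> * K" .
      next
        fix R n assume R: "\<And>k. norm (U t k - U s k - (t - s) *\<^sub>R V s k) \<le> R"
        have R0: "0 \<le> R" using R[of 0] norm_ge_zero order_trans by blast
        have e0: "0 \<le> \<eta> * (\<bar>t - s\<bar> * K)" using \<eta> K by simp
        show "norm (U t n - U s n - (t - s) *\<^sub>R V s n) \<le> \<eta> * (\<bar>t - s\<bar> * K) + l * R"
        proof (cases "n \<in> A")
          case False
          thus ?thesis using R0 e0 l by (simp add: Ub[OF t(1)] Ub[OF s] V[OF s] algebra_simps)
        next
          case True
          let ?X = "window (U s) n" and ?Y = "window (U t) n"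
          let ?r = "window (\<lambda>k. U t k - U s k - (t - s) *\<^sub>R V s k) n"
          have r: "?r = (?Y - ?X) - (t - s) *\<^sub>R window (V s) n"
            by (simp add: window_def)
          have lin: "linear (F' n ?X)" by (rule linear_F'[OF w[OF s]])
          have "U t n = F n ?Y" "U s n = F n ?X"
            using U[OF s] U[OF t(1)] True by (auto simp: solves_def)
          moreover have "V s n = F' n ?X (window (V s) n)" using V[OF s, of n] True by simp
          moreover have "F' n ?X ?r = F' n ?X (?Y - ?X) - (t - s) *\<^sub>R F' n ?X (window (V s) n)"
            unfolding r by (simp only: linear_diff[OF lin] linear_cmul[OF lin])
          ultimately have eq: "U t n - U s n - (t - s) *\<^sub>R V s n
              = (F n ?Y - F n ?X - F' n ?X (?Y - ?X)) + F' n ?X ?r" by simp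
          have "norm (F n ?Y - F n ?X - F' n ?X (?Y - ?X)) \<le> \<eta> * norm3 (?Y - ?X)"
            using C1' by blast
          also have "\<dots> \<le> \<eta> * (\<bar>t - s\<bar> * K)"
            using UL3[OF s t(1), of n] \<eta> by (simp add: mult_left_mono)
          finally have 1: "norm (F n ?Y - F n ?X - F' n ?X (?Y - ?X)) \<le> \<eta> * (\<bar>t - s\<bar> * K)" .
          have "norm (F' n ?X ?r) \<le> l * norm3 ?r" by (rule F'_le[OF w[OF s]])
          also have "\<dots> \<le> l * R" by (intro mult_left_mono norm3_window_le R l)
          finally show ?thesis unfolding eq using 1 norm_triangle_ineq order_trans
            by (smt (verit))
        qed
      qed (use l in auto)
      also have "\<dots> = (\<eta> * K / (1 - l)) * \<bar>t - s\<bar>" by (simp add: field_simps)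
      also have "\<dots> \<le> e * \<bar>t - s\<bar>" by (intro mult_right_mono \<eta>K) auto
      finally have D: "norm (U t n - U s n - (t - s) *\<^sub>R V s n) \<le> e * \<bar>t - s\<bar>" .
      \<comment> \<open>Continuity: the two velocities solve linear equations with close coefficients.\<close>
      have "norm (V t n - V s n) \<le> (\<eta> * K) / (1 - l)"
      proof (rule absorb_sup_bound[where C = "K + K"])
        show "norm (V t n - V s n) \<le> K + K" for n
          using norm_triangle_ineq4[of "V t n" "V s n"] VK[OF s, of n] VK[OF t(1), of n] by linarith
      next
        fix R n assume R: "\<And>k. norm (V t k - V s k) \<le> R"
        have R0: "0 \<le> R" using R[of 0] norm_ge_zero order_trans by blast
        have e0: "0 \<le> \<eta> * K" using \<eta> K by simp
        show "norm (V t n - V s n) \<le> \<eta> * K + l * R"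
        proof (cases "n \<in> A")
          case False
          thus ?thesis using R0 e0 l V[OF s, of n] V[OF t(1), of n] by simp
        next
          case True
          let ?X = "window (U s) n" and ?Y = "window (U t) n"
          have lin: "linear (F' n ?X)" by (rule linear_F'[OF w[OF s]])
          have eq: "V t n - V s n = (F' n ?Y (window (V t) n) - F' n ?X (window (V t) n))
              + F' n ?X (window (V t) n - window (V s) n)"
            using True V[OF s, of n] V[OF t(1), of n] by (simp add: linear_diff[OF lin])
          have "norm (F' n ?Y (window (V t) n) - F' n ?X (window (V t) n)) \<le> \<eta> * norm3 (window (V t) n)"
            using C1' by blast
          also have "\<dots> \<le> \<eta> * K"
            using \<eta> by (intro mult_left_mono norm3_window_le VK t) auto
          finally have 1: "norm (F' n ?Y (window (V t) n) - F' n ?X (window (V t) n)) \<le> \<eta> * K" .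
          have "norm (F' n ?X (window (V t) n - window (V s) n)) \<le> l * norm3 (window (V t) n - window (V s) n)"
            by (rule F'_le[OF w[OF s]])
          also have "\<dots> \<le> l * R"
            unfolding window_diff by (intro mult_left_mono norm3_window_le R l)
          finally show ?thesis unfolding eq using 1 norm_triangle_ineq order_trans
            by (smt (verit))
        qed
      qed (use l in auto)
      with D \<eta>K show ?thesis by linarith
    qed
    ultimately show ?thesis by blast
  qed
  show thesis
  proof
    show "solves A (U s)" if "s \<in> ?I" for s by (rule U[OF that])
    show "U s n = b n + s *\<^sub>R \<beta> n" if "s \<in> ?I" "n \<notin> A" for s n by (rule Ub[OF that])
    show "V s n = \<beta> n" if "s \<in> ?I" "n \<notin> A" for s n using V[OF that(1), of n] that(2) by simp
    show "norm (V s n) \<le> l * K" if "s \<in> ?I" "n \<in> A" for s n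
    proof -
      have "norm (V s n) \<le> l * norm3 (window (V s) n)"
        using V[OF that(1), of n] that(2) F'_le[OF w[OF that(1)], of n "window (V s) n"] by simp
      also have "\<dots> \<le> l * K" by (intro mult_left_mono norm3_window_le VK that l)
      finally show ?thesis .
    qed
    show "((\<lambda>s. U s n) has_vector_derivative V s n) (at s)" if s: "s \<in> ?I" for s n
      unfolding has_vector_derivative_def has_derivative_at_alt
    proof (intro conjI allI impI)
      show "bounded_linear (\<lambda>x. x *\<^sub>R V s n)" by (rule bounded_linear_scaleR_left)
      fix e :: real assume "0 < e"
      obtain d where d: "d > 0" and D: "\<And>t n. t \<in> ?I \<Longrightarrow> \<bar>t - s\<bar> < d \<Longrightarrow>
          norm (U t n - U s n - (t - s) *\<^sub>R V s n) \<le> e * \<bar>t - s\<bar>"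
        using close[OF s \<open>0 < e\<close>] by metis
      obtain d' where d': "d' > 0" "\<And>t. \<bar>t - s\<bar> < d' \<Longrightarrow> t \<in> ?I"
        using s open_greaterThanLessThan[of "-1" "1::real"] unfolding open_dist dist_real_def by metis
      show "\<exists>d>0. \<forall>y. norm (y - s) < d \<longrightarrow> norm (U y n - U s n - (y - s) *\<^sub>R V s n) \<le> e * norm (y - s)"
        using d d' D by (intro exI[of _ "min d d'"]) auto
    qed
    show "continuous_on ?I (\<lambda>s. V s n)" for n
      unfolding continuous_on_iff
    proof (intro ballI allI impI)
      fix s e :: real assume s: "s \<in> ?I" and "0 < e"
      then obtain d where "d > 0" "\<And>t n. t \<in> ?I \<Longrightarrow> \<bar>t - s\<bar> < d \<Longrightarrow> norm (V t n - V s n) \<le> e / 2"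
        using close[OF s half_gt_zero[OF \<open>0 < e\<close>]] by metis
      with \<open>0 < e\<close> show "\<exists>d>0. \<forall>x'\<in>?I. dist x' s < d \<longrightarrow> dist (V x' n) (V s n) < e"
        by (intro exI[of _ d]) (auto simp: dist_norm intro: le_less_trans[of _ "e / 2"])
    qed
  qed
qed

end

section \<open>Free flight and boundary laws in polar coordinates\<close>

text \<open>The length of the gradient \<open>(cos \<theta>, sqrt (1 + e) * sin \<theta>)\<close> of \<open>Psi\<close>, up to the factor \<open>2 \<rho>\<close>, at
  the point with polar coordinates \<open>(\<rho>, \<theta>)\<close>.\<close>

definition stretch :: "real \<Rightarrow> real \<Rightarrow> real" where
  "stretch e \<theta> = sqrt (1 + e * (sin \<theta>)\<^sup>2)"

text \<open>Physical position and velocity of a particle whose scaled position is \<open>\<rho>\<close> times the unit vector at angle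
  \<open>\<theta>\<close> and whose scaled velocity has radial component \<open>a\<close> and angular component \<open>J\<close> there.\<close>

definition polar_point :: "real \<Rightarrow> real \<Rightarrow> real \<Rightarrow> plane" where
  "polar_point e \<rho> \<theta> = (\<rho> * cos \<theta>, \<rho> * sin \<theta> / sqrt (1 + e))"

definition polar_velocity :: "real \<Rightarrow> real \<Rightarrow> real \<Rightarrow> real \<Rightarrow> plane" where
  "polar_velocity e \<theta> a J = (a * cos \<theta> - J * sin \<theta>, (a * sin \<theta> + J * cos \<theta>) / sqrt (1 + e))"

text \<open>The change between polar components and the physical normal and tangential components
  \<open>m\<close>, \<open>p\<close>: the radial component is \<open>m * stretch e \<theta>\<close>, the angular one \<open>angular e \<theta> m p\<close>, and
  \<open>tangential\<close> recovers \<open>p\<close> from these two. For \<open>e = 0\<close> both are projections.\<close>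

definition tangential :: "real \<Rightarrow> real \<Rightarrow> real \<Rightarrow> real \<Rightarrow> real" where
  "tangential e \<theta> a J = (J * stretch e \<theta> - a * e * sin \<theta> * cos \<theta> / stretch e \<theta>) / sqrt (1 + e)"

definition angular :: "real \<Rightarrow> real \<Rightarrow> real \<Rightarrow> real \<Rightarrow> real" where
  "angular e \<theta> m p = (p * sqrt (1 + e) + m * e * sin \<theta> * cos \<theta>) / stretch e \<theta>"

lemma unit_normal_uminus: "unit_normal \<nu> (- R) = - unit_normal \<nu> R"
proof -
  have "(fst (- R), \<nu> * snd (- R)) = - (fst R, \<nu> * snd R)" by simp
  thus ?thesis unfolding unit_normal_def by (simp only: sgn_minus)
qed

lemma unit_tangent_uminus: "unit_tangent \<nu> (- R) = - unit_tangent \<nu> R"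
  unfolding unit_tangent_def unit_normal_uminus by simp

lemma cos_sin_arctan_ratio:
  assumes "a \<noteq> 0"
  shows "cos (arctan (J / a)) = \<bar>a\<bar> / sqrt (a\<^sup>2 + J\<^sup>2)" "sin (arctan (J / a)) = sgn a * J / sqrt (a\<^sup>2 + J\<^sup>2)"
proof -
  have "1 + (J / a)\<^sup>2 = (a\<^sup>2 + J\<^sup>2) / a\<^sup>2" using assms by (simp add: field_simps)
  hence s: "sqrt (1 + (J / a)\<^sup>2) = sqrt (a\<^sup>2 + J\<^sup>2) / \<bar>a\<bar>" by (simp add: real_sqrt_divide)
  show "cos (arctan (J / a)) = \<bar>a\<bar> / sqrt (a\<^sup>2 + J\<^sup>2)"
    unfolding cos_arctan s by simp
  show "sin (arctan (J / a)) = sgn a * J / sqrt (a\<^sup>2 + J\<^sup>2)"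
    unfolding sin_arctan s using assms by (simp add: sgn_if abs_if field_simps)
qed

text \<open>\<open>arctan (J / a)\<close> is the argument of \<open>(a, J)\<close> up to a half turn, and the half turns cancel in the
  difference if \<open>a\<close> and \<open>a'\<close> have the same sign.\<close>

lemma swing_cos_sin:
  fixes a J a' J' :: real
  assumes s: "0 < a * a'" and A: "a\<^sup>2 + J\<^sup>2 = A" "a'\<^sup>2 + J'\<^sup>2 = A"
  defines "\<delta> \<equiv> arctan (J / a) - arctan (J' / a')"
  shows "A * cos \<delta> = a * a' + J * J'" "A * sin \<delta> = J * a' - a * J'"
proof -
  have nz: "a \<noteq> 0" "a' \<noteq> 0" using s by auto
  have pos: "0 < A" using A(1) nz by (metis add_pos_nonneg zero_less_power2 zero_le_power2)
  have sg: "sgn a = sgn a'" "\<bar>a\<bar> = sgn a * a" "\<bar>a'\<bar> = sgn a * a'" "sgn a * sgn a = 1"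
    using s by (auto simp: zero_less_mult_iff sgn_if)
  have sq: "sqrt A * sqrt A = A" using pos by simp
  have "cos \<delta> = (sgn a * a * (sgn a * a') + sgn a * J * (sgn a * J')) / (sqrt A * sqrt A)"
    unfolding \<delta>_def cos_diff cos_sin_arctan_ratio[OF nz(1)] cos_sin_arctan_ratio[OF nz(2)] A sg(2,3)
      sg(1)[symmetric] by (simp add: add_divide_distrib)
  also have "sgn a * a * (sgn a * a') + sgn a * J * (sgn a * J') = (sgn a * sgn a) * (a * a' + J * J')"
    by algebra
  finally show "A * cos \<delta> = a * a' + J * J'" unfolding sg(4) sq using pos by simp
  have "sin \<delta> = (sgn a * J * (sgn a * a') - sgn a * a * (sgn a * J')) / (sqrt A * sqrt A)"
    unfolding \<delta>_def sin_diff cos_sin_arctan_ratio[OF nz(1)] cos_sin_arctan_ratio[OF nz(2)] A sg(2,3)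
      sg(1)[symmetric] by (simp add: diff_divide_distrib)
  also have "sgn a * J * (sgn a * a') - sgn a * a * (sgn a * J') = (sgn a * sgn a) * (J * a' - a * J')"
    by algebra
  finally show "A * sin \<delta> = J * a' - a * J'" unfolding sg(4) sq using pos by simp
qed

lemma flight_scale:
  assumes "flight U R V R'" "0 < c"
  shows "flight U R (c *\<^sub>R V) R'"
proof -
  obtain t where t: "t > 0" "R' = R + t *\<^sub>R V" "\<And>s. s \<in> {0<..<t} \<Longrightarrow> R + s *\<^sub>R V \<in> U"
    using assms(1) unfolding flight_def by blast
  show ?thesis unfolding flight_def
    using t(1,2) assms(2) t(3)[of "s * c" for s]
    by (intro exI[of _ "t / c"]) (auto simp: field_simps)
qed

lemma flight_uminus:
  assumes "flight U R V R'" "\<And>x. x \<in> U \<Longrightarrow> - x \<in> U"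
  shows "flight U (- R) (- V) (- R')"
  using assms unfolding flight_def
  by (metis (no_types, opaque_lifting) minus_add_distrib scaleR_minus_right)

lemma annulus_uminus: "x \<in> annulus \<nu> \<alpha> \<Longrightarrow> - x \<in> annulus \<nu> \<alpha>"
  by (simp add: annulus_def Psi_def)

context
  fixes e :: real
  assumes e: "0 < e"
begin

lemma r_pos: "0 < sqrt (1 + e)" "(sqrt (1 + e))\<^sup>2 = 1 + e" "sqrt (1 + e) * sqrt (1 + e) = 1 + e"
  using e by (auto simp: power2_eq_square)

lemma stretch_pos: "0 < stretch e \<theta>"
  using e by (simp add: stretch_def add_pos_nonneg)

lemma stretch_sq: "(stretch e \<theta>)\<^sup>2 = 1 + e * (sin \<theta>)\<^sup>2"
  using e by (simp add: stretch_def)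

lemma stretch_sq': "(stretch e \<theta>)\<^sup>2 = (cos \<theta>)\<^sup>2 + (1 + e) * (sin \<theta>)\<^sup>2"
  unfolding stretch_sq cos_squared_eq by (simp add: algebra_simps)

lemma unit_normal_polar:
  assumes "0 < \<rho>"
  shows "unit_normal (1 + e) (polar_point e \<rho> \<theta>) =
    (cos \<theta> / stretch e \<theta>, sqrt (1 + e) * sin \<theta> / stretch e \<theta>)"
proof -
  have *: "(1 + e) * (\<rho> * sin \<theta> / sqrt (1 + e)) = \<rho> * (sqrt (1 + e) * sin \<theta>)"
    using r_pos by (simp add: field_simps)
  have n: "norm (\<rho> * cos \<theta>, \<rho> * (sqrt (1 + e) * sin \<theta>)) = \<rho> * stretch e \<theta>"
  proof -
    have "(\<rho> * cos \<theta>)\<^sup>2 + (\<rho> * (sqrt (1 + e) * sin \<theta>))\<^sup>2 = (\<rho> * stretch e \<theta>)\<^sup>2"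
      unfolding power_mult_distrib stretch_sq' r_pos(2) by algebra
    thus ?thesis
      using assms stretch_pos[of \<theta>] by (simp add: norm_Pair)
  qed
  show ?thesis
    unfolding unit_normal_def polar_point_def fst_conv snd_conv * sgn_div_norm n
    using assms stretch_pos[of \<theta>] by (simp add: divide_inverse)
qed

lemma unit_tangent_polar:
  assumes "0 < \<rho>"
  shows "unit_tangent (1 + e) (polar_point e \<rho> \<theta>) =
    (- (sqrt (1 + e) * sin \<theta> / stretch e \<theta>), cos \<theta> / stretch e \<theta>)"
  unfolding unit_tangent_def unit_normal_polar[OF assms] by simp

lemma velocity_normal:
  assumes "0 < \<rho>"
  shows "polar_velocity e \<theta> a J \<bullet> unit_normal (1 + e) (polar_point e \<rho> \<theta>) = a / stretch e \<theta>"
proof -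
  have "(a * cos \<theta> - J * sin \<theta>) * cos \<theta> + (a * sin \<theta> + J * cos \<theta>) * sin \<theta> = a"
    using sin_cos_squared_add[of \<theta>] by algebra
  moreover have "x * (cos \<theta> / stretch e \<theta>) + y / sqrt (1 + e) * (sqrt (1 + e) * sin \<theta> / stretch e \<theta>)
      = (x * cos \<theta> + y * sin \<theta>) / stretch e \<theta>" for x y
    using r_pos(1) by (simp add: add_divide_distrib)
  ultimately show ?thesis
    unfolding unit_normal_polar[OF assms] polar_velocity_def inner_Pair inner_real_def by simp
qed

lemma velocity_tangent:
  assumes "0 < \<rho>"
  shows "polar_velocity e \<theta> a J \<bullet> unit_tangent (1 + e) (polar_point e \<rho> \<theta>) = tangential e \<theta> a J"
proof -
  let ?r = "sqrt (1 + e)" and ?N = "stretch e \<theta>"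
  have N: "?N * ?N = (cos \<theta>)\<^sup>2 + (1 + e) * (sin \<theta>)\<^sup>2"
    using stretch_sq'[of \<theta>] by (simp add: power2_eq_square)
  have "(polar_velocity e \<theta> a J \<bullet> unit_tangent (1 + e) (polar_point e \<rho> \<theta>)) * (?r * ?N)
      = - (a * cos \<theta> - J * sin \<theta>) * (?r * ?r) * sin \<theta> + (a * sin \<theta> + J * cos \<theta>) * cos \<theta>"
    unfolding unit_tangent_polar[OF assms] polar_velocity_def inner_Pair inner_real_def
    using r_pos(1) stretch_pos[of \<theta>] by (simp add: field_simps)
  also have "\<dots> = J * (?N * ?N) - a * e * sin \<theta> * cos \<theta>"
    unfolding N r_pos(3) by algebra
  also have "\<dots> = tangential e \<theta> a J * (?r * ?N)"
    using r_pos(1) stretch_pos[of \<theta>] by (simp add: tangential_def field_simps)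
  finally show ?thesis using r_pos(1) stretch_pos[of \<theta>] by simp
qed

lemma frame_orthonormal:
  fixes \<theta> :: real
  assumes "0 < \<rho>"
  defines "n \<equiv> unit_normal (1 + e) (polar_point e \<rho> \<theta>)" and "t \<equiv> unit_tangent (1 + e) (polar_point e \<rho> \<theta>)"
  shows "n \<bullet> n = 1" "t \<bullet> t = 1" "n \<bullet> t = 0" "t \<bullet> n = 0"
proof -
  have N: "stretch e \<theta> * stretch e \<theta> = cos \<theta> * cos \<theta> + (1 + e) * (sin \<theta> * sin \<theta>)"
    using stretch_sq'[of \<theta>] by (simp add: power2_eq_square)
  have *: "cos \<theta> * cos \<theta> + (sqrt (1 + e) * sin \<theta>) * (sqrt (1 + e) * sin \<theta>) = stretch e \<theta> * stretch e \<theta>"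
    unfolding N using r_pos(3) by algebra
  show "n \<bullet> n = 1" "t \<bullet> t = 1" "n \<bullet> t = 0" "t \<bullet> n = 0"
    unfolding n_def t_def unit_normal_polar[OF assms(1)] unit_tangent_polar[OF assms(1)] inner_Pair inner_real_def
    using stretch_pos[of \<theta>] *
    by (simp_all add: times_divide_times_eq add_divide_distrib[symmetric] add.commute)
qed

lemma frame_expand:
  assumes "0 < \<rho>"
  shows "V = (V \<bullet> unit_tangent (1 + e) (polar_point e \<rho> \<theta>)) *\<^sub>R unit_tangent (1 + e) (polar_point e \<rho> \<theta>)
     + (V \<bullet> unit_normal (1 + e) (polar_point e \<rho> \<theta>)) *\<^sub>R unit_normal (1 + e) (polar_point e \<rho> \<theta>)"
proof -
  define n where "n = unit_normal (1 + e) (polar_point e \<rho> \<theta>)"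
  have t: "unit_tangent (1 + e) (polar_point e \<rho> \<theta>) = (- snd n, fst n)"
    by (simp add: unit_tangent_def n_def)
  have n1: "fst n * fst n + snd n * snd n = 1"
    using frame_orthonormal(1)[OF assms, of \<theta>] by (simp add: n_def[symmetric] inner_prod_def)
  show ?thesis
    unfolding t n_def[symmetric]
  proof (rule prod_eqI)
    show "fst V = fst ((V \<bullet> (- snd n, fst n)) *\<^sub>R (- snd n, fst n) + (V \<bullet> n) *\<^sub>R n)"
      using n1 by (simp add: inner_prod_def) algebra
    show "snd V = snd ((V \<bullet> (- snd n, fst n)) *\<^sub>R (- snd n, fst n) + (V \<bullet> n) *\<^sub>R n)"
      using n1 by (simp add: inner_prod_def) algebra
  qed
qed

lemma velocity_pythagoras:
  "(a / stretch e \<theta>)\<^sup>2 + (tangential e \<theta> a J)\<^sup>2 = (norm (polar_velocity e \<theta> a J))\<^sup>2"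
proof -
  let ?t = "unit_tangent (1 + e) (polar_point e 1 \<theta>)" and ?n = "unit_normal (1 + e) (polar_point e 1 \<theta>)"
  let ?V = "polar_velocity e \<theta> a J"
  note on = frame_orthonormal[of 1 \<theta>, OF zero_less_one]
  have "?V \<bullet> ?V = ((?V \<bullet> ?t) *\<^sub>R ?t + (?V \<bullet> ?n) *\<^sub>R ?n) \<bullet> ((?V \<bullet> ?t) *\<^sub>R ?t + (?V \<bullet> ?n) *\<^sub>R ?n)"
    using frame_expand[of 1 ?V \<theta>] by simp
  also have "\<dots> = (?V \<bullet> ?t)\<^sup>2 + (?V \<bullet> ?n)\<^sup>2"
    using on by (simp add: inner_add_left inner_add_right power2_eq_square)
  finally show ?thesis
    by (simp add: velocity_normal velocity_tangent power2_norm_eq_inner add.commute)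
qed

lemma tangential_angular: "tangential e \<theta> (m * stretch e \<theta>) (angular e \<theta> m p) = p"
  unfolding tangential_def angular_def using r_pos(1) stretch_pos[of \<theta>] by (simp add: field_simps)

lemma velocity_from_frame:
  assumes "0 < \<rho>"
  shows "p *\<^sub>R unit_tangent (1 + e) (polar_point e \<rho> \<theta>) + m *\<^sub>R unit_normal (1 + e) (polar_point e \<rho> \<theta>)
     = polar_velocity e \<theta> (m * stretch e \<theta>) (angular e \<theta> m p)"
  using frame_expand[OF assms, of "polar_velocity e \<theta> (m * stretch e \<theta>) (angular e \<theta> m p)" \<theta>]
    stretch_pos[of \<theta>]
  by (simp add: velocity_normal[OF assms] velocity_tangent[OF assms] tangential_angular)

text \<open>The scaled velocity is a fixed vector; seen from the moving polar frame it turns by the angle that the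
  particle advances. Two frames related by equal length and equal angular momentum \<open>\<rho> J\<close>
  thus describe the same line, and the advance is the difference of the two arguments.
  Negative \<open>\<rho>'\<close> is allowed, for a chord that ends near the antipode.\<close>

lemma free_flight:
  fixes a J a' J' \<theta> \<rho> \<rho>' :: real
  assumes s: "0 < a * a'" and A: "a\<^sup>2 + J\<^sup>2 = A" "a'\<^sup>2 + J'\<^sup>2 = A" and L: "\<rho> * J = \<rho>' * J'"
  defines "\<theta>' \<equiv> \<theta> + (arctan (J / a) - arctan (J' / a'))"
  shows "polar_velocity e \<theta> a J = polar_velocity e \<theta>' a' J'"
    and "polar_point e \<rho> \<theta> + ((\<rho>' * a' - \<rho> * a) / A) *\<^sub>R polar_velocity e \<theta> a J = polar_point e \<rho>' \<theta>'"
proof -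
  define \<delta> where "\<delta> = arctan (J / a) - arctan (J' / a')"
  note cs = swing_cos_sin[OF s A, folded \<delta>_def]
  have pos: "0 < A" using A(1) s by (metis add_pos_nonneg less_numeral_extra(3) mult_zero_left zero_le_power2 zero_less_power2)
  have c: "cos \<theta>' = cos \<theta> * cos \<delta> - sin \<theta> * sin \<delta>" "sin \<theta>' = sin \<theta> * cos \<delta> + cos \<theta> * sin \<delta>"
    unfolding \<theta>'_def \<delta>_def by (simp_all add: cos_add sin_add)
  have a: "a' * cos \<delta> - J' * sin \<delta> = a" "a' * sin \<delta> + J' * cos \<delta> = J"
  proof -
    have "A * (a' * cos \<delta> - J' * sin \<delta>) = a' * (A * cos \<delta>) - J' * (A * sin \<delta>)"
      "A * (a' * sin \<delta> + J' * cos \<delta>) = a' * (A * sin \<delta>) + J' * (A * cos \<delta>)"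
      by (simp_all add: algebra_simps)
    hence "A * (a' * cos \<delta> - J' * sin \<delta>) = A * a" "A * (a' * sin \<delta> + J' * cos \<delta>) = A * J"
      unfolding cs by (simp_all add: A(2)[symmetric] algebra_simps power2_eq_square)
    thus "a' * cos \<delta> - J' * sin \<delta> = a" "a' * sin \<delta> + J' * cos \<delta> = J" using pos by auto
  qed
  have v1: "a * cos \<theta> - J * sin \<theta> = a' * cos \<theta>' - J' * sin \<theta>'"
    and v2: "a * sin \<theta> + J * cos \<theta> = a' * sin \<theta>' + J' * cos \<theta>'"
    by (simp_all add: c a[symmetric] algebra_simps)
  show "polar_velocity e \<theta> a J = polar_velocity e \<theta>' a' J'"
    unfolding polar_velocity_def v1 v2 ..
  define t where "t = (\<rho>' * a' - \<rho> * a) / A"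
  have tA: "t * A = \<rho>' * a' - \<rho> * a" using pos by (simp add: t_def)
  have "A * (\<rho> + t * a) = \<rho> * (a\<^sup>2 + J\<^sup>2) + (t * A) * a"
    unfolding A by (simp add: algebra_simps)
  also have "\<dots> = (\<rho> * J) * J + \<rho>' * a' * a"
    unfolding tA by (simp add: algebra_simps power2_eq_square)
  also have "\<dots> = \<rho>' * (a * a' + J * J')"
    unfolding L by (simp add: algebra_simps)
  finally have "A * (\<rho> + t * a) = A * (\<rho>' * cos \<delta>)"
    unfolding cs(1)[symmetric] by (simp add: algebra_simps)
  moreover have "A * (t * J) = A * (\<rho>' * sin \<delta>)"
  proof -
    have "A * (t * J) = (t * A) * J" by simp
    also have "\<dots> = \<rho>' * a' * J - (\<rho> * J) * a" unfolding tA by (simp add: algebra_simps)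
    also have "\<dots> = \<rho>' * (J * a' - a * J')" unfolding L by (simp add: algebra_simps)
    finally show ?thesis unfolding cs(2)[symmetric] by (simp add: algebra_simps)
  qed
  ultimately
  have p: "\<rho> + t * a = \<rho>' * cos \<delta>" "t * J = \<rho>' * sin \<delta>" using pos by auto
  have x: "\<rho> * cos \<theta> + t * (a * cos \<theta> - J * sin \<theta>) = \<rho>' * cos \<theta>'"
    and y: "\<rho> * sin \<theta> + t * (a * sin \<theta> + J * cos \<theta>) = \<rho>' * sin \<theta>'"
  proof -
    have "\<rho> * cos \<theta> + t * (a * cos \<theta> - J * sin \<theta>) = (\<rho> + t * a) * cos \<theta> - (t * J) * sin \<theta>"
      "\<rho> * sin \<theta> + t * (a * sin \<theta> + J * cos \<theta>) = (\<rho> + t * a) * sin \<theta> + (t * J) * cos \<theta>"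
      by (simp_all add: algebra_simps)
    thus "\<rho> * cos \<theta> + t * (a * cos \<theta> - J * sin \<theta>) = \<rho>' * cos \<theta>'"
      "\<rho> * sin \<theta> + t * (a * sin \<theta> + J * cos \<theta>) = \<rho>' * sin \<theta>'"
      unfolding p c by (simp_all add: algebra_simps)
  qed
  show "polar_point e \<rho> \<theta> + ((\<rho>' * a' - \<rho> * a) / A) *\<^sub>R polar_velocity e \<theta> a J = polar_point e \<rho>' \<theta>'"
    unfolding t_def[symmetric] polar_point_def polar_velocity_def x[symmetric] y[symmetric]
    by (simp add: add_divide_distrib[symmetric])
qed

lemma Psi_along_flight:
  "Psi (1 + e) (polar_point e \<rho> \<theta> + s *\<^sub>R polar_velocity e \<theta> a J) = \<rho>\<^sup>2 + 2 * \<rho> * a * s + (a\<^sup>2 + J\<^sup>2) * s\<^sup>2"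
proof -
  have "Psi (1 + e) (polar_point e \<rho> \<theta> + s *\<^sub>R polar_velocity e \<theta> a J) =
     (\<rho> * cos \<theta> + s * (a * cos \<theta> - J * sin \<theta>))\<^sup>2
     + (1 + e) * ((\<rho> * sin \<theta> + s * (a * sin \<theta> + J * cos \<theta>)) / sqrt (1 + e))\<^sup>2"
    by (simp add: Psi_def polar_point_def polar_velocity_def add_divide_distrib[symmetric])
  also have "(1 + e) * ((\<rho> * sin \<theta> + s * (a * sin \<theta> + J * cos \<theta>)) / sqrt (1 + e))\<^sup>2
     = (\<rho> * sin \<theta> + s * (a * sin \<theta> + J * cos \<theta>))\<^sup>2"
    using e by (simp add: power_divide)
  also have "(\<rho> * cos \<theta> + s * (a * cos \<theta> - J * sin \<theta>))\<^sup>2 + \<dots> = \<rho>\<^sup>2 + 2 * \<rho> * a * s + (a\<^sup>2 + J\<^sup>2) * s\<^sup>2"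
    using sin_cos_squared_add[of \<theta>] by algebra
  finally show ?thesis .
qed

lemma Psi_polar_point: "Psi (1 + e) (polar_point e \<rho> \<theta>) = \<rho>\<^sup>2"
  using Psi_along_flight[of \<rho> \<theta> 0] by simp

text \<open>The chord of a circle leaves with the opposite radial and the same angular component. The end point
  is described by its antipode, in keeping with the reduced section.\<close>

lemma chord_flight:
  fixes a J \<theta> :: real
  assumes a: "a < 0"
  defines "\<theta>' \<equiv> \<theta> + (arctan (J / a) - arctan (- J / a))"
  shows "flight (inner_region (1 + e) (1/2)) (polar_point e (1/2) \<theta>) (polar_velocity e \<theta> a J) (- polar_point e (1/2) \<theta>')"
    and "polar_velocity e \<theta> a J = - polar_velocity e \<theta>' (- a) J"
proof -
  define A where "A = a\<^sup>2 + J\<^sup>2"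
  have pos: "0 < A" using a by (simp add: A_def add_pos_nonneg)
  have s: "0 < a * a" using a by (simp add: mult_neg_neg)
  have A: "a\<^sup>2 + J\<^sup>2 = A" "a\<^sup>2 + (- J)\<^sup>2 = A" by (simp_all add: A_def)
  have flip: "1 / 2 * J = - 1 / 2 * - J" by simp
  note ff = free_flight[OF s A, of "1/2" "-1/2" \<theta>, folded \<theta>'_def]
  show "polar_velocity e \<theta> a J = - polar_velocity e \<theta>' (- a) J"
    unfolding ff(1)[OF flip] by (simp add: polar_velocity_def add_divide_distrib diff_divide_distrib)
  have p: "polar_point e (-1/2) \<theta>' = - polar_point e (1/2) \<theta>'" by (simp add: polar_point_def)
  show "flight (inner_region (1 + e) (1/2)) (polar_point e (1/2) \<theta>) (polar_velocity e \<theta> a J) (- polar_point e (1/2) \<theta>')"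
    unfolding flight_def
  proof (intro exI[of _ "- a / A"] conjI ballI)
    show "- a / A > 0" using a pos by (simp add: divide_neg_pos)
    show "- polar_point e (1/2) \<theta>' = polar_point e (1/2) \<theta> + (- a / A) *\<^sub>R polar_velocity e \<theta> a J"
      using ff(2)[OF flip] unfolding p by (simp add: add_divide_distrib)
    fix s assume s: "s \<in> {0<..<- a / A}"
    hence "A * s < - a" using pos by (simp add: field_simps)
    hence "s * (a + A * s) < 0" using s by (simp add: mult_pos_neg)
    thus "polar_point e (1/2) \<theta> + s *\<^sub>R polar_velocity e \<theta> a J \<in> inner_region (1 + e) (1/2)"
      unfolding inner_region_def mem_Collect_eq Psi_along_flight A_def[symmetric]
      by (simp add: algebra_simps power2_eq_square)
  qed
qed

lemma outward_flight:
  fixes a J a' \<theta> :: real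
  assumes a: "0 < a" "0 < a'" and a': "a'\<^sup>2 = a\<^sup>2 + J\<^sup>2 - (J/2)\<^sup>2"
  defines "\<theta>' \<equiv> \<theta> + (arctan (J / a) - arctan ((J/2) / a'))"
  shows "flight (annulus (1 + e) (1/2)) (polar_point e (1/2) \<theta>) (polar_velocity e \<theta> a J) (polar_point e 1 \<theta>')"
    and "polar_velocity e \<theta> a J = polar_velocity e \<theta>' a' (J/2)"
proof -
  define A where "A = a\<^sup>2 + J\<^sup>2"
  have pos: "0 < A" using a by (simp add: A_def add_pos_nonneg)
  have s: "0 < a * a'" using a by simp
  have A: "a\<^sup>2 + J\<^sup>2 = A" "a'\<^sup>2 + (J/2)\<^sup>2 = A" by (simp_all add: A_def a')
  note ff = free_flight[OF s A, of "1/2" 1 \<theta>, folded \<theta>'_def]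
  show "polar_velocity e \<theta> a J = polar_velocity e \<theta>' a' (J/2)" using ff(1) by simp
  have "a\<^sup>2 \<le> a'\<^sup>2" unfolding a' by (simp add: power_divide)
  hence aa: "a \<le> a'" using a by (simp add: power2_le_iff_abs_le)
  define t where "t = (a' - a / 2) / A"
  have end1: "polar_point e (1/2) \<theta> + t *\<^sub>R polar_velocity e \<theta> a J = polar_point e 1 \<theta>'"
    using ff(2) by (simp add: t_def)
  have Qt: "(1/2)\<^sup>2 + 2 * (1/2) * a * t + A * t\<^sup>2 = 1"
    using Psi_along_flight[of "1/2" \<theta> t a J] unfolding end1 Psi_polar_point A by simp
  show "flight (annulus (1 + e) (1/2)) (polar_point e (1/2) \<theta>) (polar_velocity e \<theta> a J) (polar_point e 1 \<theta>')"
    unfolding flight_def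
  proof (intro exI[of _ t] conjI ballI)
    show "t > 0" using aa a pos by (simp add: t_def)
    show "polar_point e 1 \<theta>' = polar_point e (1/2) \<theta> + t *\<^sub>R polar_velocity e \<theta> a J"
      using end1 by simp
    fix s assume s: "s \<in> {0<..<t}"
    have "0 < a * s" "0 \<le> A * s\<^sup>2" "a * s < a * t" "A * s\<^sup>2 \<le> A * t\<^sup>2"
      using s a pos by (auto intro!: mult_left_mono power_mono)
    thus "polar_point e (1/2) \<theta> + s *\<^sub>R polar_velocity e \<theta> a J \<in> annulus (1 + e) (1/2)"
      unfolding annulus_def mem_Collect_eq Psi_along_flight A using Qt by simp
  qed
qed

lemma inward_flight:
  fixes a J a' \<theta> :: real
  assumes a: "0 < a" "0 < a'" and a': "a'\<^sup>2 = a\<^sup>2 + J\<^sup>2 - (2 * J)\<^sup>2"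
  defines "\<theta>' \<equiv> \<theta> + (arctan (J / (- a)) - arctan (2 * J / (- a')))"
  shows "flight (annulus (1 + e) (1/2)) (polar_point e 1 \<theta>) (polar_velocity e \<theta> (- a) J) (polar_point e (1/2) \<theta>')"
    and "polar_velocity e \<theta> (- a) J = polar_velocity e \<theta>' (- a') (2 * J)"
proof -
  define A where "A = a\<^sup>2 + J\<^sup>2"
  have pos: "0 < A" using a by (simp add: A_def add_pos_nonneg)
  have s: "0 < (- a) * (- a')" using a by simp
  have A: "(- a)\<^sup>2 + J\<^sup>2 = A" "(- a')\<^sup>2 + (2 * J)\<^sup>2 = A" by (simp_all add: A_def a')
  note ff = free_flight[OF s A, of 1 "1/2" \<theta>, folded \<theta>'_def]
  show "polar_velocity e \<theta> (- a) J = polar_velocity e \<theta>' (- a') (2 * J)" using ff(1) by simp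
  have "a'\<^sup>2 \<le> a\<^sup>2" unfolding a' by (simp add: power_mult_distrib)
  hence aa: "a' \<le> a" using a by (simp add: power2_le_iff_abs_le)
  define t where "t = (a - a' / 2) / A"
  have tA: "A * t = a - a' / 2" using pos by (simp add: t_def)
  have end1: "polar_point e 1 \<theta> + t *\<^sub>R polar_velocity e \<theta> (- a) J = polar_point e (1/2) \<theta>'"
    using ff(2) by (simp add: t_def)
  have Qt: "1 - 2 * a * t + A * t\<^sup>2 = (1/2)\<^sup>2"
    using Psi_along_flight[of 1 \<theta> t "- a" J] unfolding end1 Psi_polar_point A by simp
  show "flight (annulus (1 + e) (1/2)) (polar_point e 1 \<theta>) (polar_velocity e \<theta> (- a) J) (polar_point e (1/2) \<theta>')"
    unfolding flight_def
  proof (intro exI[of _ t] conjI ballI)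
    show "t > 0" using aa a pos by (simp add: t_def)
    show "polar_point e (1/2) \<theta>' = polar_point e 1 \<theta> + t *\<^sub>R polar_velocity e \<theta> (- a) J"
      using end1 by simp
    fix s assume s: "s \<in> {0<..<t}"
    have As: "A * s < A * t" using s pos by simp
    have "s * (2 * a - A * s) > 0" using s As a tA by (intro mult_pos_pos) auto
    moreover have "(t - s) * (2 * a - A * t - A * s) > 0"
      using s As a tA by (intro mult_pos_pos) auto
    ultimately show "polar_point e 1 \<theta> + s *\<^sub>R polar_velocity e \<theta> (- a) J \<in> annulus (1 + e) (1/2)"
      unfolding annulus_def mem_Collect_eq Psi_along_flight A using Qt
      by (simp add: algebra_simps power2_eq_square)
  qed
qed

text \<open>Reflection keeps the tangential component; since the metric is not rotationally symmetric, the
  angular component changes by a term of size \<open>e\<close>.\<close>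

lemma reflect_polar:
  assumes "0 < \<rho>"
  shows "reflect (1 + e) (polar_point e \<rho> \<theta>) (polar_velocity e \<theta> a J) =
    polar_velocity e \<theta> (- a) (J - 2 * a * e * sin \<theta> * cos \<theta> / (stretch e \<theta>)\<^sup>2)"
proof -
  let ?N = "stretch e \<theta>" and ?n = "unit_normal (1 + e) (polar_point e \<rho> \<theta>)"
    and ?t = "unit_tangent (1 + e) (polar_point e \<rho> \<theta>)"
  define p where "p = tangential e \<theta> a J"
  define m where "m = a / ?N"
  have N: "0 < ?N" by (rule stretch_pos)
  have V: "polar_velocity e \<theta> a J = p *\<^sub>R ?t + m *\<^sub>R ?n"
    using frame_expand[OF assms, of "polar_velocity e \<theta> a J" \<theta>]
    by (simp add: velocity_normal[OF assms] velocity_tangent[OF assms] p_def m_def)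
  have m: "polar_velocity e \<theta> a J \<bullet> ?n = m" by (simp add: velocity_normal[OF assms] m_def)
  have "reflect (1 + e) (polar_point e \<rho> \<theta>) (polar_velocity e \<theta> a J) = p *\<^sub>R ?t + (- m) *\<^sub>R ?n"
    unfolding reflect_def m unfolding V by (simp add: algebra_simps)
      (metis (no_types) scaleR_2 scaleR_scaleR mult.commute)
  also have "\<dots> = polar_velocity e \<theta> (- m * ?N) (angular e \<theta> (- m) p)"
    by (rule velocity_from_frame[OF assms])
  also have "- m * ?N = - a" using N by (simp add: m_def)
  also have "angular e \<theta> (- m) p = J - 2 * a * e * sin \<theta> * cos \<theta> / ?N\<^sup>2"
    using N r_pos(1) by (simp add: angular_def p_def tangential_def m_def field_simps power2_eq_square)
  finally show ?thesis .
qed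

end

section \<open>The return in closed form\<close>

text \<open>The functions below follow one return in the order of events. Velocities in the annulus are
  divided by \<open>q = e/16\<close>, so that all velocities have unit physical length. First the chord, entered with normal
  component \<open>chord_normal e p\<close>, and its exit angle (of the antipode of the exit point).\<close>

definition chord_normal :: "real \<Rightarrow> real \<Rightarrow> real" where
  "chord_normal e p = - sqrt (1 - (e * p / 16)\<^sup>2)"

definition exit_angle :: "real \<Rightarrow> real \<Rightarrow> real \<Rightarrow> real" where
  "exit_angle e \<theta> p = \<theta> + 2 * arctan
     (angular e \<theta> (chord_normal e p) (e * p / 16) / (chord_normal e p * stretch e \<theta>))"

text \<open>The tangential velocity at the exit divided by \<open>q\<close>. The summand with the factor \<open>16 = e/q\<close> is
  the turning of the normal along the chord; the division by \<open>q\<close> has been carried out, so that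
  \<open>e = 0\<close> is a regular value.\<close>

definition exit_fraction :: "real \<Rightarrow> real \<Rightarrow> real \<Rightarrow> real" where
  "exit_fraction e \<theta> p = (let \<phi> = exit_angle e \<theta> p in
     p * stretch e \<phi> / stretch e \<theta> + 16 * chord_normal e p / sqrt (1 + e) *
       (sin \<theta> * cos \<theta> * stretch e \<phi> / stretch e \<theta> + sin \<phi> * cos \<phi> * stretch e \<theta> / stretch e \<phi>))"

text \<open>The annular flight outwards: polar components at the inner circle, then at the outer circle, where
  the angular component has halved.\<close>

definition out_radial :: "real \<Rightarrow> real \<Rightarrow> real \<Rightarrow> real" where
  "out_radial e \<theta> w = sqrt (1 - w\<^sup>2) * stretch e \<theta>"

definition out_angular :: "real \<Rightarrow> real \<Rightarrow> real \<Rightarrow> real" where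
  "out_angular e \<theta> w = angular e \<theta> (sqrt (1 - w\<^sup>2)) w"

definition hit_radial :: "real \<Rightarrow> real \<Rightarrow> real \<Rightarrow> real" where
  "hit_radial e \<theta> w = sqrt ((out_radial e \<theta> w)\<^sup>2 + (out_angular e \<theta> w)\<^sup>2 - (out_angular e \<theta> w / 2)\<^sup>2)"

definition hit_angle :: "real \<Rightarrow> real \<Rightarrow> real \<Rightarrow> real" where
  "hit_angle e \<theta> w = \<theta> + (arctan (out_angular e \<theta> w / out_radial e \<theta> w)
     - arctan ((out_angular e \<theta> w / 2) / hit_radial e \<theta> w))"

text \<open>After the reflection, and the flight back: the angular component doubles, and the inner circle is
  reached if the radicand of the new radial component is positive.\<close>

definition back_angular :: "real \<Rightarrow> real \<Rightarrow> real \<Rightarrow> real" where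
  "back_angular e \<theta> w = (let \<phi> = hit_angle e \<theta> w in
     out_angular e \<theta> w / 2 - 2 * hit_radial e \<theta> w * e * sin \<phi> * cos \<phi> / (stretch e \<phi>)\<^sup>2)"

definition entry_radicand :: "real \<Rightarrow> real \<Rightarrow> real \<Rightarrow> real" where
  "entry_radicand e \<theta> w = (hit_radial e \<theta> w)\<^sup>2 + (back_angular e \<theta> w)\<^sup>2 - (2 * back_angular e \<theta> w)\<^sup>2"

definition return_angle :: "real \<Rightarrow> real \<Rightarrow> real \<Rightarrow> real" where
  "return_angle e \<theta> w = hit_angle e \<theta> w + (arctan (back_angular e \<theta> w / (- hit_radial e \<theta> w))
     - arctan (2 * back_angular e \<theta> w / (- sqrt (entry_radicand e \<theta> w))))"

definition return_fraction :: "real \<Rightarrow> real \<Rightarrow> real \<Rightarrow> real" where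
  "return_fraction e \<theta> w =
     tangential e (return_angle e \<theta> w) (- sqrt (entry_radicand e \<theta> w)) (2 * back_angular e \<theta> w)"

definition return_formula :: "real \<Rightarrow> real \<times> real \<Rightarrow> real \<times> real" where
  "return_formula e z = (let \<phi> = exit_angle e (fst z) (snd z); w = exit_fraction e (fst z) (snd z)
     in (return_angle e \<phi> w, return_fraction e \<phi> w))"

text \<open>No tangency on the section, no critical transmission, and the reflected ray meets the inner ellipse
  transversally.\<close>

definition in_branch :: "real \<Rightarrow> real \<times> real \<Rightarrow> bool" where
  "in_branch e z \<longleftrightarrow> \<bar>snd z\<bar> < 1 \<and> \<bar>exit_fraction e (fst z) (snd z)\<bar> < 1 \<and>
     0 < entry_radicand e (exit_angle e (fst z) (snd z)) (exit_fraction e (fst z) (snd z))"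

lemma section_point_polar: "section_point (1 + e) (1/2) \<theta> = polar_point e (1/2) \<theta>"
  by (simp add: section_point_def polar_point_def)

lemma section_velocity_polar:
  assumes "0 < e"
  shows "section_velocity (1 + e) (1/2) q (\<theta>, p) =
    q *\<^sub>R polar_velocity e \<theta> (- sqrt (1 - p\<^sup>2) * stretch e \<theta>) (angular e \<theta> (- sqrt (1 - p\<^sup>2)) p)"
  unfolding section_velocity_def Let_def section_point_polar fst_conv snd_conv
    velocity_from_frame[OF assms, of "1/2", symmetric, simplified] by (simp add: add.commute)

lemma norm_velocity_sq:
  assumes "0 < e"
  shows "(norm (polar_velocity e \<theta> (m * stretch e \<theta>) (angular e \<theta> m p)))\<^sup>2 = m\<^sup>2 + p\<^sup>2"
  using velocity_pythagoras[OF assms, of "m * stretch e \<theta>" \<theta> "angular e \<theta> m p"] stretch_pos[OF assms, of \<theta>]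
  by (simp add: tangential_angular[OF assms])

text \<open>Both the velocity at the entry and the turning of the normal contribute a factor \<open>e\<close>, which is
  what makes the quotient by \<open>q\<close> finite.\<close>

lemma exit_tangential:
  fixes p :: real
  assumes e: "0 < e"
  defines "m \<equiv> chord_normal e p"
  shows "tangential e (exit_angle e \<theta> p) (- (m * stretch e \<theta>)) (angular e \<theta> m (e * p / 16))
     = e / 16 * exit_fraction e \<theta> p"
proof -
  let ?\<phi> = "exit_angle e \<theta> p"
  have "0 < sqrt (1 + e)" "0 < stretch e \<theta>" "0 < stretch e ?\<phi>"
    using e by (auto intro: stretch_pos)
  moreover have "(((e * p / 16 * r + m * e * s * c) / N) * Nh - (- (m * N)) * e * sh * ch / Nh) / r
     = e / 16 * (p * Nh / N + 16 * m / r * (s * c * Nh / N + sh * ch * N / Nh))"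
    if "0 < r" "0 < N" "0 < Nh" for r N Nh s c sh ch :: real
    using that by (simp add: field_simps)
  ultimately show ?thesis
    unfolding tangential_def exit_fraction_def Let_def angular_def m_def[symmetric] by blast
qed

text \<open>The flights of the polar description are strung together. After the chord all points and velocities
  are antipodal to those of the formula, so the second alternative in the definition of
  \<open>regular_branch\<close> applies.\<close>

theorem regular_branch_formula:
  assumes e: "0 < e" "e < 1" and z: "in_branch e z"
  shows "regular_branch (1 + e) (1/2) (e/16) z (exit_fraction e (fst z) (snd z)) (return_formula e z)"
proof -
  obtain \<theta> p where zz: "z = (\<theta>, p)" by fastforce
  define q where "q = e / 16"
  define m where "m = chord_normal e p"
  define \<phi> where "\<phi> = exit_angle e \<theta> p"
  define w where "w = exit_fraction e \<theta> p"
  have p: "\<bar>p\<bar> < 1" and w: "\<bar>w\<bar> < 1" and D: "0 < entry_radicand e \<phi> w"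
    using z by (auto simp: in_branch_def zz \<phi>_def w_def)
  have q: "0 < q" "q < 1" using e by (auto simp: q_def)
  have qp: "(q * p)\<^sup>2 < q\<^sup>2" "(q * w)\<^sup>2 < q\<^sup>2" "q\<^sup>2 < 1"
    using q p w by (auto simp: power_mult_distrib abs_square_less_1 power_less_one_iff)
  have mdef: "m = - sqrt (1 - (q * p)\<^sup>2)" by (simp add: m_def chord_normal_def q_def)
  have m: "m < 0" "m\<^sup>2 + (q * p)\<^sup>2 = 1" using qp unfolding mdef by auto
  note N = stretch_pos[OF e(1)]
  define a where "a = m * stretch e \<theta>"
  define J where "J = angular e \<theta> m (q * p)"
  have a: "a < 0" using m N[of \<theta>] by (simp add: a_def mult_neg_pos)
  define R0 where "R0 = polar_point e (1/2) \<theta>"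
  define V0 where "V0 = section_velocity (1 + e) (1/2) q (\<theta>, p)"
  define V1 where "V1 = polar_velocity e \<theta> a J"
  define P1 where "P1 = polar_point e (1/2) \<phi>"
  note half = half_gt_zero[OF zero_less_one]
  have V0: "V0 \<bullet> unit_tangent (1 + e) R0 = q * p"
    "V0 \<bullet> unit_normal (1 + e) R0 = - q * sqrt (1 - p\<^sup>2)"
    unfolding V0_def R0_def section_velocity_polar[OF e(1)] inner_scaleR_left
      velocity_tangent[OF e(1) half] velocity_normal[OF e(1) half] tangential_angular[OF e(1)]
    using N[of \<theta>] by simp_all
  have "sgn (V0 \<bullet> unit_normal (1 + e) R0) = - 1"
  proof -
    have "0 < q * sqrt (1 - p\<^sup>2)" using q p by (simp add: abs_square_less_1)
    thus ?thesis unfolding V0 by simp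
  qed
  hence V1: "transmit (1 + e) 1 R0 V0 = V1"
    unfolding transmit_def Let_def V0(1) unfolding R0_def V1_def a_def J_def
    using velocity_from_frame[OF e(1) half, of "q * p" \<theta> m] by (simp add: mdef)
  have swing: "\<phi> = \<theta> + (arctan (J / a) - arctan (- J / a))"
    by (simp add: \<phi>_def exit_angle_def J_def a_def m_def q_def arctan_minus)
  note chord = chord_flight[OF e(1) a, where J = J and \<theta> = \<theta>, folded swing, folded R0_def V1_def P1_def]
  define W where "W = polar_velocity e \<phi> (- a) J"
  have V1W: "V1 = - W" using chord(2) by (simp add: W_def)
  have tW: "W \<bullet> unit_tangent (1 + e) P1 = q * w"
    unfolding W_def P1_def velocity_tangent[OF e(1) half] a_def J_def m_def \<phi>_def w_def q_def
    using exit_tangential[OF e(1), of \<theta> p] by simp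
  have nW: "W \<bullet> unit_normal (1 + e) P1 > 0"
    unfolding W_def P1_def velocity_normal[OF e(1) half] using a N[of \<phi>] by (simp add: divide_neg_pos)
  have "(norm W)\<^sup>2 = 1"
    using norm_velocity_sq[OF e(1), of \<theta> m "q * p"] m V1W by (simp add: V1_def a_def J_def)
  hence nW2: "(W \<bullet> unit_normal (1 + e) P1)\<^sup>2 = 1 - (q * w)\<^sup>2"
    using velocity_pythagoras[OF e(1), of "- a" \<phi> J] tW
    unfolding W_def P1_def velocity_tangent[OF e(1) half] velocity_normal[OF e(1) half] by simp
  define a1 where "a1 = out_radial e \<phi> w"
  define J1 where "J1 = out_angular e \<phi> w"
  have a1: "0 < a1" using w N[of \<phi>] by (simp add: a1_def out_radial_def abs_square_less_1)
  define U2 where "U2 = polar_velocity e \<phi> a1 J1"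
  have U2: "U2 = w *\<^sub>R unit_tangent (1 + e) P1 + sqrt (1 - w\<^sup>2) *\<^sub>R unit_normal (1 + e) P1"
    unfolding U2_def P1_def velocity_from_frame[OF e(1) half] a1_def J1_def out_radial_def out_angular_def ..
  have sq: "sqrt (q\<^sup>2 - (q * w)\<^sup>2) = q * sqrt (1 - w\<^sup>2)"
  proof -
    have "q\<^sup>2 - (q * w)\<^sup>2 = q\<^sup>2 * (1 - w\<^sup>2)" by (simp add: power_mult_distrib algebra_simps)
    thus ?thesis using q by (simp add: real_sqrt_mult)
  qed
  have V2: "transmit (1 + e) q (- P1) V1 = - (q *\<^sub>R U2)"
    using tW nW unfolding transmit_def Let_def V1W unit_tangent_uminus unit_normal_uminus
    by (simp add: U2 sq scaleR_add_right sgn_if)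
  define a2 where "a2 = hit_radial e \<phi> w"
  define \<psi> where "\<psi> = hit_angle e \<phi> w"
  have "(J1 / 2)\<^sup>2 = J1\<^sup>2 / 4" by (simp add: power_divide)
  hence "0 < a1\<^sup>2 + J1\<^sup>2 - (J1 / 2)\<^sup>2"
    using zero_less_power[OF a1, of 2] zero_le_power2[of J1] by linarith
  hence a2: "0 < a2" "a2\<^sup>2 = a1\<^sup>2 + J1\<^sup>2 - (J1 / 2)\<^sup>2"
    unfolding a2_def hit_radial_def a1_def[symmetric] J1_def[symmetric] by auto
  have \<psi>: "\<psi> = \<phi> + (arctan (J1 / a1) - arctan ((J1 / 2) / a2))"
    by (simp add: \<psi>_def hit_angle_def a1_def J1_def a2_def)
  define P2 where "P2 = polar_point e 1 \<psi>"
  note out = outward_flight[OF e(1) a1 a2, of \<phi>, folded \<psi>, folded P1_def U2_def P2_def]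
  define J3 where "J3 = back_angular e \<phi> w"
  have J3: "J3 = J1 / 2 - 2 * a2 * e * sin \<psi> * cos \<psi> / (stretch e \<psi>)\<^sup>2"
    by (simp add: J3_def back_angular_def Let_def a2_def \<psi>_def J1_def)
  define U3 where "U3 = polar_velocity e \<psi> (- a2) J3"
  have "reflect (1 + e) P2 U2 = U3"
    unfolding P2_def out(2) reflect_polar[OF e(1) zero_less_one] U3_def J3 ..
  hence V3: "reflect (1 + e) (- P2) (- (q *\<^sub>R U2)) = - (q *\<^sub>R U3)"
    unfolding reflect_def unit_normal_uminus
    by (auto simp: scaleR_diff_right mult.left_commute)
  define a4 where "a4 = sqrt (entry_radicand e \<phi> w)"
  have a4: "0 < a4" "a4\<^sup>2 = a2\<^sup>2 + J3\<^sup>2 - (2 * J3)\<^sup>2"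
    using D by (auto simp: a4_def entry_radicand_def a2_def J3_def)
  define \<theta>' where "\<theta>' = return_angle e \<phi> w"
  have \<theta>'_eq: "\<theta>' = \<psi> + (arctan (J3 / (- a2)) - arctan (2 * J3 / (- a4)))"
    by (simp add: \<theta>'_def return_angle_def \<psi>_def J3_def a2_def a4_def)
  define P3 where "P3 = polar_point e (1/2) \<theta>'"
  note inw = inward_flight[OF e(1) a2(1) a4, of \<psi>, folded \<theta>'_eq, folded P2_def U3_def P3_def]
  define p' where "p' = return_fraction e \<phi> w"
  have p'_eq: "p' = tangential e \<theta>' (- a4) (2 * J3)"
    by (simp add: p'_def return_fraction_def \<theta>'_def a4_def J3_def)
  \<comment> \<open>The speed is preserved, so the normal component at the return is determined by \<open>p'\<close>.\<close>
  have nU: "norm U3 = 1"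
  proof -
    have "(norm U2)\<^sup>2 = 1"
      unfolding U2_def a1_def J1_def out_radial_def out_angular_def norm_velocity_sq[OF e(1)]
      using w by (simp add: abs_square_le_1)
    moreover have "tangential e \<psi> (- a2) J3 = tangential e \<psi> a2 (J1 / 2)"
    proof -
      have "(x - 2 * a2 * e * s * c / M\<^sup>2) * M - - a2 * e * s * c / M = x * M - a2 * e * s * c / M"
        if "0 < M" for x s c M :: real
        using that by (simp add: field_simps power2_eq_square)
      thus ?thesis unfolding tangential_def J3 using N[of \<psi>] by presburger
    qed
    hence "(norm U3)\<^sup>2 = (norm U2)\<^sup>2"
      unfolding out(2) U3_def velocity_pythagoras[OF e(1), symmetric] by simp
    ultimately show ?thesis by (metis norm_ge_zero one_power2 power2_eq_imp_eq zero_le_one)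
  qed
  have pyth: "(a4 / stretch e \<theta>')\<^sup>2 + p'\<^sup>2 = 1"
    using velocity_pythagoras[OF e(1), of "- a4" \<theta>' "2 * J3"] nU unfolding inw(2) p'_eq by simp
  have "0 < a4 / stretch e \<theta>'" using a4 N[of \<theta>'] by simp
  hence "0 < (a4 / stretch e \<theta>')\<^sup>2" by (rule zero_less_power)
  hence p'1: "\<bar>p'\<bar> < 1"
    using pyth unfolding abs_square_less_1[symmetric] by linarith
  have a4': "sqrt (1 - p'\<^sup>2) = a4 / stretch e \<theta>'"
    using pyth \<open>0 < a4 / stretch e \<theta>'\<close> by (intro real_sqrt_unique) linarith+
  have V3': "section_velocity (1 + e) (1/2) q (\<theta>', p') = q *\<^sub>R U3"
  proof -
    have 1: "- sqrt (1 - p'\<^sup>2) * stretch e \<theta>' = - a4" unfolding a4' using N[of \<theta>'] by simp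
    have 2: "angular e \<theta>' (- sqrt (1 - p'\<^sup>2)) p' = 2 * J3"
      unfolding a4' unfolding p'_eq angular_def tangential_def
      using N[of \<theta>'] r_pos(1)[OF e(1)] by (simp add: field_simps)
    show ?thesis unfolding section_velocity_polar[OF e(1)] 1 2 inw(2) ..
  qed
  have ret: "return_formula e z = (\<theta>', p')"
    by (simp add: return_formula_def zz \<phi>_def w_def \<theta>'_def p'_def Let_def)
  have f1: "flight (inner_region (1 + e) (1/2)) R0 V1 (- P1)" by (rule chord(1))
  have f2: "flight (annulus (1 + e) (1/2)) (- P1) (- (q *\<^sub>R U2)) (- P2)"
    by (rule flight_uminus[OF flight_scale[OF out(1) q(1)] annulus_uminus])
  have f3: "flight (annulus (1 + e) (1/2)) (- P2) (- (q *\<^sub>R U3)) (- P3)"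
    by (rule flight_uminus[OF flight_scale[OF inw(1) q(1)] annulus_uminus])
  have Psi_neg: "Psi (1 + e) (- R) = Psi (1 + e) R" for R by (simp add: Psi_def)
  have mem: "- P1 \<in> inner_ellipse (1 + e) (1/2)" "- P2 \<in> outer_ellipse (1 + e)"
    "- P3 \<in> inner_ellipse (1 + e) (1/2)"
    by (simp_all add: inner_ellipse_def outer_ellipse_def Psi_neg P1_def P2_def P3_def
        Psi_polar_point[OF e(1)])
  have wq: "w = (- (q *\<^sub>R U2) \<bullet> unit_tangent (1 + e) (- P1)) / q"
    using q frame_orthonormal[OF e(1) half, of \<phi>, folded P1_def]
    by (simp add: unit_tangent_uminus U2 inner_add_left)
  have n1: "V1 \<bullet> unit_normal (1 + e) (- P1) > 0" "(V1 \<bullet> unit_normal (1 + e) (- P1))\<^sup>2 > 1 - q\<^sup>2"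
    using nW nW2 qp by (simp_all add: V1W unit_normal_uminus)
  show ?thesis
    unfolding regular_branch_def ret unfolding zz fst_conv snd_conv q_def[symmetric] w_def[symmetric]
  proof (intro conjI p p'1 exI)
    show "R0 = section_point (1 + e) (1/2) \<theta>" by (simp add: section_point_polar R0_def)
    show "V0 = section_velocity (1 + e) (1/2) q (\<theta>, p)" by (simp add: V0_def)
    show "V1 = transmit (1 + e) 1 R0 V0" by (simp add: V1)
    show "flight (inner_region (1 + e) (1/2)) R0 V1 (- P1)" by (rule f1)
    show "- (q *\<^sub>R U2) = transmit (1 + e) q (- P1) V1" by (simp add: V2)
    show "flight (annulus (1 + e) (1/2)) (- P1) (- (q *\<^sub>R U2)) (- P2)" by (rule f2)
    show "- (q *\<^sub>R U3) = reflect (1 + e) (- P2) (- (q *\<^sub>R U2))" by (simp add: V3)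
    show "flight (annulus (1 + e) (1/2)) (- P2) (- (q *\<^sub>R U3)) (- P3)" by (rule f3)
    show "- P3 = section_point (1 + e) (1/2) \<theta>' \<and> - (q *\<^sub>R U3) = section_velocity (1 + e) (1/2) q (\<theta>', p') \<or>
       - (- P3) = section_point (1 + e) (1/2) \<theta>' \<and> - (- (q *\<^sub>R U3)) = section_velocity (1 + e) (1/2) q (\<theta>', p')"
      by (simp add: section_point_polar P3_def V3')
  qed (fact mem n1 wq)+
qed

lemma flight_unique:
  assumes "flight U R V R'" "R' \<notin> U" "flight U R V R''" "R'' \<notin> U"
  shows "R' = R''"
proof -
  obtain t where t: "t > 0" "R' = R + t *\<^sub>R V" "\<And>s. s \<in> {0<..<t} \<Longrightarrow> R + s *\<^sub>R V \<in> U"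
    using assms(1) unfolding flight_def by blast
  obtain t' where t': "t' > 0" "R'' = R + t' *\<^sub>R V" "\<And>s. s \<in> {0<..<t'} \<Longrightarrow> R + s *\<^sub>R V \<in> U"
    using assms(3) unfolding flight_def by blast
  have "\<not> t < t'" "\<not> t' < t"
    using t t' assms(2,4) by auto
  thus ?thesis using t(2) t'(2) by force
qed

lemma same_point_angle_mod_pi:
  assumes "0 < e" "polar_point e (1/2) \<theta> = c *\<^sub>R polar_point e (1/2) \<theta>'" "c = 1 \<or> c = - 1"
  shows "\<exists>k::int. \<theta> - \<theta>' = of_int k * pi"
proof -
  have "cos \<theta> = c * cos \<theta>'" "sin \<theta> = c * sin \<theta>'"
    using assms r_pos(1)[OF assms(1)] by (auto simp: polar_point_def)
  hence "sin (\<theta> - \<theta>') = 0" by (simp add: sin_diff)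
  thus ?thesis by (auto simp: sin_zero_iff_int2)
qed

lemma same_velocity_fraction:
  assumes e: "0 < e" and R: "polar_point e (1/2) \<theta> = c *\<^sub>R polar_point e (1/2) \<theta>'"
    and V: "section_velocity (1 + e) (1/2) q (\<theta>, p) = c *\<^sub>R section_velocity (1 + e) (1/2) q (\<theta>', p')"
    and c: "c = 1 \<or> c = - 1" and q: "0 < q"
  shows "p = p'"
proof -
  have h: "(0::real) < 1/2" by simp
  have t: "section_velocity (1 + e) (1/2) q (\<theta>, p) \<bullet> unit_tangent (1 + e) (polar_point e (1/2) \<theta>) = q * p" for \<theta> p
    unfolding section_velocity_polar[OF e] inner_scaleR_left velocity_tangent[OF e h] tangential_angular[OF e] ..
  have "unit_tangent (1 + e) (polar_point e (1/2) \<theta>) = c *\<^sub>R unit_tangent (1 + e) (polar_point e (1/2) \<theta>')"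
    unfolding R using c by (auto simp: unit_tangent_uminus)
  hence "q * p = (c * c) * (q * p')"
    using t[of \<theta> p] t[of \<theta>' p'] unfolding V by (auto simp: mult.assoc)
  thus ?thesis using c q by auto
qed

definition trajectory :: "real \<Rightarrow> real \<Rightarrow> real \<times> real \<Rightarrow> plane \<Rightarrow> plane \<Rightarrow> plane \<Rightarrow> plane \<Rightarrow> bool" where
  "trajectory \<nu> q z R1 R2 R3 V3 \<longleftrightarrow> (let R0 = section_point \<nu> (1/2) (fst z);
       V1 = transmit \<nu> 1 R0 (section_velocity \<nu> (1/2) q z); V2 = transmit \<nu> q R1 V1
     in flight (inner_region \<nu> (1/2)) R0 V1 R1 \<and> R1 \<in> inner_ellipse \<nu> (1/2) \<and>
        flight (annulus \<nu> (1/2)) R1 V2 R2 \<and> R2 \<in> outer_ellipse \<nu> \<and> V3 = reflect \<nu> R2 V2 \<and>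
        flight (annulus \<nu> (1/2)) R2 V3 R3 \<and> R3 \<in> inner_ellipse \<nu> (1/2))"

text \<open>Each flight ends at the first point outside its region.\<close>

lemma trajectory_unique:
  assumes "trajectory \<nu> q z R1 R2 R3 V3" "trajectory \<nu> q z S1 S2 S3 W3"
  shows "R3 = S3 \<and> V3 = W3"
proof -
  have in_out: "R \<notin> inner_region \<nu> (1/2)" "R \<notin> annulus \<nu> (1/2)" if "R \<in> inner_ellipse \<nu> (1/2)" for R
    using that by (auto simp: inner_ellipse_def inner_region_def annulus_def)
  have out: "R \<notin> annulus \<nu> (1/2)" if "R \<in> outer_ellipse \<nu>" for R
    using that by (auto simp: outer_ellipse_def annulus_def)
  note A = assms[unfolded trajectory_def Let_def]
  have 1: "R1 = S1" using A flight_unique in_out(1) by meson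
  have 2: "R2 = S2" using A flight_unique out unfolding 1 by meson
  have 3: "V3 = W3" using A unfolding 1 2 by simp
  have "R3 = S3" using A flight_unique in_out(2) unfolding 2 3 by meson
  with 3 show ?thesis by simp
qed

lemma return_rel_trajectory:
  assumes "return_rel \<nu> (1/2) q z z'"
  obtains R1 R2 R3 V3 c where "trajectory \<nu> q z R1 R2 R3 V3" "c = 1 \<or> c = - 1"
    "c *\<^sub>R R3 = section_point \<nu> (1/2) (fst z')" "c *\<^sub>R V3 = section_velocity \<nu> (1/2) q z'"
  using assms unfolding return_rel_def regular_branch_def
  apply (elim conjE exE disjE)
  subgoal for w R0 V0 V1 R1 V2 R2 V3 R3
    by (rule that[of R1 R2 R3 V3 1]) (simp_all add: trajectory_def Let_def)
  subgoal for w R0 V0 V1 R1 V2 R2 V3 R3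
    by (rule that[of R1 R2 R3 V3 "- 1"]) (simp_all add: trajectory_def Let_def)
  done

text \<open>The initial state determines the trajectory. What is left is the choice of representatives: angles modulo \<open>2 * pi\<close>, and the antipode.\<close>

lemma return_unique:
  assumes e: "0 < e" and q: "0 < q" and
    1: "return_rel (1 + e) (1/2) q z z1" and 2: "return_rel (1 + e) (1/2) q z z2"
  shows "snd z1 = snd z2 \<and> (\<exists>k::int. fst z1 - fst z2 = of_int k * pi)"
proof -
  obtain R1 R2 R3 V3 c where A: "trajectory (1 + e) q z R1 R2 R3 V3" "c = 1 \<or> c = - 1"
    "c *\<^sub>R R3 = section_point (1 + e) (1/2) (fst z1)" "c *\<^sub>R V3 = section_velocity (1 + e) (1/2) q z1"
    by (rule return_rel_trajectory[OF 1])
  obtain S1 S2 S3 W3 d where B: "trajectory (1 + e) q z S1 S2 S3 W3" "d = 1 \<or> d = - 1"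
    "d *\<^sub>R S3 = section_point (1 + e) (1/2) (fst z2)" "d *\<^sub>R W3 = section_velocity (1 + e) (1/2) q z2"
    by (rule return_rel_trajectory[OF 2])
  have eq: "S3 = R3" "W3 = V3" using trajectory_unique[OF A(1) B(1)] by auto
  have cd: "c * d = 1 \<or> c * d = - 1" "(c * d) * d = c" using A(2) B(2) by auto
  have R: "polar_point e (1/2) (fst z1) = (c * d) *\<^sub>R polar_point e (1/2) (fst z2)"
    using A(3) B(3) cd(2) unfolding section_point_polar eq by (metis scaleR_scaleR)
  have V: "section_velocity (1 + e) (1/2) q z1 = (c * d) *\<^sub>R section_velocity (1 + e) (1/2) q z2"
    using A(4) B(4) cd(2) unfolding eq by (metis scaleR_scaleR)
  show ?thesis
    using same_point_angle_mod_pi[OF e R cd(1)]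
      same_velocity_fraction[OF e R _ cd(1) q, of "snd z1" "snd z2"] V by simp
qed

section \<open>The limit of vanishing ellipticity\<close>

lemma coefficients_zero [simp]:
  "stretch 0 \<theta> = 1" "angular 0 \<theta> m p = p" "tangential 0 \<theta> a J = J" "chord_normal 0 p = - 1"
  by (simp_all add: stretch_def angular_def tangential_def chord_normal_def)

lemma exit_zero [simp]:
  "exit_angle 0 \<theta> p = \<theta>" "exit_fraction 0 \<theta> p = p - 16 * sin (2 * \<theta>)"
  by (simp_all add: exit_angle_def exit_fraction_def sin_double)

text \<open>The angular advance of the circular annular flight from radius \<open>1/2\<close> to \<open>1\<close> and back, namely
  \<open>2 * (arcsin w - arcsin (w/2))\<close>.\<close>

definition twist :: "real \<Rightarrow> real" where
  "twist w = 2 * (arctan (w / sqrt (1 - w\<^sup>2)) - arctan ((w / 2) / sqrt (1 - (w / 2)\<^sup>2)))"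

text \<open>For \<open>e = 0\<close> the annulus is rotationally symmetric: angular momentum survives the reflection, and
  \<open>w\<close> returns unchanged.\<close>

lemma outer_zero:
  assumes "\<bar>w\<bar> < 1"
  shows "out_radial 0 \<theta> w = sqrt (1 - w\<^sup>2)" "out_angular 0 \<theta> w = w" "hit_radial 0 \<theta> w = sqrt (1 - (w / 2)\<^sup>2)"
    "hit_angle 0 \<theta> w = \<theta> + twist w / 2" "back_angular 0 \<theta> w = w / 2" "entry_radicand 0 \<theta> w = 1 - w\<^sup>2"
    "return_angle 0 \<theta> w = \<theta> + twist w" "return_fraction 0 \<theta> w = w"
proof -
  have w: "0 < 1 - w\<^sup>2" "0 < 1 - (w / 2)\<^sup>2"
    using assms abs_square_less_1[of w] zero_le_power2[of w] by (auto simp: power_divide)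
  show 1: "out_radial 0 \<theta> w = sqrt (1 - w\<^sup>2)" and 2: "out_angular 0 \<theta> w = w"
    by (simp_all add: out_radial_def out_angular_def)
  show 3: "hit_radial 0 \<theta> w = sqrt (1 - (w / 2)\<^sup>2)"
    unfolding hit_radial_def 1 2 using w by simp
  show 4: "hit_angle 0 \<theta> w = \<theta> + twist w / 2"
    unfolding hit_angle_def 1 2 3 twist_def by simp
  show 5: "back_angular 0 \<theta> w = w / 2"
    unfolding back_angular_def Let_def 2 by simp
  show 6: "entry_radicand 0 \<theta> w = 1 - w\<^sup>2"
    unfolding entry_radicand_def 3 5 using w by (simp add: power_divide)
  show 7: "return_angle 0 \<theta> w = \<theta> + twist w"
  proof -
    have "arctan (w / 2 / - sqrt (1 - (w / 2)\<^sup>2)) = - arctan (w / 2 / sqrt (1 - (w / 2)\<^sup>2))"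
      "arctan (2 * (w / 2) / - sqrt (1 - w\<^sup>2)) = - arctan (w / sqrt (1 - w\<^sup>2))"
      by (simp_all add: arctan_minus)
    note flip = this
    have "t + 2 * (A - B) / 2 + (- B - - A) = t + 2 * (A - B)" for t A B :: real
      by (simp add: field_simps)
    thus ?thesis unfolding return_angle_def 3 4 5 6 flip twist_def .
  qed
  show "return_fraction 0 \<theta> w = w"
    unfolding return_fraction_def 5 by simp
qed

lemma C1_at_chord_normal:
  assumes "C1_at f x" "f x = 0" "C1_at h x"
  shows "C1_at (\<lambda>x. chord_normal (f x) (h x)) x"
  unfolding chord_normal_def by (intro C1_intros assms) (simp_all add: assms)

context
  fixes f g h :: "'a::real_normed_vector \<Rightarrow> real" and x :: 'a
  assumes f: "C1_at f x" and g: "C1_at g x" and f0: "f x = 0"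
begin

lemma C1_at_stretch: "C1_at (\<lambda>x. stretch (f x) (g x)) x"
  unfolding stretch_def by (intro C1_intros f g) (simp add: f0)

lemma C1_at_angular:
  assumes "C1_at m x" "C1_at p x"
  shows "C1_at (\<lambda>x. angular (f x) (g x) (m x) (p x)) x"
  unfolding angular_def by (intro C1_intros C1_at_stretch f g assms) (simp_all add: f0)

lemma C1_at_tangential:
  assumes "C1_at m x" "C1_at p x"
  shows "C1_at (\<lambda>x. tangential (f x) (g x) (m x) (p x)) x"
  unfolding tangential_def by (intro C1_intros C1_at_stretch f g assms) (simp_all add: f0)

lemma C1_at_exit_angle:
  assumes "C1_at h x" shows "C1_at (\<lambda>x. exit_angle (f x) (g x) (h x)) x"
  unfolding exit_angle_def
  by (intro C1_intros C1_at_stretch C1_at_angular C1_at_chord_normal f g f0 assms) (simp_all add: f0)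

end

context
  fixes f g h :: "'a::real_normed_vector \<Rightarrow> real" and x :: 'a
  assumes f: "C1_at f x" and g: "C1_at g x" and h: "C1_at h x" and f0: "f x = 0"
begin

lemma C1_at_exit_fraction: "C1_at (\<lambda>x. exit_fraction (f x) (g x) (h x)) x"
  unfolding exit_fraction_def Let_def
  by (intro C1_intros C1_at_stretch C1_at_chord_normal C1_at_exit_angle f g h f0) (simp_all add: f0)

context
  assumes h1: "\<bar>h x\<bar> < 1"
begin

lemma pos_radicands: "0 < 1 - (h x)\<^sup>2" "0 < 1 - (h x / 2)\<^sup>2"
  using h1 abs_square_less_1[of "h x"] zero_le_power2[of "h x"] by (auto simp: power_divide)

lemma C1_at_out_radial: "C1_at (\<lambda>x. out_radial (f x) (g x) (h x)) x"
  unfolding out_radial_def by (intro C1_intros C1_at_stretch f g h f0 pos_radicands)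

lemma C1_at_out_angular: "C1_at (\<lambda>x. out_angular (f x) (g x) (h x)) x"
  unfolding out_angular_def by (intro C1_intros C1_at_angular f g h f0 pos_radicands)

lemma C1_at_hit_radial: "C1_at (\<lambda>x. hit_radial (f x) (g x) (h x)) x"
  unfolding hit_radial_def
  by (intro C1_intros C1_at_out_radial C1_at_out_angular)
    (use pos_radicands in \<open>simp_all add: f0 outer_zero[OF h1]\<close>)

lemma C1_at_hit_angle: "C1_at (\<lambda>x. hit_angle (f x) (g x) (h x)) x"
  unfolding hit_angle_def
  by (intro C1_intros C1_at_out_radial C1_at_out_angular C1_at_hit_radial g)
    (use pos_radicands in \<open>simp_all add: f0 outer_zero[OF h1]\<close>)

lemma C1_at_back_angular: "C1_at (\<lambda>x. back_angular (f x) (g x) (h x)) x"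
  unfolding back_angular_def Let_def
  by (intro C1_intros C1_at_out_angular C1_at_hit_radial C1_at_hit_angle C1_at_stretch f f0) (simp_all add: f0)

lemma C1_at_entry_radicand: "C1_at (\<lambda>x. entry_radicand (f x) (g x) (h x)) x"
  unfolding entry_radicand_def by (intro C1_intros C1_at_back_angular C1_at_hit_radial)

lemma C1_at_return_angle: "C1_at (\<lambda>x. return_angle (f x) (g x) (h x)) x"
  unfolding return_angle_def
  by (intro C1_intros C1_at_back_angular C1_at_hit_radial C1_at_hit_angle C1_at_entry_radicand)
    (use pos_radicands in \<open>simp_all add: f0 outer_zero[OF h1]\<close>)

lemma C1_at_return_fraction: "C1_at (\<lambda>x. return_fraction (f x) (g x) (h x)) x"
  unfolding return_fraction_def
  by (intro C1_intros C1_at_tangential C1_at_back_angular C1_at_return_angle C1_at_entry_radicand f f0)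
    (use pos_radicands in \<open>simp_all add: f0 outer_zero[OF h1]\<close>)

end

end

lemma C1_at_twist [C1_intros]:
  assumes "C1_at h x" "\<bar>h x\<bar> < 1"
  shows "C1_at (\<lambda>x. twist (h x)) x"
proof -
  have "0 < 1 - (h x)\<^sup>2" "0 < 1 - (h x / 2)\<^sup>2"
    using assms(2) abs_square_less_1[of "h x"] zero_le_power2[of "h x"] by (auto simp: power_divide)
  thus ?thesis unfolding twist_def by (intro C1_intros assms) auto
qed

text \<open>The inverse of \<open>twist\<close> is elementary: by symmetry the reflection happens at half the advance, and the
  ray from the point of radius \<open>1/2\<close> to the point of radius \<open>1\<close> at angle \<open>D/2\<close> has
  direction \<open>(cos (D/2) - 1/2, sin (D/2))\<close>.\<close>

definition inv_twist :: "real \<Rightarrow> real" where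
  "inv_twist D = sin (D / 2) / sqrt (5 / 4 - cos (D / 2))"

lemma inv_twist_radicand: "1 / 4 \<le> 5 / 4 - cos (D::real)"
  using cos_le_one[of D] by linarith

lemma C1_at_inv_twist [C1_intros]:
  assumes "C1_at h x"
  shows "C1_at (\<lambda>x. inv_twist (h x)) x"
proof -
  have "0 < 5 / 4 - cos (h x / 2)" using inv_twist_radicand[of "h x / 2"] by linarith
  thus ?thesis unfolding inv_twist_def by (intro C1_intros assms) auto
qed

lemma one_minus_inv_twist_sq:
  "1 - (inv_twist D)\<^sup>2 = (cos (D / 2) - 1 / 2)\<^sup>2 / (5 / 4 - cos (D / 2))"
  "1 - (inv_twist D / 2)\<^sup>2 = (2 - cos (D / 2))\<^sup>2 / (4 * (5 / 4 - cos (D / 2)))"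
proof -
  define c where "c = cos (D / 2)"
  have pos: "0 < 5 / 4 - c" using inv_twist_radicand[of "D / 2"] unfolding c_def by linarith
  have sq: "(inv_twist D)\<^sup>2 = (1 - c\<^sup>2) / (5 / 4 - c)"
    unfolding inv_twist_def power_divide c_def[symmetric] using pos by (simp add: sin_squared_eq c_def)
  show "1 - (inv_twist D)\<^sup>2 = (cos (D / 2) - 1 / 2)\<^sup>2 / (5 / 4 - cos (D / 2))"
    unfolding sq c_def[symmetric] using pos by (simp add: field_simps power2_eq_square)
  show "1 - (inv_twist D / 2)\<^sup>2 = (2 - cos (D / 2))\<^sup>2 / (4 * (5 / 4 - cos (D / 2)))"
    unfolding power_divide sq c_def[symmetric] using pos by (simp add: field_simps power2_eq_square)
qed

lemma cos_gt_half:
  assumes "\<bar>h\<bar> < pi / 3" shows "1 / 2 < cos h"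
proof -
  have "cos (pi / 3) < cos \<bar>h\<bar>" using assms by (intro cos_monotone_0_pi) auto
  thus ?thesis by (simp add: cos_60)
qed

text \<open>With \<open>h = D/2\<close> the claim is that the arguments of \<open>exp (i h) - 1/2\<close> and \<open>2 - exp (- i h)\<close>
  differ by \<open>h\<close>. The difference of both sides has derivative zero in \<open>h\<close> as long as
  \<open>cos h > 1/2\<close>, that is, before the ray becomes tangent to the inner circle.\<close>

lemma twist_inv_twist:
  assumes D: "\<bar>D\<bar> < 2 * pi / 3"
  shows "twist (inv_twist D) = D"
proof -
  define G where "G h = arctan (sin h / (cos h - 1 / 2)) - arctan (sin h / (2 - cos h)) - h" for h :: real
  have c: "1 / 2 < cos h" if "h \<in> {- pi / 3<..<pi / 3}" for h
    using that by (intro cos_gt_half) auto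
  have dG: "(G has_real_derivative 0) (at h)" if h: "h \<in> {- pi / 3<..<pi / 3}" for h
  proof -
    define x where "x = cos h"
    define y where "y = sin h"
    have x: "1 / 2 < x" "x \<le> 1" "y\<^sup>2 = 1 - x\<^sup>2" using c[OF h] by (auto simp: x_def y_def sin_squared_eq)
    have pos: "0 < 5 / 4 - x" using x by linarith
    have d1: "((\<lambda>h. sin h / (cos h - 1 / 2)) has_real_derivative
        (cos h * (cos h - 1 / 2) - sin h * (- sin h)) / ((cos h - 1 / 2) * (cos h - 1 / 2))) (at h)"
      by (rule DERIV_divide) (use c[OF h] in \<open>auto intro!: derivative_eq_intros\<close>)
    have d2: "((\<lambda>h. sin h / (2 - cos h)) has_real_derivative
        (cos h * (2 - cos h) - sin h * sin h) / ((2 - cos h) * (2 - cos h))) (at h)"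
    proof (rule DERIV_divide)
      show "2 - cos h \<noteq> 0" using x(2) unfolding x_def by linarith
    qed (auto intro!: derivative_eq_intros)
    have quot: "inverse (1 + (y / d)\<^sup>2) * (Q / (d * d)) = Q / P" if "d \<noteq> 0" "d\<^sup>2 + y\<^sup>2 = P" for d Q P
    proof -
      have "1 + (y / d)\<^sup>2 = P / (d * d)"
        unfolding that(2)[symmetric] using that(1)
        by (simp add: add_divide_distrib power_divide power2_eq_square)
      thus ?thesis using that(1) by simp
    qed
    have n1: "x * (x - 1 / 2) - y * (- y) = 1 - x / 2" "(x - 1 / 2)\<^sup>2 + y\<^sup>2 = 5 / 4 - x"
      and n2: "x * (2 - x) - y * y = 2 * x - 1" "(2 - x)\<^sup>2 + y\<^sup>2 = 4 * (5 / 4 - x)"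
      using x(3) by (simp_all add: power2_eq_square algebra_simps)
    have "(G has_real_derivative
        inverse (1 + (y / (x - 1 / 2))\<^sup>2) * ((x * (x - 1 / 2) - y * (- y)) / ((x - 1 / 2) * (x - 1 / 2)))
        - inverse (1 + (y / (2 - x))\<^sup>2) * ((x * (2 - x) - y * y) / ((2 - x) * (2 - x))) - 1) (at h)"
      unfolding G_def x_def y_def
      by (intro DERIV_diff DERIV_chain2[OF DERIV_arctan d1] DERIV_chain2[OF DERIV_arctan d2] DERIV_ident)
    moreover have "inverse (1 + (y / (x - 1 / 2))\<^sup>2) * ((x * (x - 1 / 2) - y * (- y)) / ((x - 1 / 2) * (x - 1 / 2)))
        = (1 - x / 2) / (5 / 4 - x)"
      unfolding n1(1) by (rule quot[OF _ n1(2)]) (use x in auto)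
    moreover have "inverse (1 + (y / (2 - x))\<^sup>2) * ((x * (2 - x) - y * y) / ((2 - x) * (2 - x)))
        = (2 * x - 1) / (4 * (5 / 4 - x))"
      unfolding n2(1) by (rule quot[OF _ n2(2)]) (use x in auto)
    moreover have "(1 - x / 2) / (5 / 4 - x) - (2 * x - 1) / (4 * (5 / 4 - x)) - 1 = 0"
    proof -
      have "Q / P - S / (4 * P) - 1 = 0" if "Q = S / 4 + P" "P \<noteq> 0" for P Q S :: real
        using that(2) unfolding that(1) by (simp add: field_simps)
      from this[of "1 - x / 2" "2 * x - 1" "5 / 4 - x"] show ?thesis using pos by argo
    qed
    ultimately show ?thesis by simp
  qed
  have "\<exists>k. \<forall>h\<in>{- pi / 3<..<pi / 3}. G h = k"
  proof (rule has_field_derivative_zero_constant)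
    show "convex {- pi / 3<..<pi / 3}" by simp
    show "\<And>h. h \<in> {- pi / 3<..<pi / 3} \<Longrightarrow> (G has_real_derivative 0) (at h within {- pi / 3<..<pi / 3})"
      using dG has_field_derivative_at_within by blast
  qed
  moreover have "D / 2 \<in> {- pi / 3<..<pi / 3}" "0 \<in> {- pi / 3<..<pi / 3}"
    using D pi_gt_zero by (auto simp: abs_less_iff)
  ultimately have "G (D / 2) = G 0" by metis
  hence G0: "arctan (sin (D / 2) / (cos (D / 2) - 1 / 2)) - arctan (sin (D / 2) / (2 - cos (D / 2))) = D / 2"
    by (simp add: G_def)
  define x where "x = cos (D / 2)"
  have x: "1 / 2 < x" "x \<le> 1" using cos_gt_half[of "D / 2"] D by (auto simp: x_def)
  define R where "R = sqrt (5 / 4 - x)"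
  have R: "0 < R" using x by (simp add: R_def)
  have "sqrt (1 - (inv_twist D)\<^sup>2) = (x - 1 / 2) / R"
    unfolding one_minus_inv_twist_sq x_def[symmetric] R_def using x by (simp add: real_sqrt_divide)
  moreover have "sqrt (1 - (inv_twist D / 2)\<^sup>2) = (2 - x) / (2 * R)"
  proof -
    have "R\<^sup>2 = 5 / 4 - x" using x by (simp add: R_def)
    hence "1 - (inv_twist D / 2)\<^sup>2 = ((2 - x) / (2 * R))\<^sup>2"
      unfolding one_minus_inv_twist_sq x_def[symmetric] by (simp add: power_divide power_mult_distrib)
    thus ?thesis using R x by simp
  qed
  moreover have "inv_twist D = sin (D / 2) / R" by (simp add: inv_twist_def R_def x_def)
  ultimately show ?thesis
    unfolding twist_def using R G0 x by (simp add: x_def[symmetric])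
qed

text \<open>The inequality \<open>(2 - x) * (x - 1/2) \<le> 4 * (5/4 - x) powr (3/2)\<close> for \<open>x = cos (D/2)\<close> between
  \<open>1/2\<close> and \<open>1\<close>, with equality at \<open>x = 1\<close>.\<close>

lemma inv_twist_derivative:
  assumes "\<bar>D\<bar> < 2 * pi / 3"
  obtains k where "(inv_twist has_real_derivative k) (at D)" "\<bar>k\<bar> \<le> 1"
proof -
  define x where "x = cos (D / 2)"
  define y where "y = sin (D / 2)"
  have x: "1 / 2 < x" "x \<le> 1" "y\<^sup>2 = 1 - x\<^sup>2"
    using cos_gt_half[of "D / 2"] assms by (auto simp: x_def y_def sin_squared_eq)
  define R where "R = sqrt (5 / 4 - x)"
  have R: "0 < R" "R\<^sup>2 = 5 / 4 - x" using x by (auto simp: R_def)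
  have R12: "1 / 2 \<le> R" unfolding R_def using x real_le_rsqrt[of "1 / 2" "5 / 4 - x"] by (simp add: power2_eq_square)
  define k where "k = (x / 2 * R - y * (y / 2 / (2 * R))) / R\<^sup>2"
  have "(inv_twist has_real_derivative k) (at D)"
  proof -
    have d1: "((\<lambda>D. sin (D / 2)) has_real_derivative cos (D / 2) / 2) (at D)"
      by (auto intro!: derivative_eq_intros)
    have d2: "((\<lambda>D. 5 / 4 - cos (D / 2)) has_real_derivative sin (D / 2) / 2) (at D)"
      by (auto intro!: derivative_eq_intros)
    have "0 < 5 / 4 - cos (D / 2)" using x(2) unfolding x_def by linarith
    from DERIV_chain2[OF DERIV_real_sqrt[OF this] d2]
    have "((\<lambda>D. sqrt (5 / 4 - cos (D / 2))) has_real_derivative inverse R / 2 * (sin (D / 2) / 2)) (at D)"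
      unfolding R_def x_def .
    also have "inverse R / 2 * (sin (D / 2) / 2) = sin (D / 2) / 2 / (2 * R)"
      by (simp add: field_simps)
    finally have d3: "((\<lambda>D. sqrt (5 / 4 - cos (D / 2))) has_real_derivative (sin (D / 2) / 2 / (2 * R))) (at D)" .
    have "sqrt (5 / 4 - cos (D / 2)) \<noteq> 0" using R(1) unfolding R_def x_def by simp
    from DERIV_divide[OF d1 d3 this]
    have "((\<lambda>D. sin (D / 2) / sqrt (5 / 4 - cos (D / 2))) has_real_derivative
       (cos (D / 2) / 2 * R - sin (D / 2) * (sin (D / 2) / 2 / (2 * R))) / (R * R)) (at D)"
      unfolding R_def[unfolded x_def, symmetric] .
    thus ?thesis unfolding inv_twist_def[abs_def] k_def x_def y_def power2_eq_square .
  qed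
  moreover have k: "k = (2 - x) * (x - 1 / 2) / (4 * (R * R\<^sup>2))"
  proof -
    have "k = (2 * x * R\<^sup>2 - y\<^sup>2) / (4 * (R * R\<^sup>2))"
      unfolding k_def using R(1) by (simp add: field_simps power2_eq_square)
    also have "2 * x * R\<^sup>2 - y\<^sup>2 = (2 - x) * (x - 1 / 2)"
      unfolding R(2) x(3) by (simp add: field_simps power2_eq_square)
    finally show ?thesis .
  qed
  have "\<bar>k\<bar> \<le> 1"
  proof -
    have "0 \<le> (2 - x) * (x - 1 / 2)" using x by (intro mult_nonneg_nonneg) auto
    moreover have "(2 - x) * (x - 1 / 2) \<le> 4 * (R * R\<^sup>2)"
    proof -
      have "(2 - x) * (x - 1 / 2) = 9 / 16 - (5 / 4 - x)\<^sup>2" by (simp add: field_simps power2_eq_square)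
      also have "\<dots> \<le> 2 * (5 / 4 - x)"
        using mult_nonneg_nonneg[of "1 - x" "7 / 2 - x"] x by (simp add: field_simps power2_eq_square)
      also have "\<dots> \<le> 4 * (R * R\<^sup>2)" unfolding R(2)[symmetric]
        using mult_right_mono[OF R12, of "R\<^sup>2"] by simp
      finally show ?thesis .
    qed
    ultimately show ?thesis unfolding k using R(1) by (simp add: field_simps)
  qed
  ultimately show thesis by (rule that)
qed

text \<open>An advance by a little more than \<open>pi/2\<close> still keeps a margin from critical transmission. The bound
  reduces to \<open>cos (D/2) \<ge> 65/100\<close>; at \<open>D = pi/2\<close> this cosine is about \<open>71/100\<close>.\<close>

lemma inv_twist_bound:
  assumes "\<bar>D\<bar> \<le> pi / 2 + 13 / 100"
  shows "\<bar>inv_twist D\<bar> \<le> 985 / 1000"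
proof -
  define x where "x = cos (D / 2)"
  have "cos (pi / 4 + 13 / 200) \<le> cos \<bar>D / 2\<bar>"
    using assms pi_gt3 by (intro cos_monotone_0_pi_le) auto
  moreover have "65 / 100 \<le> cos (pi / 4 + 13 / 200)"
  proof -
    have "cos (13 / 200 :: real) = 1 - 2 * (sin (13 / 400))\<^sup>2"
      using cos_double_sin[of "13 / 400 :: real"] by simp
    moreover have "(sin (13 / 400 :: real))\<^sup>2 \<le> (13 / 400)\<^sup>2"
      using abs_sin_x_le_abs_x[of "13 / 400"] by (intro power2_le_iff_abs_le[THEN iffD2]) auto
    moreover have "sin (13 / 200 :: real) \<le> 13 / 200"
      using sin_x_le_x[of "13 / 200"] by simp
    ultimately have 1: "93 / 100 \<le> cos (13 / 200) - sin (13 / 200 :: real)"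
      by (simp add: power2_eq_square)
    have 2: "7 / 5 \<le> sqrt 2" by (rule real_le_rsqrt) (simp add: power2_eq_square)
    have "65 / 100 \<le> (7 / 5) / 2 * (93 / 100 :: real)" by simp
    also have "\<dots> \<le> sqrt 2 / 2 * (cos (13 / 200) - sin (13 / 200))"
      using 1 2 by (intro mult_mono) auto
    also have "\<dots> = cos (pi / 4 + 13 / 200)"
      by (simp add: cos_add cos_45 sin_45 algebra_simps)
    finally show ?thesis .
  qed
  ultimately have x: "65 / 100 \<le> x" "x \<le> 1" unfolding x_def cos_abs_real by auto
  have "(15 / 1000)\<^sup>2 + (1 - 970225 / 1000000) * (5 / 4 - x) \<le> (x - 1 / 2)\<^sup>2 + (15 / 1000 :: real)\<^sup>2"
  proof -
    have "0 \<le> (x - 65 / 100) * (x + 65 / 100 - 970225 / 1000000)"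
      using x by (intro mult_nonneg_nonneg) auto
    thus ?thesis by (simp add: field_simps power2_eq_square)
  qed
  hence "1 - 970225 / 1000000 \<le> (x - 1 / 2)\<^sup>2 / (5 / 4 - x)"
    using x by (simp add: pos_le_divide_eq)
  hence "(inv_twist D)\<^sup>2 \<le> 970225 / 1000000"
    using one_minus_inv_twist_sq(1)[of D] unfolding x_def[symmetric] by linarith
  also have "\<dots> = (985 / 1000)\<^sup>2" by (simp add: power2_eq_square)
  finally have "(inv_twist D)\<^sup>2 \<le> (985 / 1000)\<^sup>2" .
  thus ?thesis using power2_le_iff_abs_le[of "985 / 1000" "inv_twist D"] by simp
qed

section \<open>The axis orbits are saddles\<close>

lemma isCont_eventually_abs_less:
  fixes f :: "'a::t2_space \<Rightarrow> real"
  assumes "isCont f x" "\<bar>f x\<bar> < c"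
  shows "\<forall>\<^sub>F z in nhds x. \<bar>f z\<bar> < c"
proof -
  have "(f \<longlongrightarrow> f x) (nhds x)"
    using assms(1) unfolding isCont_def tendsto_at_iff_tendsto_nhds .
  from tendsto_rabs[OF this] assms(2) show ?thesis by (rule order_tendstoD(2))
qed

text \<open>The characteristic polynomial has opposite signs at \<open>1\<close> and \<open>-1\<close>, so it has one root between them, and
  one outside by its growth. Eigenvectors are written down directly, using \<open>\<beta> \<noteq> 0\<close>. The
  hypothesis is stable under perturbation of the matrix.\<close>

lemma hyperbolic_saddle_if_large_trace:
  fixes f :: "real \<times> real \<Rightarrow> real \<times> real"
  assumes P: "f P = P" and D: "(f has_derivative D) (at P)"
    and cols: "D (1, 0) = (\<alpha>, \<gamma>)" "D (0, 1) = (\<beta>, \<delta>)" and \<beta>: "\<beta> \<noteq> 0"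
    and tr: "\<bar>1 + (\<alpha> * \<delta> - \<beta> * \<gamma>)\<bar> < \<bar>\<alpha> + \<delta>\<bar>"
  shows "hyperbolic_saddle f P"
proof -
  define \<tau> where "\<tau> = \<alpha> + \<delta>"
  define \<Delta> where "\<Delta> = \<alpha> * \<delta> - \<beta> * \<gamma>"
  define \<xi> where "\<xi> x = x\<^sup>2 - \<tau> * x + \<Delta>" for x
  have cont: "continuous_on S \<xi>" for S unfolding \<xi>_def by (intro continuous_intros)
  have lin: "linear D" using D has_derivative_linear by blast
  have eig: "\<exists>u. u \<noteq> 0 \<and> D u = x *\<^sub>R u" if "\<xi> x = 0" for x
  proof (intro exI conjI)
    show "(\<beta>, x - \<alpha>) \<noteq> 0" using \<beta> by (simp add: zero_prod_def)
    have "(\<beta>, x - \<alpha>) = \<beta> *\<^sub>R (1, 0) + (x - \<alpha>) *\<^sub>R (0, 1)" by simp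
    hence "D (\<beta>, x - \<alpha>) = \<beta> *\<^sub>R (\<alpha>, \<gamma>) + (x - \<alpha>) *\<^sub>R (\<beta>, \<delta>)"
      using cols by (metis linear_add[OF lin] linear_cmul[OF lin])
    also have "\<dots> = x *\<^sub>R (\<beta>, x - \<alpha>)"
      using that by (simp add: \<xi>_def \<tau>_def \<Delta>_def algebra_simps power2_eq_square)
    finally show "D (\<beta>, x - \<alpha>) = x *\<^sub>R (\<beta>, x - \<alpha>)" .
  qed
  define M where "M = 2 + \<bar>\<tau>\<bar> + \<bar>\<Delta>\<bar>"
  have big: "\<xi> M > 0" "\<xi> (- M) > 0"
  proof -
    have "\<bar>\<tau>\<bar> * M + \<bar>\<Delta>\<bar> < M * M"
    proof -
      have "M * M = \<bar>\<tau>\<bar> * M + (2 + \<bar>\<Delta>\<bar>) * M" by (simp add: M_def algebra_simps)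
      moreover have "(2 + \<bar>\<Delta>\<bar>) * 2 \<le> (2 + \<bar>\<Delta>\<bar>) * M" by (intro mult_left_mono) (auto simp: M_def)
      ultimately show ?thesis by (simp add: algebra_simps)
    qed
    moreover have "\<tau> * M \<le> \<bar>\<tau>\<bar> * M" "- \<tau> * M \<le> \<bar>\<tau>\<bar> * M"
      by (intro mult_right_mono; simp add: M_def)+
    ultimately show "\<xi> M > 0" "\<xi> (- M) > 0" unfolding \<xi>_def power2_eq_square by (auto simp: abs_le_iff)
  qed
  have M: "M > 1" by (simp add: M_def)
  have tr': "\<bar>1 + \<Delta>\<bar> < \<bar>\<tau>\<bar>" using tr by (simp add: \<tau>_def \<Delta>_def)
  have "\<exists>a b. \<xi> a = 0 \<and> \<bar>a\<bar> < 1 \<and> \<xi> b = 0 \<and> \<bar>b\<bar> > 1"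
  proof (cases "\<tau> > 0")
    case True
    have s: "\<xi> 1 < 0" "\<xi> (- 1) > 0" using True tr' by (auto simp: \<xi>_def)
    obtain a where a: "- 1 \<le> a" "a \<le> 1" "\<xi> a = 0"
      using IVT2'[of \<xi> 1 0 "- 1"] s cont by force
    obtain b where b: "1 \<le> b" "b \<le> M" "\<xi> b = 0"
      using IVT'[of \<xi> 1 0 M] s big M cont by force
    have "a \<noteq> 1" "a \<noteq> - 1" "b \<noteq> 1" using a b s by auto
    thus ?thesis using a b by (intro exI[of _ a] exI[of _ b]) auto
  next
    case False
    have s: "\<xi> 1 > 0" "\<xi> (- 1) < 0" using False tr' by (auto simp: \<xi>_def)
    obtain a where a: "- 1 \<le> a" "a \<le> 1" "\<xi> a = 0"
      using IVT'[of \<xi> "- 1" 0 1] s cont by force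
    obtain b where b: "- M \<le> b" "b \<le> - 1" "\<xi> b = 0"
      using IVT2'[of \<xi> "- 1" 0 "- M"] s big M cont by force
    have "a \<noteq> 1" "a \<noteq> - 1" "b \<noteq> - 1" using a b s by auto
    thus ?thesis using a b by (intro exI[of _ a] exI[of _ b]) auto
  qed
  then obtain a b where ab: "\<xi> a = 0" "\<bar>a\<bar> < 1" "\<xi> b = 0" "\<bar>b\<bar> > 1" by blast
  obtain u v where "u \<noteq> 0" "D u = a *\<^sub>R u" "v \<noteq> 0" "D v = b *\<^sub>R v"
    using eig[OF ab(1)] eig[OF ab(3)] by blast
  thus ?thesis unfolding hyperbolic_saddle_def using P D ab by blast
qed

text \<open>On the axes the normals point along the axis for every \<open>e\<close>, so the axis orbits are fixed points of the
  exact formula.\<close>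

lemma return_formula_fixed:
  assumes "sin s * cos s = 0"
  shows "exit_angle e s 0 = s" "exit_fraction e s 0 = 0" "return_formula e (s, 0) = (s, 0)"
    "return_angle e s 0 = s" "return_fraction e s 0 = 0"
proof -
  have a: "angular e s m 0 = 0" for m using assms by (simp add: angular_def mult.assoc)
  have t: "tangential e s m 0 = 0" for m using assms by (simp add: tangential_def mult.assoc)
  show 1: "exit_angle e s 0 = s" by (simp add: exit_angle_def a)
  have sc: "sin s * cos s * x = 0" for x using assms by simp
  show 2: "exit_fraction e s 0 = 0" unfolding exit_fraction_def Let_def 1 by (simp add: sc)
  have 3: "out_angular e s 0 = 0" by (simp add: out_angular_def a)
  have 4: "hit_angle e s 0 = s" by (simp add: hit_angle_def 3)
  have 5: "back_angular e s 0 = 0" using assms by (simp add: back_angular_def 3 4 Let_def mult.assoc)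
  show 6: "return_angle e s 0 = s" by (simp add: return_angle_def 4 5)
  show 7: "return_fraction e s 0 = 0" by (simp add: return_fraction_def 5 6 t)
  show "return_formula e (s, 0) = (s, 0)"
    by (simp add: return_formula_def Let_def 1 2 6 7)
qed

text \<open>For \<open>e = 0\<close> the radicand of the return is \<open>1 - w\<^sup>2\<close>; the bounds leave room for the perturbation.
  The number \<open>3\<close> is any bound beyond \<open>pi/2\<close>.\<close>

lemma eventually_in_branch:
  "\<forall>\<^sub>F e in at_right 0. \<forall>\<theta> p. \<bar>\<theta>\<bar> \<le> 3 \<and> \<bar>p\<bar> \<le> 995 / 1000 \<and> \<bar>exit_fraction e \<theta> p\<bar> \<le> 99 / 100 \<longrightarrow> in_branch e (\<theta>, p)"
proof -
  let ?K = "{- 3..3} \<times> {- (995 / 1000)..995 / 1000} \<times> {- (99 / 100)..99 / 100 :: real} :: (real \<times> real \<times> real) set"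
  let ?G = "\<lambda>X :: real \<times> real \<times> real \<times> real.
     entry_radicand (fst X) (exit_angle (fst X) (fst (snd X)) (fst (snd (snd X)))) (snd (snd (snd X)))"
  have K: "compact ?K" by (intro compact_Times compact_Icc)
  have G: "C1_at ?G (0, x)" if "x \<in> ?K" for x
    using that by (intro C1_at_entry_radicand C1_at_exit_angle C1_intros) auto
  have "\<forall>\<^sub>F e in at_right 0. slices_close ?G ?K (1 / 100) e"
    by (rule slices_uniformly_C1_close[OF K G]) simp_all
  thus ?thesis
  proof eventually_elim
    case (elim e)
    note elim = elim[unfolded slices_close_def]
    show ?case
    proof (intro allI impI)
      fix \<theta> p assume A: "\<bar>\<theta>\<bar> \<le> 3 \<and> \<bar>p\<bar> \<le> 995 / 1000 \<and> \<bar>exit_fraction e \<theta> p\<bar> \<le> 99 / 100"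
      define w where "w = exit_fraction e \<theta> p"
      have w: "\<bar>w\<bar> \<le> 99 / 100" using A by (simp add: w_def)
      have "(\<theta>, p, w) \<in> ?K" using A by (auto simp: w_def abs_le_iff)
      hence "\<bar>entry_radicand e (exit_angle e \<theta> p) w - (1 - w\<^sup>2)\<bar> < 1 / 100"
        using elim w by (force simp: outer_zero(6))
      moreover have "w\<^sup>2 \<le> (99 / 100)\<^sup>2" using w power2_le_iff_abs_le[of "99 / 100" w] by simp
      hence "w\<^sup>2 \<le> 9801 / 10000" by (simp add: power2_eq_square)
      ultimately have "0 < entry_radicand e (exit_angle e \<theta> p) w" by linarith
      thus "in_branch e (\<theta>, p)" using A by (auto simp: in_branch_def w_def)
    qed
  qed
qed

lemma eventually_exit_fraction_continuous:
  "\<forall>\<^sub>F e in at_right 0. \<forall>x \<in> {- 3..3} \<times> {- (995 / 1000)..995 / 1000}.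
     C1_at (\<lambda>X. exit_fraction (fst X) (fst (snd X)) (snd (snd X))) (e, x)"
proof -
  let ?K = "{- 3..3} \<times> {- (995 / 1000)..995 / 1000} :: (real \<times> real) set"
  let ?G = "\<lambda>X :: real \<times> real \<times> real. exit_fraction (fst X) (fst (snd X)) (snd (snd X))"
  have K: "compact ?K" by (intro compact_Times compact_Icc)
  have G: "C1_at ?G (0, x)" if "x \<in> ?K" for x
    by (intro C1_at_exit_fraction C1_intros) auto
  have "\<forall>\<^sub>F e in at_right 0. slices_close ?G ?K (1) e"
    by (rule slices_uniformly_C1_close[OF K G]) simp_all
  thus ?thesis unfolding slices_close_def by eventually_elim blast
qed

lemma return_rel_formula:
  assumes "0 < e" "e < 1" "in_branch e z"
  shows "return_rel (1 + e) (1/2) (e/16) z (return_formula e z)"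
  unfolding return_rel_def using regular_branch_formula[OF assms] by blast

text \<open>Both representatives lie in a half-open window of length \<open>pi\<close> around the initial angle and differ by a
  multiple of \<open>pi\<close>.\<close>

lemma return_map_formula:
  assumes e: "0 < e" "e < 1" and z: "in_branch e z"
    and close: "\<bar>fst (return_formula e z) - fst z\<bar> < pi / 2"
  shows "return_map (1 + e) (1/2) (e/16) z = return_formula e z"
  unfolding return_map_def
proof (rule the_equality)
  show "return_rel (1 + e) (1/2) (e/16) z (return_formula e z) \<and>
      fst (return_formula e z) - fst z \<in> {- pi / 2<..pi / 2}"
  proof
    have "- pi / 2 < fst (return_formula e z) - fst z" "fst (return_formula e z) - fst z \<le> pi / 2"
      using close by linarith+
    thus "fst (return_formula e z) - fst z \<in> {- pi / 2<..pi / 2}" by simp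
  qed (rule return_rel_formula[OF e z])
next
  fix z' assume z': "return_rel (1 + e) (1/2) (e/16) z z' \<and> fst z' - fst z \<in> {- pi / 2<..pi / 2}"
  have q: "0 < e / 16" using e by simp
  obtain k :: int where k: "snd z' = snd (return_formula e z)" "fst z' - fst (return_formula e z) = of_int k * pi"
    using return_unique[OF e(1) q conjunct1[OF z'] return_rel_formula[OF e z]] by blast
  have "- pi / 2 < fst z' - fst z" "fst z' - fst z \<le> pi / 2" using z' by simp_all
  hence "\<bar>of_int k * pi\<bar> < 1 * pi" using close k(2) by linarith
  hence "\<bar>of_int k :: real\<bar> < 1" unfolding abs_mult by simp
  hence "k = 0" by linarith
  thus "z' = return_formula e z" using k by (simp add: prod_eq_iff)
qed

lemma twist_derivative_zero: "(twist has_real_derivative 1) (at 0)"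
  unfolding twist_def by (auto intro!: derivative_eq_intros)

lemma C1_at_return_formula:
  assumes "\<bar>snd x - 16 * sin (2 * fst x)\<bar> < 1"
  shows "C1_at (\<lambda>X. return_formula (fst X) (snd X)) (0, x)"
  unfolding return_formula_def Let_def using assms
  by (intro C1_at_return_angle C1_at_return_fraction C1_at_exit_angle C1_at_exit_fraction C1_intros) simp_all

lemma return_formula_zero:
  assumes "\<bar>snd x - 16 * sin (2 * fst x)\<bar> < 1"
  shows "return_formula 0 x = (fst x + twist (snd x - 16 * sin (2 * fst x)), snd x - 16 * sin (2 * fst x))"
  using assms by (simp add: return_formula_def Let_def outer_zero)

lemma return_formula_derivative_zero:
  assumes s: "sin (2 * s) = 0" and c: "cos (2 * s) = \<kappa>"
  shows "slice_derivative (\<lambda>X. return_formula (fst X) (snd X)) 0 (s, 0) v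
     = (fst v + (snd v - 32 * \<kappa> * fst v), snd v - 32 * \<kappa> * fst v)"
proof -
  let ?F = "\<lambda>X :: real \<times> real \<times> real. return_formula (fst X) (snd X)"
  let ?g = "\<lambda>x :: real \<times> real. (fst x + twist (snd x - 16 * sin (2 * fst x)), snd x - 16 * sin (2 * fst x))"
  let ?L = "\<lambda>v :: real \<times> real. (fst v + (snd v - 32 * \<kappa> * fst v), snd v - 32 * \<kappa> * fst v)"
  have w: "((\<lambda>x :: real \<times> real. snd x - 16 * sin (2 * fst x)) has_derivative (\<lambda>v. snd v - 32 * \<kappa> * fst v)) (at (s, 0))"
    by (auto intro!: derivative_eq_intros simp: c)
  have t: "((\<lambda>x :: real \<times> real. twist (snd x - 16 * sin (2 * fst x))) has_derivative
      (\<lambda>v. snd v - 32 * \<kappa> * fst v)) (at (s, 0))"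
    using has_derivative_compose[OF w, of twist "(*) 1"] twist_derivative_zero s
    by (simp add: has_field_derivative_def)
  have g: "(?g has_derivative ?L) (at (s, 0))"
    by (intro has_derivative_Pair has_derivative_add t w has_derivative_fst has_derivative_ident)
  have "isCont (\<lambda>x :: real \<times> real. \<bar>snd x - 16 * sin (2 * fst x)\<bar>) (s, 0)" by (intro continuous_intros)
  hence "\<forall>\<^sub>F x in at (s, 0). \<bar>snd x - 16 * sin (2 * fst x)\<bar> < (1::real)"
    unfolding isCont_def by (rule order_tendstoD(2)) (simp add: s)
  hence "\<forall>\<^sub>F x in at (s, 0). ?g x = ?F (0, x)"
    by eventually_elim (simp add: return_formula_zero)
  from has_derivative_transform_eventually[OF g this]
  have lim: "((\<lambda>x. ?F (0, x)) has_derivative ?L) (at (s, 0))"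
    using s by (simp add: return_formula_zero)
  have "((\<lambda>x. ?F (0, x)) has_derivative slice_derivative ?F 0 (s, 0)) (at (s, 0))"
    by (rule has_derivative_slice, rule C1_at_return_formula) (simp add: s)
  from has_derivative_unique[OF this lim] show ?thesis by simp
qed

text \<open>At \<open>e = 0\<close> the matrix has the columns \<open>(1 - 32 \<kappa>, - 32 \<kappa>)\<close> and \<open>(1, 1)\<close>, where \<open>\<kappa> = 1\<close> on the long and
  \<open>\<kappa> = -1\<close> on the short axis. Its determinant is \<open>1\<close> and its trace \<open>2 - 32 \<kappa>\<close>, far from the
  interval where the eigenvalues could be on the unit circle.\<close>

lemma eventually_saddle:
  assumes s: "sin s * cos s = 0" and c: "cos (2 * s) = \<kappa>" and \<kappa>: "\<bar>\<kappa>\<bar> = 1" and s2: "\<bar>s\<bar> < 3"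
  shows "\<forall>\<^sub>F e in at_right 0. saddle_of_return_map (1 + e) (1/2) (e/16) (s, 0)"
proof -
  let ?F = "\<lambda>X :: real \<times> real \<times> real. return_formula (fst X) (snd X)"
  let ?P = "(s, 0) :: real \<times> real"
  let ?L0 = "slice_derivative ?F 0 ?P"
  have s': "sin (2 * s) = 0" using s by (simp add: sin_double)
  have "C1_at ?F (0, x)" if "x \<in> {?P}" for x
    using that s' by (intro C1_at_return_formula) simp
  hence "\<forall>\<^sub>F e in at_right 0. slices_close ?F {?P} (1 / 100) e"
    by (intro slices_uniformly_C1_close) auto
  moreover have "\<forall>\<^sub>F e in at_right 0. e \<in> {0<..<1::real}"
    by (rule eventually_at_right_real) simp
  ultimately show ?thesis
    using eventually_in_branch eventually_exit_fraction_continuous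
  proof eventually_elim
    case (elim e)
    note elim = elim[unfolded slices_close_def]
    have e: "0 < e" "e < 1" using elim by auto
    have C1: "C1_at ?F (e, ?P)" and near: "norm (slice_derivative ?F e ?P - ?L0) < 1 / 100"
      using elim by auto
    note fixed = return_formula_fixed[OF s]
    have contF: "isCont (return_formula e) ?P"
      using has_derivative_continuous[OF has_derivative_slice[OF C1]] by simp
    have "C1_at (\<lambda>X. exit_fraction (fst X) (fst (snd X)) (snd (snd X))) (e, ?P)"
      using elim s2 by (auto simp: abs_less_iff)
    from has_derivative_continuous[OF has_derivative_slice[OF this]]
    have contW: "isCont (\<lambda>z. exit_fraction e (fst z) (snd z)) ?P" by simp
    have good: "\<forall>\<^sub>F z in nhds ?P. in_branch e z \<and> \<bar>fst (return_formula e z) - fst z\<bar> < pi / 2"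
    proof -
      have "\<forall>\<^sub>F z in nhds ?P. \<bar>exit_fraction e (fst z) (snd z)\<bar> < 99 / 100"
        by (rule isCont_eventually_abs_less[OF contW]) (simp add: fixed)
      moreover have "\<forall>\<^sub>F z in nhds ?P. \<bar>fst z\<bar> < (3::real)"
        by (rule isCont_eventually_abs_less) (simp_all add: s2)
      moreover have "\<forall>\<^sub>F z in nhds ?P. \<bar>snd z\<bar> < (995 / 1000::real)"
        by (rule isCont_eventually_abs_less) simp_all
      moreover have "\<forall>\<^sub>F z in nhds ?P. \<bar>fst (return_formula e z) - fst z\<bar> < pi / 2"
        by (rule isCont_eventually_abs_less) (intro continuous_intros contF, simp add: fixed)
      ultimately show ?thesis
      proof eventually_elim
        case (elim z)
        thus ?case using \<open>\<forall>\<theta> p. \<bar>\<theta>\<bar> \<le> 3 \<and> \<bar>p\<bar> \<le> 995 / 1000 \<and> \<bar>exit_fraction e \<theta> p\<bar> \<le> 99 / 100 \<longrightarrow> in_branch e (\<theta>, p)\<close>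
          by (cases z) auto
      qed
    qed
    have dom: "?P \<in> interior (regular_domain (1 + e) (1/2) (e/16))"
    proof -
      have "\<forall>\<^sub>F z in nhds ?P. z \<in> regular_domain (1 + e) (1/2) (e/16)"
        using good
      proof eventually_elim
        case (elim z)
        show ?case unfolding regular_domain_def using return_rel_formula[OF e conjunct1[OF elim]] by blast
      qed
      thus ?thesis unfolding eventually_nhds interior_def by blast
    qed
    have "\<forall>\<^sub>F z in nhds ?P. return_map (1 + e) (1/2) (e/16) z = return_formula e z"
      using good by eventually_elim (use return_map_formula[OF e] in blast)
    hence eqP: "return_map (1 + e) (1/2) (e/16) ?P = return_formula e ?P"
      and eq: "\<forall>\<^sub>F z in at ?P. return_formula e z = return_map (1 + e) (1/2) (e/16) z"
      by (auto simp: eventually_nhds_conv_at elim: eventually_mono)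
    let ?D = "slice_derivative ?F e ?P"
    have "(return_formula e has_derivative ?D) (at ?P)"
      using has_derivative_slice[OF C1] by simp
    from has_derivative_transform_eventually[OF this eq]
    have der: "(return_map (1 + e) (1/2) (e/16) has_derivative ?D) (at ?P)"
      using eqP by simp
    obtain \<alpha> \<gamma> \<beta> \<delta> where cols: "?D (1, 0) = (\<alpha>, \<gamma>)" "?D (0, 1) = (\<beta>, \<delta>)" by fastforce
    have bound: "norm (?D v - ?L0 v) \<le> 1 / 100 * norm v" for v
    proof -
      have "norm (?D v - ?L0 v) \<le> norm (?D - ?L0) * norm v"
        using norm_blinfun[of "?D - ?L0" v] by (simp add: blinfun.diff_left)
      also have "\<dots> \<le> 1 / 100 * norm v" using near by (intro mult_right_mono) auto
      finally show ?thesis .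
    qed
    note L0 = return_formula_derivative_zero[OF s' c]
    have "norm ((\<alpha>, \<gamma>) - (1 - 32 * \<kappa>, - 32 * \<kappa>)) \<le> 1 / 100"
      using bound[of "(1, 0)"] unfolding cols L0 by (simp add: norm_Pair)
    hence 1: "\<bar>\<alpha> - (1 - 32 * \<kappa>)\<bar> \<le> 1 / 100" "\<bar>\<gamma> - (- 32 * \<kappa>)\<bar> \<le> 1 / 100"
      using norm_fst_le[of "\<alpha> - (1 - 32 * \<kappa>)" "\<gamma> - (- 32 * \<kappa>)"] norm_snd_le[of "\<gamma> - (- 32 * \<kappa>)" "\<alpha> - (1 - 32 * \<kappa>)"]
      by auto
    have "norm ((\<beta>, \<delta>) - (1, 1)) \<le> 1 / 100"
      using bound[of "(0, 1)"] unfolding cols L0 by (simp add: norm_Pair)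
    hence 2: "\<bar>\<beta> - 1\<bar> \<le> 1 / 100" "\<bar>\<delta> - 1\<bar> \<le> 1 / 100"
      using norm_fst_le[of "\<beta> - 1" "\<delta> - 1"] norm_snd_le[of "\<delta> - 1" "\<beta> - 1"] by auto
    have "\<bar>\<alpha> * (\<delta> - 1)\<bar> \<le> 34 * (1 / 100)" "\<bar>\<gamma> * (\<beta> - 1)\<bar> \<le> 34 * (1 / 100)"
      unfolding abs_mult using 1 2 \<kappa> by (intro mult_mono; auto simp: abs_le_iff abs_if split: if_splits)+
    moreover have "\<alpha> * \<delta> - \<beta> * \<gamma> = (\<alpha> * (\<delta> - 1) - \<gamma> * (\<beta> - 1)) + (\<alpha> - \<gamma>)"
      by (simp add: algebra_simps)
    ultimately have "\<bar>1 + (\<alpha> * \<delta> - \<beta> * \<gamma>)\<bar> \<le> 3"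
      using 1 by linarith
    moreover have "3 < \<bar>\<alpha> + \<delta>\<bar>" using 1 2 \<kappa> by (auto simp: abs_if split: if_splits)
    ultimately have tr: "\<bar>1 + (\<alpha> * \<delta> - \<beta> * \<gamma>)\<bar> < \<bar>\<alpha> + \<delta>\<bar>" by linarith
    have "\<beta> \<noteq> 0" using 2 by auto
    from hyperbolic_saddle_if_large_trace[OF _ der cols this tr]
    show ?case unfolding saddle_of_return_map_def using dom eqP fixed by simp
  qed
qed

section \<open>Returns as a contracting chain\<close>

type_synonym state = "real \<times> real \<times> real"

text \<open>A state collects the angle \<open>\<theta>\<^sub>n\<close>, the exit fraction \<open>w\<^sub>n\<close> and the tangential fraction \<open>p\<^sub>n\<^sub>+\<^sub>1\<close> at the next
  entry. The weights \<open>1/4\<close> and \<open>1/8\<close> balance the partial derivatives: the equations determine \<open>\<theta>\<close> from the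
  fractions with small factor \<open>1/32\<close>, but \<open>w\<close> from the angles and \<open>p\<close> from \<open>w\<close> with factor \<open>1\<close>.\<close>

definition angle_of :: "state \<Rightarrow> real" where "angle_of u = fst u"
definition exit_of :: "state \<Rightarrow> real" where "exit_of u = 4 * fst (snd u)"
definition next_fraction_of :: "state \<Rightarrow> real" where "next_fraction_of u = 8 * snd (snd u)"

text \<open>The advance that \<open>w\<close> should have produced: the actual advance \<open>twist w\<close> of the circular model,
  corrected by the error in the next angle. At \<open>e = 0\<close> it is \<open>\<theta>\<^sub>n\<^sub>+\<^sub>1 - \<theta>\<^sub>n\<close>.\<close>

definition angle_mismatch :: "real \<times> state \<times> state \<times> state \<Rightarrow> real" where
  "angle_mismatch X = (let e = fst X; x = fst (snd X); y = fst (snd (snd X)); z = snd (snd (snd X))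
     in angle_of z - return_angle e (exit_angle e (angle_of y) (next_fraction_of x)) (exit_of y) + twist (exit_of y))"

text \<open>The right hand side of the chain. A fixed point has exit fraction \<open>w\<close>, return angle equal to the next
  angle, and return fraction equal to the next fraction. The first component is a Newton step for
  \<open>exit_fraction e \<theta> p = w\<close> with the slope \<open>\<mp> 32\<close> of the limit at \<open>\<theta> = 0\<close> and \<open>\<theta> = pi/2\<close>; the sign is
  \<open>\<sigma>\<close>.\<close>

definition step_map :: "real \<Rightarrow> real \<times> state \<times> state \<times> state \<Rightarrow> state" where
  "step_map \<sigma> X = (let e = fst X; x = fst (snd X); y = fst (snd (snd X));
       \<theta> = angle_of y; w = exit_of y; p = next_fraction_of x
     in (\<theta> + \<sigma> * (exit_fraction e \<theta> p - w) / 32,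
         inv_twist (angle_mismatch X) / 4,
         return_fraction e (exit_angle e \<theta> p) w / 8))"

text \<open>Angles within \<open>65/1000\<close> of \<open>s\<close>, since \<open>\<bar>p - w\<bar> / 32 < 2/32 = 62.5/1000\<close> bounds them in the limit; fractions
  bounded away from \<open>1\<close>.\<close>

definition state_box :: "real \<Rightarrow> state set" where
  "state_box s = {s - 65 / 1000..s + 65 / 1000} \<times> {- (99 / 400)..99 / 400} \<times> {- (995 / 8000)..995 / 8000}"

lemma state_box_iff:
  "u \<in> state_box s \<longleftrightarrow> \<bar>angle_of u - s\<bar> \<le> 65 / 1000 \<and> \<bar>exit_of u\<bar> \<le> 99 / 100 \<and> \<bar>next_fraction_of u\<bar> \<le> 995 / 1000"
  unfolding abs_diff_le_iff abs_le_iff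
  by (cases u) (auto simp: state_box_def angle_of_def exit_of_def next_fraction_of_def)

lemma compact_state_box: "compact (state_box s)" and convex_state_box: "convex (state_box s)"
  unfolding state_box_def by (intro compact_Times compact_Icc convex_Times convex_real_interval)+

lemma bounded_linear_coordinates:
  "bounded_linear angle_of" "bounded_linear exit_of" "bounded_linear next_fraction_of"
  unfolding angle_of_def exit_of_def next_fraction_of_def
  by (intro bounded_linear_intros)+

lemma coordinates_le_norm:
  "\<bar>angle_of u\<bar> \<le> norm u" "\<bar>exit_of u\<bar> \<le> 4 * norm u" "\<bar>next_fraction_of u\<bar> \<le> 8 * norm u"
proof -
  have "norm (fst u) \<le> norm u" "norm (snd u) \<le> norm u" by (metis norm_fst_le norm_snd_le prod.collapse)+
  moreover have "norm (fst (snd u)) \<le> norm (snd u)" "norm (snd (snd u)) \<le> norm (snd u)"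
    by (metis norm_fst_le norm_snd_le prod.collapse)+
  ultimately have "norm (fst u) \<le> norm u" "norm (fst (snd u)) \<le> norm u" "norm (snd (snd u)) \<le> norm u"
    by linarith+
  thus "\<bar>angle_of u\<bar> \<le> norm u" "\<bar>exit_of u\<bar> \<le> 4 * norm u" "\<bar>next_fraction_of u\<bar> \<le> 8 * norm u"
    by (simp_all add: angle_of_def exit_of_def next_fraction_of_def abs_mult)
qed

lemma coordinates_diff:
  "angle_of (u - v) = angle_of u - angle_of v" "exit_of (u - v) = exit_of u - exit_of v"
  "next_fraction_of (u - v) = next_fraction_of u - next_fraction_of v"
  by (simp_all add: angle_of_def exit_of_def next_fraction_of_def)

lemma C1_at_coordinates [C1_intros]:
  "C1_at f x \<Longrightarrow> C1_at (\<lambda>x. angle_of (f x)) x" "C1_at f x \<Longrightarrow> C1_at (\<lambda>x. exit_of (f x)) x"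
  "C1_at f x \<Longrightarrow> C1_at (\<lambda>x. next_fraction_of (f x)) x"
  by (rule C1_at_compose[OF _ C1_at_bounded_linear]; simp add: bounded_linear_coordinates)+

lemma C1_at_angle_mismatch:
  assumes "\<bar>exit_of (fst (snd X))\<bar> < 1"
  shows "C1_at angle_mismatch (0, X)"
proof -
  have "C1_at (\<lambda>X. angle_mismatch X) (0, X)"
    unfolding angle_mismatch_def Let_def using assms
    by (intro C1_at_return_angle C1_at_exit_angle C1_intros) simp_all
  thus ?thesis by simp
qed

lemma C1_at_step_map:
  assumes "\<bar>exit_of (fst (snd X))\<bar> < 1"
  shows "C1_at (step_map \<sigma>) (0, X)"
proof -
  have "C1_at (\<lambda>X. step_map \<sigma> X) (0, X)"
    unfolding step_map_def Let_def using assms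
    by (intro C1_at_return_fraction C1_at_exit_angle C1_at_exit_fraction C1_at_angle_mismatch C1_intros) simp_all
  thus ?thesis by simp
qed

lemma angle_mismatch_zero:
  assumes "\<bar>exit_of y\<bar> < 1"
  shows "angle_mismatch (0, x, y, z) = angle_of z - angle_of y"
  unfolding angle_mismatch_def Let_def using assms by (simp add: outer_zero)

lemma step_map_zero:
  assumes "\<bar>exit_of y\<bar> < 1"
  shows "step_map \<sigma> (0, x, y, z) =
    (angle_of y + \<sigma> * (next_fraction_of x - 16 * sin (2 * angle_of y) - exit_of y) / 32,
     inv_twist (angle_of z - angle_of y) / 4, exit_of y / 8)"
  unfolding step_map_def Let_def using assms by (simp add: outer_zero angle_mismatch_zero)

lemma norm_triple:
  fixes a b c :: real
  shows "norm (a, b, c) = sqrt (a\<^sup>2 + (b\<^sup>2 + c\<^sup>2))"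
  by (simp add: norm_Pair)

text \<open>Admissible pairs of a reference angle and the sign of the Newton slope there.\<close>

definition symbol :: "real \<Rightarrow> real \<Rightarrow> bool" where
  "symbol s \<sigma> \<longleftrightarrow> (s = 0 \<and> \<sigma> = 1) \<or> (s = pi / 2 \<and> \<sigma> = - 1)"

lemma symbol_sin:
  assumes "symbol s \<sigma>"
  shows "\<sigma> * sin (2 * (s + a)) = sin (2 * a)" "\<sigma> * cos (2 * (s + a)) = cos (2 * a)" "\<bar>\<sigma>\<bar> = 1" "\<sigma> * \<sigma> = 1"
proof -
  have e: "2 * (pi / 2 + a) = 2 * a + pi" by (simp add: field_simps)
  have "sin (2 * (pi / 2 + a)) = - sin (2 * a)" "cos (2 * (pi / 2 + a)) = - cos (2 * a)"
    unfolding e by simp_all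
  thus "\<sigma> * sin (2 * (s + a)) = sin (2 * a)" "\<sigma> * cos (2 * (s + a)) = cos (2 * a)" "\<bar>\<sigma>\<bar> = 1" "\<sigma> * \<sigma> = 1"
    using assms unfolding symbol_def by (elim disjE conjE; simp only:; simp)+
qed

text \<open>The residual of the Newton step at distance \<open>a\<close> from the reference angle and its derivative; both are
  of higher order in \<open>a\<close>.\<close>

lemma small_angle_defect:
  fixes a :: real
  assumes "\<bar>a\<bar> \<le> 65 / 1000"
  shows "0 \<le> 1 - cos (2 * a)" "1 - cos (2 * a) \<le> 9 / 1000" "\<bar>a - sin (2 * a) / 2\<bar> \<le> 6 / 10000"
proof -
  have b: "0 \<le> 1 - cos (2 * t)" "1 - cos (2 * t) \<le> 9 / 1000" if "\<bar>t\<bar> \<le> 65 / 1000" for t :: real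
  proof -
    have "1 - cos (2 * t) = 2 * (sin t)\<^sup>2" by (simp add: cos_double_sin)
    moreover have "(sin t)\<^sup>2 \<le> (65 / 1000)\<^sup>2"
      using abs_sin_x_le_abs_x[of t] that power2_le_iff_abs_le[of "65 / 1000" "sin t"] by simp
    ultimately show "0 \<le> 1 - cos (2 * t)" "1 - cos (2 * t) \<le> 9 / 1000" by (simp_all add: power2_eq_square)
  qed
  show "0 \<le> 1 - cos (2 * a)" "1 - cos (2 * a) \<le> 9 / 1000" using b[OF assms] .
  have "norm ((a - sin (2 * a) / 2) - (0 - sin (2 * 0) / 2)) \<le> 9 / 1000 * norm (a - 0)"
  proof (rule differentiable_bound[where f = "\<lambda>a. a - sin (2 * a) / 2" and S = "{- (65 / 1000)..65 / 1000}"
        and f' = "\<lambda>t. (*) (1 - cos (2 * t))"])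
    show "((\<lambda>a. a - sin (2 * a) / 2) has_derivative (*) (1 - cos (2 * t))) (at t within {- (65 / 1000)..65 / 1000})" for t :: real
      by (auto intro!: derivative_eq_intros simp: algebra_simps)
    show "onorm ((*) (1 - cos (2 * t))) \<le> 9 / 1000" if "t \<in> {- (65 / 1000)..65 / 1000}" for t :: real
    proof (rule onorm_le)
      fix x :: real
      have "\<bar>t\<bar> \<le> 65 / 1000" using that by (auto simp: abs_le_iff)
      from b[OF this] have "\<bar>1 - cos (2 * t)\<bar> \<le> 9 / 1000" by simp
      thus "norm ((1 - cos (2 * t)) * x) \<le> 9 / 1000 * norm x"
        unfolding real_norm_def abs_mult by (intro mult_right_mono) auto
    qed
  qed (use assms in \<open>auto simp: abs_le_iff\<close>)
  thus "\<bar>a - sin (2 * a) / 2\<bar> \<le> 6 / 10000" using assms by simp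
qed

definition transition :: "real \<Rightarrow> real \<Rightarrow> real \<Rightarrow> (state \<times> state \<times> state) set" where
  "transition s0 s1 s2 = state_box s0 \<times> state_box s1 \<times> state_box s2"

text \<open>The derivative of \<open>step_map\<close> at \<open>e = 0\<close>, where \<open>c\<close> is the cosine of twice the distance from the reference angle and \<open>k\<close> the derivative of \<open>inv_twist\<close>.\<close>

definition limit_step_derivative :: "real \<Rightarrow> real \<Rightarrow> real \<Rightarrow> state \<times> state \<times> state \<Rightarrow> state" where
  "limit_step_derivative c k \<sigma> v = (angle_of (fst (snd v)) * (1 - c)
      + \<sigma> * (next_fraction_of (fst v) - exit_of (fst (snd v))) / 32,
     k * (angle_of (snd (snd v)) - angle_of (fst (snd v))) / 4, exit_of (fst (snd v)) / 8)"

text \<open>With the chosen weights the components are at most \<open>9/1000 + 8/32 + 4/32\<close>, \<open>2/4\<close> and \<open>4/8\<close>, and the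
  Euclidean norm of these three numbers is below \<open>81/100\<close>.\<close>

lemma limit_step_derivative_contracts:
  assumes c: "0 \<le> 1 - c" "1 - c \<le> 9 / 1000" and k: "\<bar>k\<bar> \<le> 1" and \<sigma>: "\<bar>\<sigma>\<bar> = 1"
  shows "norm (limit_step_derivative c k \<sigma> v) \<le> 81 / 100 * norm3 v"
proof -
  obtain x y z where v: "v = (x, y, z)" by (cases v) auto
  define r where "r = norm3 v"
  have r: "0 \<le> r" "norm x \<le> r" "norm y \<le> r" "norm z \<le> r"
    unfolding r_def by (rule norm3_nonneg) (simp_all add: norm3_def v)
  have co: "\<bar>angle_of u\<bar> \<le> r" "\<bar>exit_of u\<bar> \<le> 4 * r" "\<bar>next_fraction_of u\<bar> \<le> 8 * r"
    if "norm u \<le> r" for u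
    using coordinates_le_norm[of u] that by linarith+
  note cx = co[OF r(2)] and cy = co[OF r(3)] and cz = co[OF r(4)]
  have 1: "\<bar>angle_of y * (1 - c) + \<sigma> * (next_fraction_of x - exit_of y) / 32\<bar> \<le> 384 / 1000 * r"
  proof -
    have "\<bar>angle_of y * (1 - c)\<bar> \<le> r * (9 / 1000)"
      unfolding abs_mult using cy c r by (intro mult_mono) auto
    moreover have "\<bar>\<sigma> * (next_fraction_of x - exit_of y) / 32\<bar> \<le> 12 * r / 32"
      using cx cy \<sigma> by (simp add: abs_mult)
    ultimately show ?thesis by linarith
  qed
  have 2: "\<bar>k * (angle_of z - angle_of y) / 4\<bar> \<le> 1 / 2 * r"
  proof -
    have "\<bar>k * (angle_of z - angle_of y)\<bar> \<le> 1 * (2 * r)"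
      unfolding abs_mult using cz cy k by (intro mult_mono) auto
    thus ?thesis by simp
  qed
  have 3: "\<bar>exit_of y / 8\<bar> \<le> 1 / 2 * r" using cy by simp
  have "norm (limit_step_derivative c k \<sigma> v) \<le> sqrt ((384 / 1000 * r)\<^sup>2 + ((1 / 2 * r)\<^sup>2 + (1 / 2 * r)\<^sup>2))"
    unfolding limit_step_derivative_def v fst_conv snd_conv norm_triple
    by (intro real_sqrt_le_mono add_mono)
      (use 1 2 3 r in \<open>auto intro!: power2_le_iff_abs_le[THEN iffD2]\<close>)
  also have "\<dots> \<le> sqrt ((81 / 100 * r)\<^sup>2)"
    using r by (intro real_sqrt_le_mono) (simp add: power2_eq_square)
  also have "\<dots> = 81 / 100 * r" using r by simp
  finally show ?thesis by (simp add: r_def)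
qed

lemma step_map_slice_derivative_zero:
  assumes s: "symbol s \<sigma>" and y: "y \<in> state_box s" and z: "\<bar>angle_of z - angle_of y\<bar> \<le> pi / 2 + 13 / 100"
  shows "norm (slice_derivative (step_map \<sigma>) 0 (x, y, z) v) \<le> 81 / 100 * norm3 v"
proof -
  have w: "\<bar>exit_of y\<bar> < 1" and a: "\<bar>angle_of y - s\<bar> \<le> 65 / 1000" using y by (auto simp: state_box_iff)
  have "\<bar>angle_of z - angle_of y\<bar> < 2 * pi / 3" using z pi_gt3 by linarith
  then obtain k where k: "(inv_twist has_real_derivative k) (at (angle_of z - angle_of y))" "\<bar>k\<bar> \<le> 1"
    using inv_twist_derivative by blast
  let ?X = "(x, y, z)"
  let ?g = "\<lambda>X. (angle_of (fst (snd X)) + \<sigma> * (next_fraction_of (fst X) - 16 * sin (2 * angle_of (fst (snd X))) - exit_of (fst (snd X))) / 32,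
     inv_twist (angle_of (snd (snd X)) - angle_of (fst (snd X))) / 4, exit_of (fst (snd X)) / 8)"
  define c where "c = \<sigma> * cos (2 * angle_of y)"
  have c: "c = cos (2 * (angle_of y - s))" using symbol_sin(2)[OF s, of "angle_of y - s"] by (simp add: c_def)
  note D = bounded_linear_coordinates[THEN bounded_linear.has_derivative]
  have tw: "((\<lambda>X :: state \<times> state \<times> state. inv_twist (angle_of (snd (snd X)) - angle_of (fst (snd X)))) has_derivative
      (\<lambda>v. k * (angle_of (snd (snd v)) - angle_of (fst (snd v))))) (at ?X)"
    by (rule has_derivative_compose[of "\<lambda>X :: state \<times> state \<times> state. angle_of (snd (snd X)) - angle_of (fst (snd X))" _ _ _ inv_twist "(*) k"])
      (use k(1) in \<open>auto intro!: derivative_eq_intros D simp: has_field_derivative_def\<close>)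
  have first: "((\<lambda>X :: state \<times> state \<times> state. angle_of (fst (snd X)) + \<sigma> * (next_fraction_of (fst X) - 16 * sin (2 * angle_of (fst (snd X))) - exit_of (fst (snd X))) / 32)
     has_derivative (\<lambda>v. angle_of (fst (snd v)) * (1 - c) + \<sigma> * (next_fraction_of (fst v) - exit_of (fst (snd v))) / 32)) (at ?X)"
    by (auto intro!: derivative_eq_intros D simp: c_def field_simps)
  have third: "((\<lambda>X :: state \<times> state \<times> state. exit_of (fst (snd X)) / 8) has_derivative (\<lambda>v. exit_of (fst (snd v)) / 8)) (at ?X)"
    by (auto intro!: derivative_eq_intros D)
  have g: "(?g has_derivative limit_step_derivative c k \<sigma>) (at ?X)"
    unfolding limit_step_derivative_def[abs_def]
    by (intro has_derivative_Pair first third) (use tw in \<open>auto intro!: derivative_eq_intros\<close>)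
  have "isCont (\<lambda>X :: state \<times> state \<times> state. \<bar>exit_of (fst (snd X))\<bar>) ?X"
    by (intro continuous_intros bounded_linear.isCont[OF bounded_linear_coordinates(2)])
  hence "\<forall>\<^sub>F X in at ?X. \<bar>exit_of (fst (snd X))\<bar> < 1"
    unfolding isCont_def by (rule order_tendstoD(2)) (simp add: w)
  hence ev: "\<forall>\<^sub>F X in at ?X. ?g X = step_map \<sigma> (0, X)"
    by eventually_elim (auto simp: step_map_zero)
  have lim: "((\<lambda>X. step_map \<sigma> (0, X)) has_derivative limit_step_derivative c k \<sigma>) (at ?X)"
    by (rule has_derivative_transform_eventually[OF g ev]) (simp_all add: step_map_zero w)
  have "((\<lambda>X. step_map \<sigma> (0, X)) has_derivative slice_derivative (step_map \<sigma>) 0 ?X) (at ?X)"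
    by (rule has_derivative_slice, rule C1_at_step_map) (simp add: w)
  from has_derivative_unique[OF this lim] show ?thesis
    using limit_step_derivative_contracts[of c k \<sigma> v] small_angle_defect(1,2)[OF a] k(2) symbol_sin(3)[OF s]
    by (simp add: c)
qed

section \<open>Heteroclinic solutions for small ellipticity\<close>

lemma norm_le_norm3: "norm (X :: state \<times> state \<times> state) \<le> 3 * norm3 X"
proof -
  obtain x y z where X: "X = (x, y, z)" by (cases X) auto
  have "norm X \<le> norm x + (norm y + norm z)"
    unfolding X by (meson add_left_mono norm_Pair_le order_trans)
  thus ?thesis by (simp add: X norm3_def)
qed

definition symbols :: "real set" where "symbols = {0, pi / 2}"

definition sign_of :: "real \<Rightarrow> real" where "sign_of s = (if s = 0 then 1 else - 1)"

lemma symbol_bounds: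
  assumes "s \<in> symbols"
  shows "0 \<le> s" "s \<le> 2" "sin s * cos s = 0"
proof -
  consider "s = 0" | "s = pi / 2" using assms unfolding symbols_def by blast
  hence "0 \<le> s \<and> s \<le> 2 \<and> sin s * cos s = 0"
  proof cases
    case 2
    show ?thesis unfolding 2 using pi_less_4 by simp
  qed simp
  thus "0 \<le> s" "s \<le> 2" "sin s * cos s = 0" by auto
qed

lemma symbol_sign_of: "s \<in> symbols \<Longrightarrow> symbol s (sign_of s)"
  by (auto simp: symbols_def sign_of_def symbol_def)

text \<open>What the limit step satisfies with room to spare on the product of boxes. The bounds on angle and next fraction are
  slightly smaller than those of \<open>state_box\<close>; the difference is the room in which boundary data can
  be moved.\<close>

definition good_step :: "real \<Rightarrow> real \<Rightarrow> state \<times> state \<times> state \<Rightarrow> bool" where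
  "good_step e s X \<longleftrightarrow> C1_at (step_map (sign_of s)) (e, X) \<and>
     \<bar>angle_of (step_map (sign_of s) (e, X)) - s\<bar> \<le> 64 / 1000 \<and>
     \<bar>exit_of (step_map (sign_of s) (e, X))\<bar> \<le> 99 / 100 \<and>
     \<bar>next_fraction_of (step_map (sign_of s) (e, X))\<bar> \<le> 9945 / 10000 \<and>
     (\<forall>v. norm (slice_derivative (step_map (sign_of s)) e X v) \<le> 9 / 10 * norm3 v) \<and>
     \<bar>angle_mismatch (e, X)\<bar> < 2 * pi / 3"

lemma transition_close:
  assumes "s0 \<in> symbols" "s1 \<in> symbols" "s2 \<in> symbols" "(x, y, z) \<in> transition s0 s1 s2"
  shows "\<bar>angle_of z - angle_of y\<bar> \<le> pi / 2 + 13 / 100" "\<bar>exit_of y\<bar> \<le> 99 / 100"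
    "\<bar>next_fraction_of x\<bar> \<le> 995 / 1000" "\<bar>angle_of y - s1\<bar> \<le> 65 / 1000"
proof -
  have b: "x \<in> state_box s0" "y \<in> state_box s1" "z \<in> state_box s2" using assms(4) by (auto simp: transition_def)
  have "\<bar>s2 - s1\<bar> \<le> pi / 2" using assms(2,3) by (auto simp: symbols_def abs_if)
  thus "\<bar>angle_of z - angle_of y\<bar> \<le> pi / 2 + 13 / 100"
  proof -
    have "\<bar>angle_of y - s1\<bar> \<le> 65 / 1000" "\<bar>angle_of z - s2\<bar> \<le> 65 / 1000"
      using b(2,3) by (auto simp: state_box_iff)
    with \<open>\<bar>s2 - s1\<bar> \<le> pi / 2\<close> show ?thesis by linarith
  qed
  show "\<bar>exit_of y\<bar> \<le> 99 / 100" "\<bar>next_fraction_of x\<bar> \<le> 995 / 1000" "\<bar>angle_of y - s1\<bar> \<le> 65 / 1000"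
    using b by (auto simp: state_box_iff)
qed

text \<open>The jump between different reference angles is covered by \<open>inv_twist_bound\<close>, whose argument is at most
  \<open>pi/2\<close> plus twice the radius of the boxes.\<close>

lemma limit_step_bounds:
  assumes s: "s0 \<in> symbols" "s1 \<in> symbols" "s2 \<in> symbols" and X: "(x, y, z) \<in> transition s0 s1 s2"
  defines "u \<equiv> step_map (sign_of s1) (0, x, y, z)"
  shows "\<bar>angle_of u - s1\<bar> \<le> 63 / 1000" "\<bar>exit_of u\<bar> \<le> 985 / 1000" "\<bar>next_fraction_of u\<bar> \<le> 99 / 100"
proof -
  note t = transition_close[OF s X]
  have w: "\<bar>exit_of y\<bar> < 1" using t(2) by linarith
  define a where "a = angle_of y - s1"
  let ?\<sigma> = "sign_of s1"
  have "?\<sigma> * sin (2 * angle_of y) = sin (2 * a)"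
    using symbol_sin(1)[OF symbol_sign_of[OF s(2)], of a] by (simp add: a_def)
  hence "angle_of u - s1 = (a - sin (2 * a) / 2) + ?\<sigma> * (next_fraction_of x - exit_of y) / 32"
    unfolding u_def step_map_zero[OF w] by (simp add: angle_of_def a_def algebra_simps diff_divide_distrib add_divide_distrib)
  moreover have "\<bar>a - sin (2 * a) / 2\<bar> \<le> 6 / 10000"
    using t(4) unfolding a_def by (rule small_angle_defect)
  moreover have "\<bar>?\<sigma> * (next_fraction_of x - exit_of y)\<bar> \<le> 1985 / 1000"
  proof -
    have "\<bar>next_fraction_of x - exit_of y\<bar> \<le> 1985 / 1000" using t(2,3) by linarith
    thus ?thesis by (simp add: abs_mult symbol_sin(3)[OF symbol_sign_of[OF s(2)]])
  qed
  ultimately show "\<bar>angle_of u - s1\<bar> \<le> 63 / 1000" by linarith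
  show "\<bar>exit_of u\<bar> \<le> 985 / 1000"
    unfolding u_def step_map_zero[OF w] using inv_twist_bound[OF t(1)] by (simp add: exit_of_def)
  show "\<bar>next_fraction_of u\<bar> \<le> 99 / 100"
    unfolding u_def step_map_zero[OF w] using t(2) by (simp add: next_fraction_of_def)
qed

lemma eventually_good_step:
  assumes s: "s0 \<in> symbols" "s1 \<in> symbols" "s2 \<in> symbols"
  shows "\<forall>\<^sub>F e in at_right 0. \<forall>X\<in>transition s0 s1 s2. good_step e s1 X"
proof -
  let ?K = "transition s0 s1 s2" and ?\<sigma> = "sign_of s1"
  have K: "compact ?K" unfolding transition_def by (intro compact_Times compact_state_box)
  have w: "\<bar>exit_of (fst (snd X))\<bar> < 1" if "X \<in> ?K" for X
  proof -
    obtain x y z where X: "X = (x, y, z)" by (cases X) auto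
    show ?thesis using transition_close(2)[OF s, of x y z] that by (simp add: X)
  qed
  have "\<forall>\<^sub>F e in at_right 0. slices_close (step_map ?\<sigma>) ?K (1 / 2000) e"
    by (rule slices_uniformly_C1_close[OF K C1_at_step_map[OF w]]) simp_all
  moreover have "\<forall>\<^sub>F e in at_right 0. slices_close angle_mismatch ?K (1 / 10) e"
    by (rule slices_uniformly_C1_close[OF K C1_at_angle_mismatch[OF w]]) simp_all
  ultimately show ?thesis
  proof eventually_elim
    case (elim e)
    note elim = elim[unfolded slices_close_def]
    show ?case
    proof
      fix X assume XK: "X \<in> ?K"
      then obtain x y z where X: "X = (x, y, z)" and xyz: "(x, y, z) \<in> ?K" by (cases X) auto
      note t = transition_close[OF s xyz] and b = limit_step_bounds[OF s xyz]
      define u where "u = step_map ?\<sigma> (e, X)"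
      define u0 where "u0 = step_map ?\<sigma> (0, X)"
      have close: "norm (u - u0) < 1 / 2000" using elim XK by (auto simp: u_def u0_def)
      have "\<bar>angle_of u - s1\<bar> \<le> 64 / 1000" "\<bar>exit_of u\<bar> \<le> 99 / 100" "\<bar>next_fraction_of u\<bar> \<le> 9945 / 10000"
        using coordinates_le_norm[of "u - u0"] close b unfolding coordinates_diff u0_def[symmetric] X[symmetric]
        by linarith+
      moreover have "norm (slice_derivative (step_map ?\<sigma>) e X v) \<le> 9 / 10 * norm3 v" for v
      proof -
        let ?D = "slice_derivative (step_map ?\<sigma>) e X" and ?E = "slice_derivative (step_map ?\<sigma>) 0 X"
        have "norm (?D v) \<le> norm (?E v) + norm ((?D - ?E) v)"
          using norm_triangle_ineq[of "?E v" "(?D - ?E) v"] by (simp add: blinfun.diff_left)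
        moreover have "norm (?E v) \<le> 81 / 100 * norm3 v"
          unfolding X by (rule step_map_slice_derivative_zero[OF symbol_sign_of[OF s(2)] _ t(1)])
            (use xyz in \<open>simp add: transition_def\<close>)
        moreover have "norm ((?D - ?E) v) \<le> 1 / 2000 * (3 * norm3 v)"
        proof -
          have "norm ((?D - ?E) v) \<le> norm (?D - ?E) * norm v" by (rule norm_blinfun)
          also have "\<dots> \<le> 1 / 2000 * (3 * norm3 v)"
            using elim XK norm_le_norm3[of v] by (intro mult_mono) (auto simp: less_imp_le)
          finally show ?thesis .
        qed
        ultimately show ?thesis using norm3_nonneg[of v] by linarith
      qed
      moreover have "\<bar>angle_mismatch (e, X)\<bar> < 2 * pi / 3"
      proof -
        have "\<bar>angle_mismatch (e, X) - angle_mismatch (0, X)\<bar> < 1 / 10" using elim XK by auto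
        moreover have "angle_mismatch (0, X) = angle_of z - angle_of y"
          unfolding X by (rule angle_mismatch_zero) (use t(2) in linarith)
        ultimately show ?thesis using t(1) pi_gt3 by linarith
      qed
      ultimately show "good_step e s1 X" unfolding good_step_def u_def using elim XK by blast
    qed
  qed
qed

definition step_modulus :: "real \<Rightarrow> real \<Rightarrow> real \<times> real \<times> real \<Rightarrow> real \<Rightarrow> bool" where
  "step_modulus e \<eta> c \<delta> \<longleftrightarrow> (case c of (s0, s1, s2) \<Rightarrow> let F = step_map (sign_of s1); D = slice_derivative F e in
     \<forall>X\<in>transition s0 s1 s2. \<forall>Y\<in>transition s0 s1 s2. norm3 (Y - X) < \<delta> \<longrightarrow>
       norm (F (e, Y) - F (e, X) - D X (Y - X)) \<le> \<eta> * norm3 (Y - X) \<and>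
       (\<forall>v. norm (D Y v - D X v) \<le> \<eta> * norm3 v))"

lemma good_step_uniformly_C1:
  assumes good: "\<And>X. X \<in> transition s0 s1 s2 \<Longrightarrow> good_step e s1 X" and \<eta>: "0 < \<eta>"
  shows "\<exists>\<delta>>0. step_modulus e \<eta> (s0, s1, s2) \<delta>"
proof -
  let ?K = "transition s0 s1 s2" and ?F = "step_map (sign_of s1)"
  let ?D = "slice_derivative ?F e"
  have K: "compact ?K" "convex ?K"
    unfolding transition_def by (intro compact_Times compact_state_box convex_Times convex_state_box)+
  have C1: "C1_at ?F (e, X)" if "X \<in> ?K" for X using good[OF that] by (simp add: good_step_def)
  have "0 < \<eta> / 3" using \<eta> by simp
  from uniformly_C1_on_compact[OF K has_derivative_slice[OF C1] continuous_on_slice_derivative[OF C1] this]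
  obtain \<delta> where \<delta>: "\<delta> > 0" and U: "\<And>X Y. X \<in> ?K \<Longrightarrow> Y \<in> ?K \<Longrightarrow> norm (Y - X) < \<delta> \<Longrightarrow>
     norm (?F (e, Y) - ?F (e, X) - ?D X (Y - X)) \<le> \<eta> / 3 * norm (Y - X) \<and> norm (?D Y - ?D X) \<le> \<eta> / 3"
    by blast
  show ?thesis
    unfolding step_modulus_def prod.case Let_def
  proof (intro exI[of _ "\<delta> / 3"] conjI ballI impI allI)
    show "0 < \<delta> / 3" using \<delta> by simp
    fix X Y assume XY: "X \<in> ?K" "Y \<in> ?K" "norm3 (Y - X) < \<delta> / 3"
    have n: "norm (Y - X) < \<delta>" using norm_le_norm3[of "Y - X"] XY(3) by linarith
    note U = U[OF XY(1,2) n]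
    have "\<eta> / 3 * norm (Y - X) \<le> \<eta> / 3 * (3 * norm3 (Y - X))"
      using \<eta> by (intro mult_left_mono norm_le_norm3) auto
    thus "norm (?F (e, Y) - ?F (e, X) - ?D X (Y - X)) \<le> \<eta> * norm3 (Y - X)" using U by linarith
    fix v
    have "norm (?D Y v - ?D X v) \<le> norm (?D Y - ?D X) * norm v"
      using norm_blinfun[of "?D Y - ?D X" v] by (simp add: blinfun.diff_left)
    also have "\<dots> \<le> \<eta> / 3 * (3 * norm3 v)"
      using U \<eta> by (intro mult_mono norm_le_norm3) auto
    finally show "norm (?D Y v - ?D X v) \<le> \<eta> * norm3 v" by simp
  qed
qed

lemma good_step_lipschitz:
  assumes good: "\<And>X. X \<in> transition s0 s1 s2 \<Longrightarrow> good_step e s1 X"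
    and X: "X \<in> transition s0 s1 s2" and Y: "Y \<in> transition s0 s1 s2"
  shows "norm (step_map (sign_of s1) (e, X) - step_map (sign_of s1) (e, Y)) \<le> 9 / 10 * norm3 (X - Y)"
proof -
  let ?K = "transition s0 s1 s2" and ?F = "step_map (sign_of s1)"
  let ?D = "slice_derivative ?F e"
  have cK: "convex ?K" unfolding transition_def by (intro convex_Times convex_state_box)
  define c where "c t = Y + t *\<^sub>R (X - Y)" for t :: real
  have cm: "c t \<in> ?K" if "t \<in> {0..1}" for t
  proof -
    have "c t = (1 - t) *\<^sub>R Y + t *\<^sub>R X" by (simp add: c_def algebra_simps)
    thus ?thesis using that convexD_alt[OF cK Y X, of t] by simp
  qed
  have "norm (?F (e, c 1) - ?F (e, c 0)) \<le> 9 / 10 * norm3 (X - Y) * norm (1 - 0 :: real)"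
  proof (rule differentiable_bound[where S = "{0..1}" and f = "\<lambda>t. ?F (e, c t)" and f' = "\<lambda>t h. ?D (c t) (h *\<^sub>R (X - Y))"])
    show "((\<lambda>t. ?F (e, c t)) has_derivative (\<lambda>h. ?D (c t) (h *\<^sub>R (X - Y)))) (at t within {0..1})"
      if "t \<in> {0..1}" for t
    proof -
      have "(c has_derivative (\<lambda>h. h *\<^sub>R (X - Y))) (at t within {0..1})"
        unfolding c_def[abs_def] by (auto intro!: derivative_eq_intros)
      moreover have "((\<lambda>x. ?F (e, x)) has_derivative ?D (c t)) (at (c t))"
        by (rule has_derivative_slice) (use good[OF cm[OF that]] in \<open>simp add: good_step_def\<close>)
      ultimately show ?thesis by (rule has_derivative_compose)
    qed
    show "onorm (\<lambda>h. ?D (c t) (h *\<^sub>R (X - Y))) \<le> 9 / 10 * norm3 (X - Y)" if "t \<in> {0..1}" for t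
    proof (rule onorm_le)
      fix h :: real
      have "norm (?D (c t) (h *\<^sub>R (X - Y))) = \<bar>h\<bar> * norm (?D (c t) (X - Y))"
        by (simp add: blinfun.scaleR_right)
      also have "\<dots> \<le> \<bar>h\<bar> * (9 / 10 * norm3 (X - Y))"
      proof (rule mult_left_mono)
        show "norm (?D (c t) (X - Y)) \<le> 9 / 10 * norm3 (X - Y)"
          using good[OF cm[OF that]] unfolding good_step_def by blast
      qed simp
      finally show "norm (?D (c t) (h *\<^sub>R (X - Y))) \<le> 9 / 10 * norm3 (X - Y) * norm h"
        by (simp add: mult_ac)
    qed
  qed auto
  thus ?thesis by (simp add: c_def)
qed

lemma finite_common_radius:
  fixes P :: "'a \<Rightarrow> real \<Rightarrow> bool"
  assumes "finite S" and ex: "\<And>c. c \<in> S \<Longrightarrow> \<exists>\<delta>>0. P c \<delta>"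
    and mono: "\<And>c \<delta> \<delta>'. P c \<delta> \<Longrightarrow> \<delta>' \<le> \<delta> \<Longrightarrow> P c \<delta>'"
  shows "\<exists>\<delta>>0. \<forall>c\<in>S. P c \<delta>"
  using assms(1) ex
proof (induction S rule: finite_induct)
  case empty
  show ?case using zero_less_one by blast
next
  case (insert c S)
  obtain d1 where "d1 > 0" "P c d1" using insert.prems by blast
  moreover obtain d2 where "d2 > 0" "\<forall>c\<in>S. P c d2" using insert by blast
  ultimately show ?case using mono by (intro exI[of _ "min d1 d2"]) (auto intro: mono)
qed

text \<open>The reference angles of the heteroclinic orbit.\<close>

definition itinerary :: "int \<Rightarrow> real" where
  "itinerary n = (if n \<le> 0 then 0 else pi / 2)"

lemma itinerary_mem: "itinerary n \<in> symbols"
  by (simp add: itinerary_def symbols_def)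

text \<open>The entry fraction at time \<open>n\<close> is stored in the state of time \<open>n - 1\<close>.\<close>

definition section_state :: "(int \<Rightarrow> state) \<Rightarrow> int \<Rightarrow> real \<times> real" where
  "section_state U n = (angle_of (U n), next_fraction_of (U (n - 1)))"

text \<open>A regular arc of orbits that approach \<open>P\<close> at a common geometric rate.\<close>

lemma stable_tangent_lineI:
  fixes u :: "nat \<Rightarrow> real \<Rightarrow> 'a::real_normed_vector"
  assumes d: "\<And>s. s \<in> {-1<..<1} \<Longrightarrow> (u 0 has_vector_derivative d s) (at s)"
    and c: "continuous_on {-1<..<1} d" and nz: "\<And>s. s \<in> {-1<..<1} \<Longrightarrow> d s \<noteq> 0"
    and orbit: "\<And>s k. s \<in> {-1<..<1} \<Longrightarrow> S (u k s) (u (Suc k) s)"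
    and tail: "\<And>s k. s \<in> {-1<..<1} \<Longrightarrow> dist (u k s) P \<le> C * (9 / 10) ^ k"
  shows "stable_tangent_line S P (u 0 0) (span {d 0})"
  unfolding stable_tangent_line_def
proof (intro exI[of _ "u 0"] exI[of _ u] conjI ballI allI)
  have v: "vector_derivative (u 0) (at s) = d s" if "s \<in> {-1<..<1}" for s
    by (rule vector_derivative_at[OF d[OF that]])
  show "u 0 C1_differentiable_on {-1<..<1}" using d c unfolding C1_differentiable_on_def by blast
  show "vector_derivative (u 0) (at s) \<noteq> 0" if "s \<in> {-1<..<1}" for s using v nz that by simp
  show "span {d 0} = span {vector_derivative (u 0) (at 0)}" using v[of 0] by simp
  show "uniform_limit {-1<..<1} u (\<lambda>_. P) sequentially"
  proof (rule uniform_limitI)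
    fix r :: real assume "0 < r"
    have "(\<lambda>k. C * (9 / 10) ^ k) \<longlonglongrightarrow> 0"
      by (auto intro!: tendsto_eq_intros LIMSEQ_power_zero)
    hence "\<forall>\<^sub>F k in sequentially. C * (9 / 10) ^ k < r"
      using \<open>0 < r\<close> by (rule order_tendstoD(2))
    thus "\<forall>\<^sub>F k in sequentially. \<forall>s\<in>{-1<..<1}. dist (u k s) P < r"
      by eventually_elim (use tail in \<open>blast intro: le_less_trans\<close>)
  qed
qed (use orbit in auto)

text \<open>The properties of the model that hold for all sufficiently small \<open>e > 0\<close>.\<close>

locale weakly_elliptic =
  fixes e :: real
  assumes e: "0 < e" "e < 1"
    and good: "s0 \<in> symbols \<Longrightarrow> s1 \<in> symbols \<Longrightarrow> s2 \<in> symbols \<Longrightarrow> X \<in> transition s0 s1 s2 \<Longrightarrow> good_step e s1 X"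
    and branch: "\<bar>\<theta>\<bar> \<le> 3 \<Longrightarrow> \<bar>p\<bar> \<le> 995 / 1000 \<Longrightarrow> \<bar>exit_fraction e \<theta> p\<bar> \<le> 99 / 100 \<Longrightarrow> in_branch e (\<theta>, p)"
    and exit_C1: "x \<in> {- 3..3} \<times> {- (995 / 1000)..995 / 1000} \<Longrightarrow>
       C1_at (\<lambda>X. exit_fraction (fst X) (fst (snd X)) (snd (snd X))) (e, x)"
    and saddles: "saddle_of_return_map (1 + e) (1/2) (e/16) (0, 0)" "saddle_of_return_map (1 + e) (1/2) (e/16) (pi / 2, 0)"
begin

abbreviation "returns \<equiv> return_rel (1 + e) (1/2) (e/16)"
abbreviation "B n \<equiv> state_box (itinerary n)"
abbreviation "F n X \<equiv> step_map (sign_of (itinerary n)) (e, X)"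
abbreviation "F' n X \<equiv> blinfun_apply (slice_derivative (step_map (sign_of (itinerary n))) e X)"

lemma windows_eq: "windows B n = transition (itinerary (n - 1)) (itinerary n) (itinerary (n + 1))"
  by (simp add: windows_def transition_def)

lemma good_window: "X \<in> windows B n \<Longrightarrow> good_step e (itinerary n) X"
  unfolding windows_eq by (rule good[OF itinerary_mem itinerary_mem itinerary_mem])

lemma box_norm: "u \<in> B n \<Longrightarrow> norm u \<le> 4"
proof -
  assume u: "u \<in> B n"
  have "\<bar>itinerary n\<bar> \<le> 2" using pi_less_4 by (simp add: itinerary_def)
  hence "\<bar>fst u\<bar> \<le> 3" "\<bar>fst (snd u)\<bar> \<le> 1 / 4" "\<bar>snd (snd u)\<bar> \<le> 1 / 4"
    using u unfolding state_box_iff angle_of_def exit_of_def next_fraction_of_def by linarith+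
  moreover have "norm u \<le> norm (fst u) + (norm (fst (snd u)) + norm (snd (snd u)))"
  proof -
    obtain a b c where "u = (a, b, c)" by (cases u) auto
    thus ?thesis using norm_Pair_le[of a "(b, c)"] norm_Pair_le[of b c] by simp
  qed
  ultimately show ?thesis by simp
qed

sublocale contracting_chain B F F' "9 / 10" 4
proof (rule contracting_chain.intro)
  show "closed (B n)" for n by (rule compact_imp_closed[OF compact_state_box])
  show "norm x \<le> 4" if "x \<in> B n" for x n by (rule box_norm[OF that])
  show "F n X \<in> B n" if "X \<in> windows B n" for X n
    using good_window[OF that] unfolding good_step_def state_box_iff by auto
  show "norm (F n X - F n Y) \<le> 9 / 10 * norm3 (X - Y)" if "X \<in> windows B n" "Y \<in> windows B n" for X Y n
    using that unfolding windows_eq by (intro good_step_lipschitz) (auto intro: good itinerary_mem)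
  show "linear (F' n X)" for n X by (simp add: bounded_linear.linear[OF blinfun.bounded_linear_right])
  show "norm (F' n X v) \<le> 9 / 10 * norm3 v" if "X \<in> windows B n" for X n v
    using good_window[OF that] unfolding good_step_def by blast
  fix \<eta> :: real assume \<eta>: "0 < \<eta>"
  have "\<exists>\<delta>>0. \<forall>c\<in>symbols \<times> symbols \<times> symbols. step_modulus e \<eta> c \<delta>"
  proof (rule finite_common_radius)
    show "finite (symbols \<times> symbols \<times> symbols)" by (simp add: symbols_def)
    show "\<exists>\<delta>>0. step_modulus e \<eta> c \<delta>" if "c \<in> symbols \<times> symbols \<times> symbols" for c
    proof -
      obtain s0 s1 s2 where c: "c = (s0, s1, s2)" "s0 \<in> symbols" "s1 \<in> symbols" "s2 \<in> symbols"
        using \<open>c \<in> _\<close> by auto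
      show ?thesis unfolding c(1)
        by (rule good_step_uniformly_C1[OF good[OF c(2-4)] \<eta>])
    qed
    show "step_modulus e \<eta> c \<delta>'" if "step_modulus e \<eta> c \<delta>" "\<delta>' \<le> \<delta>" for c \<delta> \<delta>'
      using that unfolding step_modulus_def Let_def by (cases c) (auto; meson less_le_trans)
  qed
  then obtain \<delta> where \<delta>: "\<delta> > 0" "\<And>c. c \<in> symbols \<times> symbols \<times> symbols \<Longrightarrow> step_modulus e \<eta> c \<delta>" by blast
  have "step_modulus e \<eta> (itinerary (n - 1), itinerary n, itinerary (n + 1)) \<delta>" for n
    by (rule \<delta>) (simp add: itinerary_mem)
  thus "\<exists>\<delta>>0. \<forall>n. \<forall>X\<in>windows B n. \<forall>Y\<in>windows B n. norm3 (Y - X) < \<delta> \<longrightarrow>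
        norm (F n Y - F n X - F' n X (Y - X)) \<le> \<eta> * norm3 (Y - X) \<and>
        (\<forall>v. norm (F' n Y v - F' n X v) \<le> \<eta> * norm3 v)"
    using \<delta>(1) unfolding windows_eq step_modulus_def prod.case Let_def by blast
qed simp_all


lemma solves_state_box: "solves A U \<Longrightarrow> U n \<in> B n"
  by (simp add: solves_def)

lemma window_solves: "solves A U \<Longrightarrow> window U n \<in> windows B n"
  by (intro window_mem solves_state_box)

lemma angle_le_3:
  assumes "u \<in> B n" shows "\<bar>angle_of u\<bar> \<le> 3"
proof -
  have "\<bar>itinerary n\<bar> \<le> 2" using pi_less_4 by (simp add: itinerary_def)
  moreover have "\<bar>angle_of u - itinerary n\<bar> \<le> 65 / 1000" using assms by (simp add: state_box_iff)
  ultimately show ?thesis by linarith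
qed

text \<open>The three components of the equation are read backwards. The second one gives
  \<open>w = inv_twist D\<close> for the mismatch \<open>D\<close>; applying \<open>twist\<close>, which is legitimate because
  \<open>\<bar>D\<bar> < 2 * pi/3\<close>, leaves the equality of the angles.\<close>

lemma solution_is_orbit:
  assumes U: "solves A U" and n: "n \<in> A"
  shows "exit_fraction e (fst (section_state U n)) (snd (section_state U n)) = exit_of (U n)"
    and "in_branch e (section_state U n)"
    and "return_formula e (section_state U n) = section_state U (n + 1)"
proof -
  let ?\<sigma> = "sign_of (itinerary n)"
  define \<theta> where "\<theta> = angle_of (U n)"
  define p where "p = next_fraction_of (U (n - 1))"
  define w where "w = exit_of (U n)"
  have good: "good_step e (itinerary n) (window U n)" by (rule good_window[OF window_solves[OF U]])
  have eq: "U n = step_map ?\<sigma> (e, U (n - 1), U n, U (n + 1))"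
    using U n by (auto simp: solves_def window_def)
  have \<sigma>: "?\<sigma> \<noteq> 0" by (simp add: sign_of_def)
  have "angle_of (U n) = angle_of (step_map ?\<sigma> (e, U (n - 1), U n, U (n + 1)))" using eq by simp
  hence "?\<sigma> * (exit_fraction e \<theta> p - w) / 32 = 0"
    by (simp add: step_map_def Let_def angle_of_def \<theta>_def p_def w_def)
  hence W: "exit_fraction e \<theta> p = w" using \<sigma> by simp
  have mm: "\<bar>angle_mismatch (e, U (n - 1), U n, U (n + 1))\<bar> < 2 * pi / 3"
    using good by (simp add: good_step_def window_def)
  have "exit_of (U n) = exit_of (step_map ?\<sigma> (e, U (n - 1), U n, U (n + 1)))" using eq by simp
  hence "w = inv_twist (angle_mismatch (e, U (n - 1), U n, U (n + 1)))"
    by (simp add: step_map_def Let_def exit_of_def w_def)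
  hence "twist w = angle_mismatch (e, U (n - 1), U n, U (n + 1))" using twist_inv_twist[OF mm] by simp
  hence \<theta>': "return_angle e (exit_angle e \<theta> p) w = angle_of (U (n + 1))"
    by (simp add: angle_mismatch_def Let_def \<theta>_def p_def w_def)
  have "next_fraction_of (U n) = next_fraction_of (step_map ?\<sigma> (e, U (n - 1), U n, U (n + 1)))" using eq by simp
  hence p': "return_fraction e (exit_angle e \<theta> p) w = next_fraction_of (U n)"
    by (simp add: step_map_def Let_def next_fraction_of_def \<theta>_def p_def w_def)
  have z: "section_state U n = (\<theta>, p)" by (simp add: section_state_def \<theta>_def p_def)
  show "exit_fraction e (fst (section_state U n)) (snd (section_state U n)) = exit_of (U n)"
    using W by (simp add: z w_def)
  show "in_branch e (section_state U n)"
    unfolding z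
  proof (rule branch)
    show "\<bar>\<theta>\<bar> \<le> 3" unfolding \<theta>_def by (rule angle_le_3[OF solves_state_box[OF U]])
    show "\<bar>p\<bar> \<le> 995 / 1000" using solves_state_box[OF U, of "n - 1"] by (simp add: state_box_iff p_def)
    show "\<bar>exit_fraction e \<theta> p\<bar> \<le> 99 / 100"
      unfolding W using solves_state_box[OF U, of n] by (simp add: state_box_iff w_def)
  qed
  show "return_formula e (section_state U n) = section_state U (n + 1)"
    unfolding z by (simp add: return_formula_def Let_def W \<theta>' p' section_state_def)
qed

lemma solution_return_rel:
  assumes "solves A U" "n \<in> A"
  shows "returns (section_state U n) (section_state U (n + 1))"
  using return_rel_formula[OF e solution_is_orbit(2)[OF assms]] solution_is_orbit(3)[OF assms] by simp

lemma fixed_state: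
  assumes "s \<in> symbols"
  shows "step_map (sign_of s) (e, (s, 0, 0), (s, 0, 0), (s, 0, 0)) = (s, 0, 0)"
proof -
  note sc = symbol_bounds(3)[OF assms]
  show ?thesis
    by (simp add: step_map_def angle_mismatch_def Let_def angle_of_def exit_of_def next_fraction_of_def
        return_formula_fixed[OF sc] twist_def inv_twist_def)
qed

text \<open>Comparison with the constant chain of the fixed point at \<open>s\<close>. It solves the equations as long as
  all three reference angles of a window equal \<open>s\<close>.\<close>

lemma tail_estimate:
  assumes U: "solves A U" and s: "s \<in> symbols"
    and near: "\<And>k. \<bar>k - n\<bar> < int j \<Longrightarrow> k \<in> A \<and> itinerary (k - 1) = s \<and> itinerary k = s \<and> itinerary (k + 1) = s"
  shows "norm (U n - (s, 0, 0)) \<le> (9 / 10) ^ j * 8"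
proof (rule geometric_decay[where A = "{k \<in> A. itinerary (k - 1) = s \<and> itinerary k = s \<and> itinerary (k + 1) = s}"])
  let ?P = "(s, 0, 0) :: state"
  show "norm (U k - ?P) \<le> 8" for k
  proof -
    have "norm s \<le> 2" using symbol_bounds[OF s] by simp
    hence "norm ?P \<le> 2" by (simp add: norm_Pair)
    moreover have "norm (U k) \<le> 4" by (rule box_norm[OF solves_state_box[OF U]])
    ultimately show ?thesis using norm_triangle_ineq4[of "U k" ?P] by linarith
  qed
  show "norm (U k - ?P) \<le> 9 / 10 * max (norm (U (k - 1) - ?P)) (max (norm (U k - ?P)) (norm (U (k + 1) - ?P)))"
    if "k \<in> {k \<in> A. itinerary (k - 1) = s \<and> itinerary k = s \<and> itinerary (k + 1) = s}" for k
  proof -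
    have k: "k \<in> A" "itinerary (k - 1) = s" "itinerary k = s" "itinerary (k + 1) = s" using that by auto
    have P: "?P \<in> state_box s" by (simp add: state_box_iff angle_of_def exit_of_def next_fraction_of_def)
    have PW: "(?P, ?P, ?P) \<in> windows B k" using P k by (simp add: windows_def)
    have "U k - ?P = F k (window U k) - F k (?P, ?P, ?P)"
      using U k fixed_state[OF s] by (simp add: solves_def)
    hence "norm (U k - ?P) \<le> 9 / 10 * norm3 (window U k - (?P, ?P, ?P))"
      using lip[OF window_solves[OF U] PW] by simp
    thus ?thesis by (simp add: norm3_def window_def)
  qed
qed (use near in auto)

lemma section_state_dist:
  "dist (section_state U n) (s, 0) \<le> norm (U n - (s, 0, 0)) + 8 * norm (U (n - 1) - (s', 0, 0))"
proof -
  have "dist (section_state U n) (s, 0) \<le> \<bar>angle_of (U n) - s\<bar> + \<bar>next_fraction_of (U (n - 1))\<bar>"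
    unfolding section_state_def dist_norm using norm_Pair_le[of "angle_of (U n) - s" "next_fraction_of (U (n - 1))"] by simp
  moreover have "\<bar>angle_of (U n) - s\<bar> \<le> norm (U n - (s, 0, 0))"
    using coordinates_le_norm(1)[of "U n - (s, 0, 0)"] unfolding coordinates_diff by (simp add: angle_of_def)
  moreover have "\<bar>next_fraction_of (U (n - 1))\<bar> \<le> 8 * norm (U (n - 1) - (s', 0, 0))"
    using coordinates_le_norm(3)[of "U (n - 1) - (s', 0, 0)"] unfolding coordinates_diff by (simp add: next_fraction_of_def)
  ultimately show ?thesis by linarith
qed

text \<open>The exponent accounts for the distance of \<open>m\<close> from the jump of the itinerary and for the windows, which
  reach one index further, on both sides of the jump and in the shifted second coordinate of
  \<open>section_state\<close>.\<close>

definition tail_constant :: "int \<Rightarrow> real" where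
  "tail_constant m = 72 / (9 / 10) ^ (nat \<bar>m\<bar> + 4)"

lemma shifted_power_le: "(9 / 10 :: real) ^ (k - K) \<le> (9 / 10) ^ k / (9 / 10) ^ K"
proof (cases "K \<le> k")
  case True
  thus ?thesis by (simp add: power_diff)
next
  case False
  hence "(9 / 10 :: real) ^ K \<le> (9 / 10) ^ k" by (intro power_decreasing) auto
  thus ?thesis using False by (simp add: pos_le_divide_eq)
qed

lemma section_state_tail:
  assumes "norm (U n - (s, 0, 0)) \<le> (9 / 10) ^ (k - (nat \<bar>m\<bar> + 4)) * 8"
    "norm (U (n - 1) - (s, 0, 0)) \<le> (9 / 10) ^ (k - (nat \<bar>m\<bar> + 4)) * 8"
  shows "dist (section_state U n) (s, 0) \<le> tail_constant m * (9 / 10) ^ k"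
proof -
  have "dist (section_state U n) (s, 0) \<le> 72 * (9 / 10) ^ (k - (nat \<bar>m\<bar> + 4))"
    using section_state_dist[of U n s s] assms by linarith
  also have "\<dots> \<le> 72 * ((9 / 10) ^ k / (9 / 10) ^ (nat \<bar>m\<bar> + 4))"
    by (intro mult_left_mono shifted_power_le) simp
  finally show ?thesis by (simp add: tail_constant_def)
qed

lemma right_tail:
  assumes U: "solves A U" and A: "{m..} \<subseteq> A"
  shows "dist (section_state U (m + int k)) (pi / 2, 0) \<le> tail_constant m * (9 / 10) ^ k"
proof (rule section_state_tail)
  have s: "pi / 2 \<in> symbols" by (simp add: symbols_def)
  show "norm (U (m + int k) - (pi / 2, 0, 0)) \<le> (9 / 10) ^ (k - (nat \<bar>m\<bar> + 4)) * 8"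
    by (rule tail_estimate[OF U s]) (use A in \<open>auto simp: itinerary_def\<close>)
  show "norm (U (m + int k - 1) - (pi / 2, 0, 0)) \<le> (9 / 10) ^ (k - (nat \<bar>m\<bar> + 4)) * 8"
    by (rule tail_estimate[OF U s]) (use A in \<open>auto simp: itinerary_def\<close>)
qed

lemma left_tail:
  assumes U: "solves A U" and A: "{..<m} \<subseteq> A"
  shows "dist (section_state U (m - int k)) (0, 0) \<le> tail_constant m * (9 / 10) ^ k"
proof (rule section_state_tail)
  have s: "0 \<in> symbols" by (simp add: symbols_def)
  show "norm (U (m - int k) - (0, 0, 0)) \<le> (9 / 10) ^ (k - (nat \<bar>m\<bar> + 4)) * 8"
    by (rule tail_estimate[OF U s]) (use A in \<open>auto simp: itinerary_def\<close>)
  show "norm (U (m - int k - 1) - (0, 0, 0)) \<le> (9 / 10) ^ (k - (nat \<bar>m\<bar> + 4)) * 8"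
    by (rule tail_estimate[OF U s]) (use A in \<open>auto simp: itinerary_def\<close>)
qed

lemma tail_tendsto: "(\<lambda>k. tail_constant m * (9 / 10) ^ k) \<longlonglongrightarrow> 0"
  by (auto intro!: tendsto_eq_intros LIMSEQ_power_zero)

definition arc_radius :: real where "arc_radius = 1 / 4000"

context
  fixes U :: "int \<Rightarrow> state"
  assumes U: "solves UNIV U"
begin

lemma U_room: "\<bar>angle_of (U n) - itinerary n\<bar> \<le> 64 / 1000" "\<bar>exit_of (U n)\<bar> \<le> 99 / 100"
  "\<bar>next_fraction_of (U n)\<bar> \<le> 9945 / 10000"
proof -
  have "U n = F n (window U n)" using U by (simp add: solves_def)
  moreover have "good_step e (itinerary n) (window U n)" by (rule good_window[OF window_solves[OF U]])
  ultimately show "\<bar>angle_of (U n) - itinerary n\<bar> \<le> 64 / 1000" "\<bar>exit_of (U n)\<bar> \<le> 99 / 100"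
    "\<bar>next_fraction_of (U n)\<bar> \<le> 9945 / 10000"
    unfolding good_step_def by metis+
qed

text \<open>A solution on all indices lies in the image of the step map, hence well inside the boxes.\<close>

lemma perturbed_box:
  assumes "\<bar>a\<bar> \<le> arc_radius" "\<bar>p\<bar> \<le> arc_radius"
  shows "U n + (a, 0, p / 8) \<in> B n"
proof -
  have "angle_of (U n + (a, 0, p / 8)) = angle_of (U n) + a" "exit_of (U n + (a, 0, p / 8)) = exit_of (U n)"
    "next_fraction_of (U n + (a, 0, p / 8)) = next_fraction_of (U n) + p"
    by (simp_all add: angle_of_def exit_of_def next_fraction_of_def)
  note eqs = this
  show ?thesis
    unfolding state_box_iff eqs using U_room[of n] assms unfolding arc_radius_def by (intro conjI; linarith)
qed

lemma restricted: "solves A U"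
  using U unfolding solves_def by blast

text \<open>One component of the boundary data is moved along a line while the rest stays at \<open>U\<close>; by uniqueness
  the solution at parameter \<open>0\<close> is \<open>U\<close> itself.\<close>

lemma solutions_through:
  assumes i: "i \<notin> A" and \<beta>: "norm \<beta> \<le> K" and room: "\<And>s. s \<in> {-1<..<1} \<Longrightarrow> U i + s *\<^sub>R \<beta> \<in> B i"
  obtains W V where "\<And>s. s \<in> {-1<..<1} \<Longrightarrow> solves A (W s)" "W 0 = U"
    "\<And>s m. s \<in> {-1<..<1} \<Longrightarrow> ((\<lambda>s. section_state (W s) m) has_vector_derivative section_state (V s) m) (at s)"
    "\<And>m. continuous_on {-1<..<1} (\<lambda>s. section_state (V s) m)"
    "\<And>s. s \<in> {-1<..<1} \<Longrightarrow> V s i = \<beta>"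
    "\<And>s n. s \<in> {-1<..<1} \<Longrightarrow> n \<in> A \<Longrightarrow> norm (V s n) \<le> 9 / 10 * K"
proof -
  define b where "b n = (if n = i then \<beta> else 0)" for n
  have "0 \<le> K" using \<beta> norm_ge_zero order_trans by blast
  hence nb: "norm (b n) \<le> K" for n using \<beta> by (simp add: b_def)
  have box: "U n + s *\<^sub>R b n \<in> B n" if "s \<in> {-1<..<1}" for s n
    using room[OF that] solves_state_box[OF U] by (simp add: b_def)
  obtain W V where W: "\<And>s. s \<in> {-1<..<1} \<Longrightarrow> solves A (W s)"
    "\<And>s n. s \<in> {-1<..<1} \<Longrightarrow> n \<notin> A \<Longrightarrow> W s n = U n + s *\<^sub>R b n"
    "\<And>s n. s \<in> {-1<..<1} \<Longrightarrow> ((\<lambda>s. W s n) has_vector_derivative V s n) (at s)"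
    "\<And>n. continuous_on {-1<..<1} (\<lambda>s. V s n)"
    "\<And>s n. s \<in> {-1<..<1} \<Longrightarrow> n \<notin> A \<Longrightarrow> V s n = b n"
    "\<And>s n. s \<in> {-1<..<1} \<Longrightarrow> n \<in> A \<Longrightarrow> norm (V s n) \<le> 9 / 10 * K"
    using solution_arc[OF box nb, of A] by blast
  show thesis
  proof (rule that[OF W(1)])
    show "W 0 = U"
      by (rule solves_unique[OF W(1) restricted]) (use W(2)[of 0] in auto)
    show "((\<lambda>s. section_state (W s) m) has_vector_derivative section_state (V s) m) (at s)"
      if "s \<in> {-1<..<1}" for s m
      unfolding section_state_def
      by (intro has_vector_derivative_Pair bounded_linear.has_vector_derivative[OF bounded_linear_coordinates(1)]
          bounded_linear.has_vector_derivative[OF bounded_linear_coordinates(3)] W(3)[OF that])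
    show "continuous_on {-1<..<1} (\<lambda>s. section_state (V s) m)" for m
      unfolding section_state_def
      by (intro continuous_on_Pair bounded_linear.continuous_on[OF bounded_linear_coordinates(1)]
          bounded_linear.continuous_on[OF bounded_linear_coordinates(3)] W(4))
    show "V s i = \<beta>" if "s \<in> {-1<..<1}" for s
      using W(5)[OF that i] by (simp add: b_def)
  qed (use W(6) in auto)
qed

lemma scaled_radius_le: "s \<in> {-1<..<1} \<Longrightarrow> \<bar>s * arc_radius\<bar> \<le> arc_radius"
  by (auto simp: arc_radius_def abs_mult)

text \<open>Moving the entry fraction \<open>p\<^sub>m\<close>, a part of the state of time \<open>m - 1\<close>, and keeping the equations from \<open>m\<close> on. The
  contraction bounds the response of the angle.\<close>

lemma stable_line:
  "\<exists>a. \<bar>a\<bar> \<le> 9 / 10 * (arc_radius / 8) \<and>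
     stable_tangent_line returns (pi / 2, 0) (section_state U m) (span {(a, arc_radius)})"
proof -
  have room: "U (m - 1) + s *\<^sub>R (0, 0, arc_radius / 8) \<in> B (m - 1)" if "s \<in> {-1<..<1}" for s
    using perturbed_box[of 0 "s * arc_radius" "m - 1"] scaled_radius_le[OF that] by (simp add: arc_radius_def)
  have \<beta>: "norm (0, 0, arc_radius / 8) \<le> arc_radius / 8" by (simp add: arc_radius_def norm_Pair)
  have i: "m - 1 \<notin> {m..}" by simp
  obtain W V where W: "\<And>s. s \<in> {-1<..<1} \<Longrightarrow> solves {m..} (W s)" "W 0 = U"
    and d: "\<And>s n. s \<in> {-1<..<1} \<Longrightarrow> ((\<lambda>s. section_state (W s) n) has_vector_derivative section_state (V s) n) (at s)"
    and c: "\<And>n. continuous_on {-1<..<1} (\<lambda>s. section_state (V s) n)"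
    and V: "\<And>s. s \<in> {-1<..<1} \<Longrightarrow> V s (m - 1) = (0, 0, arc_radius / 8)"
    "\<And>s n. s \<in> {-1<..<1} \<Longrightarrow> n \<in> {m..} \<Longrightarrow> norm (V s n) \<le> 9 / 10 * (arc_radius / 8)"
    using solutions_through[OF i \<beta> room] by blast
  have tangent: "section_state (V s) m = (angle_of (V s m), arc_radius)" if "s \<in> {-1<..<1}" for s
    using V(1)[OF that] by (simp add: section_state_def next_fraction_of_def)
  have "stable_tangent_line returns (pi / 2, 0) (section_state (W 0) (m + int 0)) (span {section_state (V 0) m})"
  proof (rule stable_tangent_lineI[where u = "\<lambda>k s. section_state (W s) (m + int k)" and C = "tail_constant m"])
    show "((\<lambda>s. section_state (W s) (m + int 0)) has_vector_derivative section_state (V s) m) (at s)"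
      if "s \<in> {-1<..<1}" for s using d[OF that, of m] by simp
    show "section_state (V s) m \<noteq> 0" if "s \<in> {-1<..<1}" for s
      unfolding tangent[OF that] by (simp add: arc_radius_def zero_prod_def)
    show "returns (section_state (W s) (m + int k)) (section_state (W s) (m + int (Suc k)))"
      if "s \<in> {-1<..<1}" for s k
      using solution_return_rel[OF W(1)[OF that], of "m + int k"] by (simp add: algebra_simps)
    show "dist (section_state (W s) (m + int k)) (pi / 2, 0) \<le> tail_constant m * (9 / 10) ^ k"
      if "s \<in> {-1<..<1}" for s k by (rule right_tail[OF W(1)[OF that] order_refl])
  qed (rule c)
  moreover have "\<bar>angle_of (V 0 m)\<bar> \<le> 9 / 10 * (arc_radius / 8)"
    using coordinates_le_norm(1)[of "V 0 m"] V(2)[of 0 m] by simp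
  ultimately show ?thesis using tangent[of 0] W(2) by auto
qed

text \<open>Moving the angle \<open>\<theta>\<^sub>m\<close> and keeping the equations before \<open>m\<close>. The contraction bounds the response of
  the fraction \<open>p\<^sub>m\<close>; the factor \<open>8\<close> is its weight.\<close>

lemma unstable_line:
  "\<exists>b. \<bar>b\<bar> \<le> 8 * (9 / 10 * arc_radius) \<and>
     unstable_tangent_line returns (0, 0) (section_state U m) (span {(arc_radius, b)})"
proof -
  have room: "U m + s *\<^sub>R (arc_radius, 0, 0) \<in> B m" if "s \<in> {-1<..<1}" for s
    using perturbed_box[of "s * arc_radius" 0 m] scaled_radius_le[OF that] by (simp add: arc_radius_def)
  have \<beta>: "norm (arc_radius, 0 :: real, 0 :: real) \<le> arc_radius" by (simp add: arc_radius_def norm_Pair)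
  have i: "m \<notin> {..<m}" by simp
  obtain W V where W: "\<And>s. s \<in> {-1<..<1} \<Longrightarrow> solves {..<m} (W s)" "W 0 = U"
    and d: "\<And>s n. s \<in> {-1<..<1} \<Longrightarrow> ((\<lambda>s. section_state (W s) n) has_vector_derivative section_state (V s) n) (at s)"
    and c: "\<And>n. continuous_on {-1<..<1} (\<lambda>s. section_state (V s) n)"
    and V: "\<And>s. s \<in> {-1<..<1} \<Longrightarrow> V s m = (arc_radius, 0, 0)"
    "\<And>s n. s \<in> {-1<..<1} \<Longrightarrow> n \<in> {..<m} \<Longrightarrow> norm (V s n) \<le> 9 / 10 * arc_radius"
    using solutions_through[OF i \<beta> room] by blast
  have tangent: "section_state (V s) m = (arc_radius, next_fraction_of (V s (m - 1)))" if "s \<in> {-1<..<1}" for s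
    using V(1)[OF that] by (simp add: section_state_def angle_of_def)
  have "stable_tangent_line returns\<inverse>\<inverse> (0, 0) (section_state (W 0) (m - int 0)) (span {section_state (V 0) m})"
  proof (rule stable_tangent_lineI[where u = "\<lambda>k s. section_state (W s) (m - int k)" and C = "tail_constant m"])
    show "((\<lambda>s. section_state (W s) (m - int 0)) has_vector_derivative section_state (V s) m) (at s)"
      if "s \<in> {-1<..<1}" for s using d[OF that, of m] by simp
    show "section_state (V s) m \<noteq> 0" if "s \<in> {-1<..<1}" for s
      unfolding tangent[OF that] by (simp add: arc_radius_def zero_prod_def)
    show "returns\<inverse>\<inverse> (section_state (W s) (m - int k)) (section_state (W s) (m - int (Suc k)))"
      if "s \<in> {-1<..<1}" for s k
      using solution_return_rel[OF W(1)[OF that], of "m - int (Suc k)"] by (simp add: algebra_simps)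
    show "dist (section_state (W s) (m - int k)) (0, 0) \<le> tail_constant m * (9 / 10) ^ k"
      if "s \<in> {-1<..<1}" for s k by (rule left_tail[OF W(1)[OF that] order_refl])
  qed (rule c)
  moreover have "\<bar>next_fraction_of (V 0 (m - 1))\<bar> \<le> 8 * (9 / 10 * arc_radius)"
    using coordinates_le_norm(3)[of "V 0 (m - 1)"] V(2)[of 0 "m - 1"] by simp
  ultimately show ?thesis unfolding unstable_tangent_line_def using tangent[of 0] W(2) by auto
qed

text \<open>Parallel directions would give \<open>arc_radius\<^sup>2 = a * b\<close>, whereas \<open>\<bar>a * b\<bar>\<close> is at most
  \<open>(9/10)\<^sup>2 * arc_radius\<^sup>2\<close>: the weights cancel.\<close>

lemma distinct_lines:
  assumes "\<bar>a\<bar> \<le> 9 / 10 * (arc_radius / 8)" "\<bar>b\<bar> \<le> 8 * (9 / 10 * arc_radius)"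
  shows "span {(arc_radius, b)} \<noteq> span {(a, arc_radius)}"
proof
  assume "span {(arc_radius, b)} = span {(a, arc_radius)}"
  hence "(a, arc_radius) \<in> span {(arc_radius, b)}" by (simp add: span_base)
  then obtain c where "a = c * arc_radius" "arc_radius = c * b" by (auto simp: span_singleton)
  hence "arc_radius * arc_radius = a * b" by simp
  moreover have "\<bar>a * b\<bar> \<le> (9 / 10 * (arc_radius / 8)) * (8 * (9 / 10 * arc_radius))"
    unfolding abs_mult using assms by (intro mult_mono) auto
  ultimately show False by (simp add: arc_radius_def)
qed

lemma solution_heteroclinic:
  "transverse_heteroclinic_orbit (1 + e) (1/2) (e/16) (0, 0) (pi / 2, 0) (section_state U)"
proof -
  have rel: "returns (section_state U n) (section_state U (n + 1))" for n
    by (rule solution_return_rel[OF U]) simp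
  have "section_state U n \<in> stable_set returns (pi / 2, 0)" for n
    unfolding stable_set_def mem_Collect_eq
  proof (intro exI[of _ "\<lambda>k. section_state U (n + int k)"] conjI allI)
    show "returns (section_state U (n + int k)) (section_state U (n + int (Suc k)))" for k
      using rel[of "n + int k"] by (simp add: algebra_simps)
    show "(\<lambda>k. section_state U (n + int k)) \<longlonglongrightarrow> (pi / 2, 0)"
      by (rule metric_tendsto_imp_tendsto[OF tail_tendsto[of n]])
        (use right_tail[OF U, of n] in \<open>auto simp: tail_constant_def\<close>)
  qed simp
  moreover have "section_state U n \<in> unstable_set returns (0, 0)" for n
    unfolding unstable_set_def stable_set_def mem_Collect_eq
  proof (intro exI[of _ "\<lambda>k. section_state U (n - int k)"] conjI allI)
    show "returns\<inverse>\<inverse> (section_state U (n - int k)) (section_state U (n - int (Suc k)))" for k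
      using rel[of "n - int (Suc k)"] by (simp add: algebra_simps)
    show "(\<lambda>k. section_state U (n - int k)) \<longlonglongrightarrow> (0, 0)"
      by (rule metric_tendsto_imp_tendsto[OF tail_tendsto[of n]])
        (use left_tail[OF U, of n] in \<open>auto simp: tail_constant_def\<close>)
  qed simp
  moreover have "\<exists>Lu Ls. unstable_tangent_line returns (0, 0) (section_state U n) Lu \<and>
      stable_tangent_line returns (pi / 2, 0) (section_state U n) Ls \<and> Lu \<noteq> Ls" for n
    using stable_line[of n] unstable_line[of n] distinct_lines by metis
  ultimately show ?thesis
    unfolding transverse_heteroclinic_orbit_def using saddles rel by blast
qed

lemma solution_exponential_tails: "exponential_tails (section_state U) (0, 0) (pi / 2, 0)"
  unfolding exponential_tails_def
  using left_tail[OF U, of 0] right_tail[OF U, of 0]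
  by (intro exI[of _ "tail_constant 0"] exI[of _ "9 / 10"]) simp

text \<open>The orbit stays in a closed set that is cut out by non-strict inequalities and contained in the regular domain.\<close>

lemma solution_uniformly_regular: "uniformly_regular_orbit (1 + e) (1/2) (e/16) (section_state U)"
proof -
  let ?R = "{- 3..3} \<times> {- (995 / 1000)..995 / 1000 :: real}"
  define K where "K = ?R \<inter> (\<lambda>x. exit_fraction e (fst x) (snd x)) -` {- (99 / 100)..99 / 100}"
  have "continuous_on ?R (\<lambda>x. exit_fraction e (fst x) (snd x))"
    using has_derivative_continuous[OF has_derivative_slice[OF exit_C1]]
    by (intro continuous_at_imp_continuous_on) simp
  hence K: "closed K" unfolding K_def
    by (rule continuous_closed_preimage) (auto intro: closed_Times)
  have fraction: "\<bar>snd (section_state U n)\<bar> \<le> 995 / 1000"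
    and exit: "\<bar>exit_fraction e (fst (section_state U n)) (snd (section_state U n))\<bar> \<le> 99 / 100" for n
    using U_room[of "n - 1"] U_room[of n] solution_is_orbit(1)[OF U, of n] by (auto simp: section_state_def)
  have "section_state U n \<in> K" for n
  proof -
    obtain a p where z: "section_state U n = (a, p)" and a: "a = angle_of (U n)"
      by (simp add: section_state_def)
    show ?thesis
      using fraction[of n] exit[of n] angle_le_3[OF solves_state_box[OF U], of n]
      unfolding z a[symmetric] by (auto simp: K_def abs_le_iff)
  qed
  hence sub: "closure (range (section_state U)) \<subseteq> K"
    by (intro closure_minimal K) auto
  moreover have "K \<subseteq> regular_domain (1 + e) (1/2) (e/16)"
  proof
    fix x assume "x \<in> K"
    hence "in_branch e x" by (cases x) (auto simp: K_def abs_le_iff intro!: branch)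
    thus "x \<in> regular_domain (1 + e) (1/2) (e/16)"
      unfolding regular_domain_def using return_rel_formula[OF e] by blast
  qed
  moreover have "bounded K"
    unfolding K_def by (rule bounded_subset[of ?R]) (auto intro!: bounded_Times)
  hence "compact (closure (range (section_state U)))"
    using sub by (meson bounded_subset compact_eq_bounded_closed closed_closure)
  moreover have "regular_branch (1 + e) (1/2) (e/16) (section_state U n)
      (exit_fraction e (fst (section_state U n)) (snd (section_state U n))) (section_state U (n + 1))" for n
    using regular_branch_formula[OF e solution_is_orbit(2)[OF U, of n]] solution_is_orbit(3)[OF U, of n] by simp
  hence "\<forall>n. \<exists>w. regular_branch (1 + e) (1/2) (e/16) (section_state U n) w (section_state U (n + 1)) \<and>
      \<bar>snd (section_state U n)\<bar> \<le> 1 - 5 / 1000 \<and> \<bar>w\<bar> \<le> 1 - 5 / 1000"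
  proof (intro allI exI conjI)
    fix n
    show "\<bar>snd (section_state U n)\<bar> \<le> 1 - 5 / 1000" using fraction[of n] by linarith
    show "\<bar>exit_fraction e (fst (section_state U n)) (snd (section_state U n))\<bar> \<le> 1 - 5 / 1000"
      using exit[of n] by linarith
  qed
  ultimately show ?thesis
    unfolding uniformly_regular_orbit_def by (intro conjI exI[of _ "5 / 1000"]) auto
qed

end

lemma heteroclinic_solution_exists: "\<exists>U. solves UNIV U"
proof -
  have "(itinerary n, 0, 0) \<in> B n" for n
    by (simp add: state_box_iff angle_of_def exit_of_def next_fraction_of_def)
  from solves_exists[of "\<lambda>n. (itinerary n, 0, 0)" UNIV, OF this] show ?thesis by blast
qed

end

theorem proposition5p2:
  shows "\<forall>\<^sub>F \<epsilon> in at_right (0::real).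
    \<exists>z :: int \<Rightarrow> real \<times> real.
      transverse_heteroclinic_orbit (1 + \<epsilon>) (1 / 2) (\<epsilon> / 16) (0, 0) (pi / 2, 0) z \<and>
      exponential_tails z (0, 0) (pi / 2, 0) \<and>
      uniformly_regular_orbit (1 + \<epsilon>) (1 / 2) (\<epsilon> / 16) z"
proof -
  have pos: "\<forall>\<^sub>F e in at_right 0. e \<in> {0<..<1::real}"
    by (rule eventually_at_right_real) simp
  have good: "\<forall>\<^sub>F e in at_right 0. \<forall>(s0, s1, s2)\<in>symbols \<times> symbols \<times> symbols. \<forall>X\<in>transition s0 s1 s2. good_step e s1 X"
  proof (rule eventually_ball_finite)
    show "finite (symbols \<times> symbols \<times> symbols)" by (simp add: symbols_def)
    show "\<forall>c\<in>symbols \<times> symbols \<times> symbols. \<forall>\<^sub>F e in at_right 0.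
        case c of (s0, s1, s2) \<Rightarrow> \<forall>X\<in>transition s0 s1 s2. good_step e s1 X"
      by (auto intro: eventually_good_step)
  qed
  have X: "\<forall>\<^sub>F e in at_right 0. saddle_of_return_map (1 + e) (1/2) (e/16) (0, 0)"
    by (rule eventually_saddle[where \<kappa> = 1]) simp_all
  have "\<bar>pi / 2\<bar> < 3" using pi_less_4 by simp
  hence Y: "\<forall>\<^sub>F e in at_right 0. saddle_of_return_map (1 + e) (1/2) (e/16) (pi / 2, 0)"
    by (intro eventually_saddle[where \<kappa> = "-1"]) simp_all
  show ?thesis
    using pos good eventually_in_branch eventually_exit_fraction_continuous X Y
  proof eventually_elim
    case (elim e)
    interpret weakly_elliptic e
    proof
      show "0 < e" "e < 1" using elim(1) by auto
      show "good_step e s1 X" if "s0 \<in> symbols" "s1 \<in> symbols" "s2 \<in> symbols" "X \<in> transition s0 s1 s2" for s0 s1 s2 X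
        using elim(2) that by blast
      show "in_branch e (\<theta>, p)" if "\<bar>\<theta>\<bar> \<le> 3" "\<bar>p\<bar> \<le> 995 / 1000" "\<bar>exit_fraction e \<theta> p\<bar> \<le> 99 / 100" for \<theta> p
        using elim(3) that by blast
    qed (use elim in blast)+
    obtain U where "solves UNIV U" using heteroclinic_solution_exists by blast
    thus ?case
      using solution_heteroclinic solution_exponential_tails solution_uniformly_regular
      by (intro exI[of _ "section_state U"]) simp
  qed
qed

end
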